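(* There is a positive constant $C$ such that for every $r\in[0,\tfrac12)$, $$N(r)\le C\left(\tfrac12-r\right)^{-4/5}.$$ Consequently, every assemblage generated from $\omega_r$ by projective measurements on Alice's qubit admits an LHS model of size at most $C(\tfrac12-r)^{-4/5}$.
   Context: Qubit POVM: finite family $\{\Pi_i\}_{i=1}^n$ of positive semidefinite operators summing to $\mathbb{I}$; it simulates $\{M_{a|x}\}$ if $M_{a|x}=\sum_i p(a|x,i)\Pi_i$ with $p(a|x,i)\ge0$, $\sum_a p(a|x,i)=1$. $\mathcal{P}_r$: the two-outcome POVMs $\{\tfrac12(\mathbb{I}\pm r\hat n\cdot\vec\sigma)\}$ over all unit $\hat n\in\mathbb{R}^3$. $N(r)$: smallest $n$ such that some $n$-outcome qubit POVM simulates $\mathcal{P}_r$. $\omega_r=r|\Psi^-\rangle\langle\Psi^-|+(1-r)\mathbb{I}\otimes\mathbb{I}/4$, $|\Psi^-\rangle=(|01\rangle-|10\rangle)/\sqrt2$. The assemblage generated from $\rho_{AB}$ by POVMs $\{M_{a|x}\}$ on $A$ is $\sigma_{a|x}=\mathrm{Tr}_A[(M_{a|x}\otimes\mathbb{I})\rho_{AB}]$; an LHS model of size $n$ is a distribution $p(i)$ on $\{1,\dots,n\}$, states $\rho_i$ on $B$ and $p(a|x,i)$ with $\sigma_{a|x}=\sum_{i=1}^n p(a|x,i)p(i)\rho_i$. *)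

theory Defs
  imports "HOL-Analysis.Analysis"
begin

text \<open>Qubit operators: 2x2 complex matrices, indexed by the numeral type 2 = {0,1}.
  Two-qubit operators: indexed by pairs (a,b), a = Alice's index, b = Bob's index.\<close>

type_synonym qop = "complex^2^2"
type_synonym qop2 = "complex^(2 \<times> 2)^(2 \<times> 2)"

definition qtrace :: "complex^'n^'n \<Rightarrow> complex" where
  "qtrace A = (\<Sum>i\<in>UNIV. A$i$i)"

definition hermitian_op :: "complex^'n^'n \<Rightarrow> bool" where
  "hermitian_op A \<longleftrightarrow> (\<forall>i j. A$i$j = cnj (A$j$i))"

definition psd :: "complex^'n^'n \<Rightarrow> bool" where
  "psd A \<longleftrightarrow> (\<forall>v::complex^'n.
      Im (\<Sum>i\<in>UNIV. cnj (v$i) * (A *v v)$i) = 0 \<and>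
      Re (\<Sum>i\<in>UNIV. cnj (v$i) * (A *v v)$i) \<ge> 0)"

definition is_state :: "complex^'n^'n \<Rightarrow> bool" where
  "is_state \<rho> \<longleftrightarrow> psd \<rho> \<and> qtrace \<rho> = 1"

definition is_projector :: "complex^'n^'n \<Rightarrow> bool" where
  "is_projector P \<longleftrightarrow> hermitian_op P \<and> P ** P = P"

definition pauli_x :: qop where
  "pauli_x = (\<chi> i j. if i \<noteq> j then 1 else 0)"
definition pauli_y :: qop where
  "pauli_y = (\<chi> i j. if i = 0 \<and> j = 1 then - \<i> else if i = 1 \<and> j = 0 then \<i> else 0)"
definition pauli_z :: qop where
  "pauli_z = (\<chi> i j. if i = j then (if i = 0 then 1 else -1) else 0)"

definition n_dot_sigma :: "real^3 \<Rightarrow> qop" where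
  "n_dot_sigma n = n$1 *\<^sub>R pauli_x + n$2 *\<^sub>R pauli_y + n$3 *\<^sub>R pauli_z"

definition Pr_meas :: "real \<Rightarrow> real^3 \<Rightarrow> bool \<Rightarrow> qop" where
  "Pr_meas r n s = (1/2) *\<^sub>R (mat 1 + ((if s then 1 else -1) * r) *\<^sub>R n_dot_sigma n)"

definition unit_sphere3 :: "(real^3) set" where
  "unit_sphere3 = {n. norm n = 1}"

definition is_povm :: "nat \<Rightarrow> (nat \<Rightarrow> qop) \<Rightarrow> bool" where
  "is_povm n Pis \<longleftrightarrow> (\<forall>i<n. psd (Pis i)) \<and> (\<Sum>i<n. Pis i) = mat 1"

definition simulates :: "nat \<Rightarrow> (nat \<Rightarrow> qop) \<Rightarrow> 'x set \<Rightarrow> 'a set \<Rightarrow> ('x \<Rightarrow> 'a \<Rightarrow> qop) \<Rightarrow> bool" where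
  "simulates n Pis X A M \<longleftrightarrow> (\<exists>p :: 'x \<Rightarrow> 'a \<Rightarrow> nat \<Rightarrow> real.
      (\<forall>x\<in>X. \<forall>a\<in>A. \<forall>i<n. 0 \<le> p x a i) \<and>
      (\<forall>x\<in>X. \<forall>i<n. (\<Sum>a\<in>A. p x a i) = 1) \<and>
      (\<forall>x\<in>X. \<forall>a\<in>A. M x a = (\<Sum>i<n. p x a i *\<^sub>R Pis i)))"

definition N_min :: "real \<Rightarrow> nat" where
  "N_min r = (LEAST n. \<exists>Pis. is_povm n Pis \<and> simulates n Pis unit_sphere3 (UNIV :: bool set) (Pr_meas r))"

definition kron :: "qop \<Rightarrow> qop \<Rightarrow> qop2" where
  "kron A B = (\<chi> p q. A$(fst p)$(fst q) * B$(snd p)$(snd q))"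

definition ptrace_A :: "qop2 \<Rightarrow> qop" where
  "ptrace_A R = (\<chi> b b'. \<Sum>a\<in>UNIV. R$(a,b)$(a,b'))"

definition psi_minus :: "complex^(2 \<times> 2)" where
  "psi_minus = (\<chi> p. if p = (0,1) then complex_of_real (1 / sqrt 2)
                      else if p = (1,0) then - complex_of_real (1 / sqrt 2) else 0)"

definition werner :: "real \<Rightarrow> qop2" where
  "werner r = r *\<^sub>R (\<chi> p q. psi_minus$p * cnj (psi_minus$q)) + ((1 - r) / 4) *\<^sub>R mat 1"

definition assemblage :: "qop2 \<Rightarrow> ('x \<Rightarrow> 'a \<Rightarrow> qop) \<Rightarrow> 'x \<Rightarrow> 'a \<Rightarrow> qop" where
  "assemblage \<rho> M x a = ptrace_A ((kron (M x a) (mat 1)) ** \<rho>)"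

definition has_LHS_model :: "nat \<Rightarrow> 'x set \<Rightarrow> 'a set \<Rightarrow> ('x \<Rightarrow> 'a \<Rightarrow> qop) \<Rightarrow> bool" where
  "has_LHS_model n X A \<sigma> \<longleftrightarrow> (\<exists>(pi :: nat \<Rightarrow> real) (\<rho> :: nat \<Rightarrow> qop) (q :: 'x \<Rightarrow> 'a \<Rightarrow> nat \<Rightarrow> real).
      (\<forall>i<n. 0 \<le> pi i) \<and> (\<Sum>i<n. pi i) = 1 \<and>
      (\<forall>i<n. is_state (\<rho> i)) \<and>
      (\<forall>x\<in>X. \<forall>a\<in>A. \<forall>i<n. 0 \<le> q x a i) \<and>
      (\<forall>x\<in>X. \<forall>i<n. (\<Sum>a\<in>A. q x a i) = 1) \<and>
      (\<forall>x\<in>X. \<forall>a\<in>A. \<sigma> x a = (\<Sum>i<n. (q x a i * pi i) *\<^sub>R \<rho> i)))"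

definition is_projective_meas :: "nat \<Rightarrow> (nat \<Rightarrow> qop) \<Rightarrow> bool" where
  "is_projective_meas K M \<longleftrightarrow> (\<forall>a<K. is_projector (M a)) \<and> (\<Sum>a<K. M a) = mat 1"

end

(* In Bloch form a simulating POVM is a finite family of vectors y_j with total length at most 1 whose
   zonotope, the set of sums of s_j y_j with |s_j| <= 1, contains the ball of radius r. By separation this
   means that sum_j |u . y_j| >= r |u| for all u. For the uniform measure on the sphere the left-hand side is
   |u| / 2, so the task is to approximate that measure by n atoms with error O(n^(-5/4)).

   Start from a very fine discretisation and discard a fixed proportion of the atoms at a time (Matousek's
   method). Group the atoms by five inside cells of diameter about n^(-1/2); in each group there is a signed
   perturbation of the weights that preserves the total mass and the barycentre and deletes an atom. It changes
   u |-> sum_j |u . y_j| only for the O(n^(1/2)) cells met by the plane orthogonal to u, each time by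
   O(n^(-3/2)). Random signs would give n^(-5/4) times a logarithmic factor; Beck's partial colouring method
   removes the logarithm, because only a positive proportion of the groups has to be decided in a step. The
   errors of the successive steps form a geometric series. *)

theory Submission
  imports Defs
begin

section \<open>Partial colourings\<close>

text \<open>Three points shape the work. (1) A step must control a continuum of directions
  \<open>u\<close> with only O(M^2) groups to decide, 1/M being the mesh of the cells. A single net
  of sufficient fineness has about M^6 points and would bring the logarithm back. Chaining through
  nested nets avoids this: the increments shrink fast enough to allow ever larger multiples of their
  standard deviation, and such bounds cost almost no entropy. The entropy argument itself is Gibbs'
  inequality against explicit product weights. (2) Repeated steps could pile up mass in some cell.
  Therefore each group keeps the sum of its lengths, so that every cell of the current level and of
  all coarser dyadic levels keeps its mass; later steps use only these levels. (3) The sphere is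
  replaced by the unit ball with Lebesgue measure, a point \<open>v\<close> counting with its
  length: the integrals of |u . v| and |v| are (pi/2)|u| and pi, with the same ratio |u|/2, and the
  measure of a cone over a cell is bounded by that of a sheared box.\<close>

definition signed_sum :: "'g set \<Rightarrow> ('g \<Rightarrow> real) \<Rightarrow> 'g set \<Rightarrow> real" where
  "signed_sum G a A = (\<Sum>g\<in>G. (if g \<in> A then 1 else - 1) * a g)"

text \<open>The series of cosh x and exp(x^2/2) are compared termwise, by 2^n n! <= (2n)!. The
  left-hand side is twice the moment generating function of a random sign.\<close>

lemma exp_pair_le: "exp x + exp (- x) \<le> 2 * exp (x\<^sup>2/2)" for x :: real
proof -
  have fle: "2^n * fact n \<le> (fact (2 * n) :: real)" for n :: nat
  proof (induction n)
    case (Suc n)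
    have "2^Suc n * fact (Suc n) = (2 * real (Suc n)) * (2^n * fact n)"
      by (simp add: algebra_simps)
    also have "\<dots> \<le> (2 * real (Suc n)) * fact (2 * n)"
      using Suc by (intro mult_left_mono) auto
    also have "\<dots> \<le> (2 * real (Suc n)) * (real (2 * n + 1) * fact (2 * n))"
      by (intro mult_left_mono) (auto simp: mult_le_cancel_right1)
    also have "\<dots> = fact (2 * Suc n)"
      by (simp add: algebra_simps)
    finally show ?case .
  qed auto
  define f where "f n = (if even n then x^n /\<^sub>R fact n else 0)" for n
  have sm: "strict_mono ((*) (2::nat))" by (simp add: strict_mono_def)
  have f0: "f n = 0" if "n \<notin> range ((*) 2)" for n
    using that unfolding f_def by (metis dvdE rangeI)
  have "f sums cosh x" unfolding f_def by (rule cosh_converges)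
  hence "(\<lambda>n. f (2 * n)) sums cosh x" using sums_mono_reindex[of "(*) 2" f "cosh x", OF sm] f0 by blast
  hence 1: "(\<lambda>n. x^(2 * n) /\<^sub>R fact (2 * n)) sums cosh x" by (simp add: f_def)
  have 2: "(\<lambda>n. (x\<^sup>2/2)^n /\<^sub>R fact n) sums exp (x\<^sup>2/2)"
    by (rule exp_converges)
  have "cosh x \<le> exp (x\<^sup>2/2)"
  proof (rule sums_le[OF _ 1 2])
    fix n
    have "x^(2 * n) * (2^n * fact n) \<le> x^(2 * n) * fact (2 * n)"
      by (intro mult_left_mono fle) (simp add: power_mult)
    thus "x^(2 * n) /\<^sub>R fact (2 * n) \<le> (x\<^sup>2/2)^n /\<^sub>R fact n"
      by (simp add: power_divide power_mult[symmetric] field_simps)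
  qed
  thus ?thesis by (simp add: cosh_field_def)
qed

text \<open>A colouring is encoded as the set of elements with sign +1, so expectations are sums
  over \<open>Pow G\<close> divided by 2^card G. Independence of the signs appears as this
  factorisation.\<close>

lemma sum_exp_signed_sum:
  assumes "finite G"
  shows "(\<Sum>A\<in>Pow G. exp (signed_sum G a A)) = (\<Prod>g\<in>G. exp (a g) + exp (- a g))"
  using assms
proof (induction G rule: finite_induct)
  case (insert h G)
  have inj: "inj_on (insert h) (Pow G)" and disj: "Pow G \<inter> insert h ` Pow G = {}"
    using insert by (auto simp: inj_on_def)
  have e1: "exp (signed_sum (insert h G) a A) = exp (- a h) * exp (signed_sum G a A)" if "A \<in> Pow G" for A
    using that insert by (auto simp: signed_sum_def exp_add[symmetric])
  have e2: "exp (signed_sum (insert h G) a (insert h A)) = exp (a h) * exp (signed_sum G a A)" if "A \<in> Pow G" for A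
  proof -
    have "(\<Sum>g\<in>G. (if g \<in> insert h A then 1 else - 1) * a g) = (\<Sum>g\<in>G. (if g \<in> A then 1 else - 1) * a g)"
      using insert by (intro sum.cong) auto
    thus ?thesis using insert by (auto simp: signed_sum_def exp_add[symmetric])
  qed
  have "(\<Sum>A\<in>Pow (insert h G). exp (signed_sum (insert h G) a A)) =
     (\<Sum>A\<in>Pow G. exp (signed_sum (insert h G) a A)) + (\<Sum>A\<in>Pow G. exp (signed_sum (insert h G) a (insert h A)))"
    using insert inj disj by (simp add: Pow_insert sum.union_disjoint sum.reindex)
  also have "\<dots> = (exp (a h) + exp (- a h)) * (\<Sum>A\<in>Pow G. exp (signed_sum G a A))"
    by (simp add: e1 e2 sum_distrib_left[symmetric] algebra_simps)
  finally show ?case using insert by simp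
qed (simp add: signed_sum_def)

text \<open>Hoeffding's subgaussian bound; \<open>\<sigma>\<close> bounds the standard
  deviation.\<close>

lemma sum_exp_signed_sum_le:
  assumes "finite G" and "(\<Sum>g\<in>G. (a g)\<^sup>2) \<le> \<sigma>\<^sup>2"
  shows "(\<Sum>A\<in>Pow G. exp (l * signed_sum G a A)) \<le> 2^card G * exp (l\<^sup>2 * \<sigma>\<^sup>2/2)"
proof -
  have "(\<Sum>A\<in>Pow G. exp (l * signed_sum G a A)) = (\<Sum>A\<in>Pow G. exp (signed_sum G (\<lambda>g. l * a g) A))"
    by (simp add: signed_sum_def sum_distrib_left mult.left_commute)
  also have "\<dots> = (\<Prod>g\<in>G. exp (l * a g) + exp (- (l * a g)))"
    by (rule sum_exp_signed_sum[OF assms(1)])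
  also have "\<dots> \<le> (\<Prod>g\<in>G. 2 * exp ((l * a g)\<^sup>2/2))"
    by (intro prod_mono conjI exp_pair_le add_nonneg_nonneg) auto
  also have "\<dots> = 2^card G * exp (\<Sum>g\<in>G. (l * a g)\<^sup>2/2)"
    using assms(1) by (simp add: prod.distrib exp_sum)
  also have "(\<Sum>g\<in>G. (l * a g)\<^sup>2/2) = l\<^sup>2 * (\<Sum>g\<in>G. (a g)\<^sup>2)/2"
    by (simp add: power_mult_distrib sum_distrib_left sum_divide_distrib)
  also have "2^card G * exp (l\<^sup>2 * (\<Sum>g\<in>G. (a g)\<^sup>2)/2) \<le> 2^card G * exp (l\<^sup>2 * \<sigma>\<^sup>2/2)"
    using assms(2) by (intro mult_left_mono) (auto intro!: mult_left_mono)
  finally show ?thesis .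
qed

section \<open>Rounded signed sums and their entropy\<close>

definition rnd :: "real \<Rightarrow> real \<Rightarrow> int" where
  "rnd d y = \<lfloor>y/d + 1/2\<rfloor>"

lemma rnd_eq_imp_close:
  assumes "d > 0" "rnd d y = rnd d z"
  shows "\<bar>y - z\<bar> \<le> d"
proof -
  have "\<bar>(y/d + 1/2) - (z/d + 1/2)\<bar> \<le> 1"
    using assms(2) unfolding rnd_def by linarith
  hence "\<bar>(y - z)/d\<bar> \<le> 1" by (simp add: diff_divide_distrib)
  thus ?thesis using assms(1) by (simp add: abs_divide)
qed

text \<open>Rounding errs by at most 1/2, so a nonzero index b leaves |y/d| >= |b| - 1/2 >=
  |b|/2.\<close>

lemma abs_rnd_le:
  assumes "d > 0"
  shows "\<bar>real_of_int (rnd d y)\<bar> * d/2 \<le> \<bar>y\<bar>"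
proof -
  have "\<bar>real_of_int (rnd d y)\<bar> \<le> 2 * \<bar>y/d\<bar>"
  proof (cases "rnd d y = 0")
    case False
    hence "\<bar>rnd d y\<bar> \<ge> 1" by linarith
    hence 1: "\<bar>real_of_int (rnd d y)\<bar> \<ge> 1" by linarith
    have 2: "\<bar>real_of_int (rnd d y) - y/d\<bar> \<le> 1/2"
      unfolding rnd_def by linarith
    show ?thesis using 1 2 by linarith
  qed simp
  thus ?thesis using assms by (simp add: field_simps)
qed

text \<open>Chernoff's method, with \<open>b \<le> exp (b - 1)\<close> in place of an indicator function.\<close>
lemma sum_abs_rnd_le:
  assumes G: "finite G" and a: "(\<Sum>g\<in>G. (a g)\<^sup>2) \<le> \<sigma>\<^sup>2" and \<sigma>: "\<sigma> > 0" and K: "K \<ge> 2"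
  shows "(\<Sum>A\<in>Pow G. \<bar>real_of_int (rnd (K * \<sigma>) (signed_sum G a A))\<bar>) \<le> 2^card G * (2 * exp (- (K\<^sup>2/8)))"
proof -
  \<comment> \<open>The optimal Chernoff parameter, threshold over variance: a nonzero rounding
    forces |y| >= K \<sigma>/2.\<close>
  define l where "l = K/(2 * \<sigma>)"
  define X where "X = signed_sum G a"
  have d: "K * \<sigma> > 0" using \<sigma> K by simp
  have Ksq: "K\<^sup>2/4 \<ge> 1" using power_mono[OF K, of 2] by simp
  have pt: "\<bar>real_of_int (rnd (K * \<sigma>) y)\<bar> \<le> exp (- (K\<^sup>2/4)) * (exp (l * y) + exp ((- l) * y))" for y
  proof -
    define b where "b = \<bar>real_of_int (rnd (K * \<sigma>) y)\<bar>"
    have "b = \<bar>rnd (K * \<sigma>) y\<bar>" by (simp add: b_def)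
    moreover have "\<bar>rnd (K * \<sigma>) y\<bar> = 0 \<or> \<bar>rnd (K * \<sigma>) y\<bar> \<ge> 1" by linarith
    moreover have "\<bar>rnd (K * \<sigma>) y\<bar> = 0 \<Longrightarrow> b = 0" by (simp add: b_def)
    moreover have "\<bar>rnd (K * \<sigma>) y\<bar> \<ge> 1 \<Longrightarrow> b \<ge> 1"
      using of_int_1_le_iff[of "\<bar>rnd (K * \<sigma>) y\<bar>", where 'a = real] by (simp add: b_def)
    ultimately have "b = 0 \<or> b \<ge> 1" by blast
    then consider "b = 0" | "b \<ge> 1" by blast
    thus ?thesis
    proof cases
      case 1
      have "0 \<le> exp (- (K\<^sup>2/4)) * (exp (l * y) + exp ((- l) * y))" by simp
      thus ?thesis using 1 unfolding b_def by linarith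
    next
      case 2
      have "b * (K * \<sigma>)/2 \<le> \<bar>y\<bar>" using abs_rnd_le[OF d] unfolding b_def .
      hence "l * (b * (K * \<sigma>)/2) \<le> l * \<bar>y\<bar>"
        using \<sigma> K unfolding l_def by (intro mult_left_mono) auto
      also have "l * (b * (K * \<sigma>)/2) = b * (K\<^sup>2/4)"
        using \<sigma> unfolding l_def by (simp add: field_simps power2_eq_square)
      finally have ly: "b * (K\<^sup>2/4) \<le> l * \<bar>y\<bar>" .
      \<comment> \<open>Since K^2/4 >= 1, the exponent grows at least as fast as \<open>b\<close>;
        one exponential bound thus covers all sizes of the rounding at once.\<close>
      have "(b - 1) * 1 \<le> (b - 1) * (K\<^sup>2/4)"
        using 2 Ksq by (intro mult_left_mono) auto
      hence "b - 1 \<le> b * (K\<^sup>2/4) - K\<^sup>2/4"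
        unfolding left_diff_distrib mult_1_left mult_1_right .
      with ly have "b - 1 \<le> l * \<bar>y\<bar> - K\<^sup>2/4" by linarith
      hence "exp (b - 1) \<le> exp (- (K\<^sup>2/4)) * exp (l * \<bar>y\<bar>)"
        by (simp add: exp_add[symmetric])
      moreover have "b \<le> exp (b - 1)" using exp_ge_add_one_self[of "b - 1"] by simp
      moreover have "exp (l * \<bar>y\<bar>) \<le> exp (l * y) + exp ((- l) * y)"
        by (cases "y \<ge> 0") auto
      ultimately show ?thesis unfolding b_def
        by (meson exp_ge_zero mult_left_mono order_trans)
    qed
  qed
  have "(\<Sum>A\<in>Pow G. \<bar>real_of_int (rnd (K * \<sigma>) (X A))\<bar>) \<le>
      (\<Sum>A\<in>Pow G. exp (- (K\<^sup>2/4)) * (exp (l * X A) + exp ((- l) * X A)))"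
    by (intro sum_mono pt)
  also have "\<dots> = exp (- (K\<^sup>2/4)) * ((\<Sum>A\<in>Pow G. exp (l * X A)) + (\<Sum>A\<in>Pow G. exp ((- l) * X A)))"
    by (simp only: sum_distrib_left sum.distrib distrib_left)
  also have "\<dots> \<le> exp (- (K\<^sup>2/4)) * (2^card G * exp (l\<^sup>2 * \<sigma>\<^sup>2/2) + 2^card G * exp ((- l)\<^sup>2 * \<sigma>\<^sup>2/2))"
    unfolding X_def by (intro mult_left_mono add_mono sum_exp_signed_sum_le[OF G a]) auto
  also have "\<dots> = 2^card G * (2 * (exp (- (K\<^sup>2/4)) * exp (l\<^sup>2 * \<sigma>\<^sup>2/2)))"
    by simp
  also have "exp (- (K\<^sup>2/4)) * exp (l\<^sup>2 * \<sigma>\<^sup>2/2) = exp (- (K\<^sup>2/8))"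
    using \<sigma> unfolding l_def by (simp add: exp_add[symmetric] power_divide power_mult_distrib field_simps)
  finally show ?thesis unfolding X_def .
qed

text \<open>With x = exp(-L) <= 1/2 the two geometric series give at most 1 + 4x <= exp(4x), which
  the factor exp(-4x) compensates. The weights form a sub-probability on the integers, concentrated
  at 0 for large \<open>L\<close>: the reference law for a rounded sum.\<close>

lemma sum_exp_abs_int_le:
  assumes S: "finite S" and L: "L \<ge> 1"
  shows "(\<Sum>b\<in>S. exp (- (4 * exp (- L)) - L * \<bar>real_of_int b\<bar>)) \<le> 1"
proof -
  define x where "x = exp (- L)"
  have x: "0 < x" "x \<le> 1/2"
  proof -
    have "exp (- L) \<le> exp (- 1)" using L by simp
    also have "\<dots> = 1/exp (1::real)" by (simp add: exp_minus inverse_eq_divide)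
    also have "\<dots> \<le> 1/2" using exp_ge_add_one_self[of 1] by (intro divide_left_mono) auto
    finally show "x \<le> 1/2" unfolding x_def .
  qed (simp add: x_def)
  define n where "n = Max ((\<lambda>b. nat \<bar>b\<bar>) ` S)"
  have n: "nat \<bar>b\<bar> \<le> n" if "b \<in> S" for b
    unfolding n_def using S that by (intro Max_ge) auto
  have Sn: "S \<subseteq> {- int n..int n}"
  proof
    fix b assume "b \<in> S"
    from n[OF this] show "b \<in> {- int n..int n}" by auto
  qed
  have geo: "(\<Sum>k\<in>{1..n}. x^k) \<le> 2 * x" 
  proof -
    have "(\<Sum>k\<in>{1..n}. x^k) = (x - x^Suc n)/(1 - x)"
      using x sum_gp[of x 1 n] by (auto simp: )
    also have "\<dots> \<le> x/(1/2)" using x by (intro frac_le) auto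
    finally show ?thesis by simp
  qed
  have ex: "exp (- (L * \<bar>real_of_int b\<bar>)) = x^nat \<bar>b\<bar>" for b
    by (simp add: x_def exp_of_nat_mult[symmetric] mult.commute)
  have "(\<Sum>b\<in>S. x^nat \<bar>b\<bar>) \<le> (\<Sum>b\<in>{- int n..int n}. x^nat \<bar>b\<bar>)"
    using x by (intro sum_mono2 Sn) auto
  also have "{- int n..int n} = {0} \<union> int ` {1..n} \<union> (\<lambda>k. - int k) ` {1..n}"
  proof -
    have "b \<in> {0} \<union> int ` {1..n} \<union> (\<lambda>k. - int k) ` {1..n}" if "b \<in> {- int n..int n}" for b
    proof -
      consider "b = 0" | "b > 0" | "b < 0" by linarith
      thus ?thesis
      proof cases
        case 2
        hence "b = int (nat b)" "nat b \<in> {1..n}" using that by auto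
        thus ?thesis by blast
      next
        case 3
        hence "b = - int (nat (- b))" "nat (- b) \<in> {1..n}" using that by auto
        thus ?thesis by blast
      qed simp
    qed
    hence "{- int n..int n} \<subseteq> {0} \<union> int ` {1..n} \<union> (\<lambda>k. - int k) ` {1..n}" by (rule subsetI)
    moreover have "{0} \<union> int ` {1..n} \<union> (\<lambda>k. - int k) ` {1..n} \<subseteq> {- int n..int n}" by auto
    ultimately show ?thesis by (rule subset_antisym)
  qed
  also have "(\<Sum>b\<in>\<dots>. x^nat \<bar>b\<bar>) = 1 + (\<Sum>k\<in>{1..n}. x^k) + (\<Sum>k\<in>{1..n}. x^k)"
    by (subst sum.union_disjoint; (subst sum.union_disjoint)?) (auto simp: sum.reindex inj_on_def)
  also have "\<dots> \<le> 1 + 4 * x" using geo by simp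
  also have "\<dots> \<le> exp (4 * x)" by simp
  finally have "exp (- (4 * x)) * (\<Sum>b\<in>S. x^nat \<bar>b\<bar>) \<le> exp (- (4 * x)) * exp (4 * x)"
    by (intro mult_left_mono) auto
  also have "\<dots> = 1" by (simp add: exp_add[symmetric])
  finally have "(\<Sum>b\<in>S. exp (- (4 * x)) * x^nat \<bar>b\<bar>) \<le> 1"
    by (simp only: sum_distrib_left)
  moreover have "exp (- (4 * exp (- L)) - L * \<bar>real_of_int b\<bar>) = exp (- (4 * x)) * x^nat \<bar>b\<bar>" for b
    unfolding ex[symmetric] exp_add[symmetric] by (simp add: x_def)
  ultimately show ?thesis by simp
qed


lemma sum_inverse_fibre_card:
  fixes Q :: "'b \<Rightarrow> real"
  assumes "finite S"
  shows "(\<Sum>A\<in>S. Q (F A)/real (card {B\<in>S. F B = F A})) = (\<Sum>\<beta>\<in>F ` S. Q \<beta>)"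
proof -
  have "(\<Sum>A\<in>S. Q (F A)/real (card {B\<in>S. F B = F A})) =
      (\<Sum>\<beta>\<in>F ` S. \<Sum>A\<in>{A\<in>S. F A = \<beta>}. Q (F A)/real (card {B\<in>S. F B = F A}))"
    by (rule sum.image_gen[OF assms])
  also have "\<dots> = (\<Sum>\<beta>\<in>F ` S. Q \<beta>)"
  proof (rule sum.cong[OF refl])
    fix \<beta> assume "\<beta> \<in> F ` S"
    hence ne: "card {A\<in>S. F A = \<beta>} \<noteq> 0" using assms by auto
    have "(\<Sum>A\<in>{A\<in>S. F A = \<beta>}. Q (F A)/real (card {B\<in>S. F B = F A})) =
        (\<Sum>A\<in>{A\<in>S. F A = \<beta>}. Q \<beta>/real (card {B\<in>S. F B = \<beta>}))"
      by (rule sum.cong) auto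
    thus "(\<Sum>A\<in>{A\<in>S. F A = \<beta>}. Q (F A)/real (card {B\<in>S. F B = F A})) = Q \<beta>"
      using ne by simp
  qed
  finally show ?thesis .
qed

text \<open>Gibbs' inequality for the fibres of \<open>F\<close> against the product weights
  \<open>exp (- 4 exp (- L j) - L j |b|)\<close>: a large fibre exists as soon as the roundings are zero on
  average most of the time.\<close>
lemma exists_large_fibre:
  fixes F :: "'a \<Rightarrow> 'j \<Rightarrow> int"
  assumes S: "finite S" "S \<noteq> {}" and J: "finite J"
    and F0: "\<And>A j. j \<notin> J \<Longrightarrow> F A j = 0"
    and L: "\<And>j. j \<in> J \<Longrightarrow> L j \<ge> 1"
    and H: "(\<Sum>j\<in>J. \<Sum>A\<in>S. 4 * exp (- L j) + L j * \<bar>real_of_int (F A j)\<bar>) \<le> real (card S) * H"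
  shows "\<exists>A\<in>S. real (card S) * exp (- H) \<le> real (card {B\<in>S. F B = F A})"
proof -
  define q where "q j b = exp (- (4 * exp (- L j)) - L j * \<bar>real_of_int b\<bar>)" for j b
  define Q where "Q \<beta> = (\<Prod>j\<in>J. q j (\<beta> j))" for \<beta>
  define n where "n A = real (card {B\<in>S. F B = F A})" for A
  have n: "n A > 0" if "A \<in> S" for A
    using that S by (auto simp: n_def card_gt_0_iff)
  have Qpos: "Q \<beta> > 0" for \<beta> by (auto simp: Q_def q_def intro!: prod_pos)
  have cS: "real (card S) > 0" using S by (simp add: card_gt_0_iff)
  define R where "R j = (\<lambda>A. F A j) ` S" for j
  \<comment> \<open>Passing to restrictions places the image inside a product set, over which
    \<open>Q\<close> factorises; no values are merged because \<open>F A\<close> vanishes off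
    \<open>J\<close>.\<close>
  have "(\<Sum>\<beta>\<in>F ` S. Q \<beta>) = (\<Sum>\<beta>\<in>(\<lambda>\<beta>. restrict \<beta> J) ` F ` S. Q \<beta>)"
  proof -
    have "inj_on (\<lambda>\<beta>. restrict \<beta> J) (F ` S)"
    proof (rule inj_onI)
      fix \<beta> \<gamma> assume a: "\<beta> \<in> F ` S" "\<gamma> \<in> F ` S" "restrict \<beta> J = restrict \<gamma> J"
      show "\<beta> = \<gamma>"
      proof
        fix j show "\<beta> j = \<gamma> j"
          using a F0 by (cases "j \<in> J") (auto dest: fun_cong[of _ _ j])
      qed
    qed
    from sum.reindex[OF this, of Q] show ?thesis by (simp add: Q_def comp_def cong: prod.cong)
  qed
  also have "\<dots> \<le> (\<Sum>\<beta>\<in>PiE J R. Q \<beta>)"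
    using J S Qpos by (intro sum_mono2 finite_PiE) (auto simp: R_def intro: less_imp_le)
  also have "\<dots> = (\<Prod>j\<in>J. \<Sum>b\<in>R j. q j b)"
    unfolding Q_def using J S by (subst prod_sum_PiE) (auto simp: R_def)
  also have "\<dots> \<le> (\<Prod>j\<in>J. 1)"
    unfolding q_def using S L by (intro prod_mono conjI sum_exp_abs_int_le sum_nonneg) (auto simp: R_def)
  finally have Q1: "(\<Sum>\<beta>\<in>F ` S. Q \<beta>) \<le> 1" by simp
  \<comment> \<open>Nonnegativity of relative entropy, through ln z <= z - 1: the law of
    \<open>F A\<close> for uniform \<open>A\<close> gives its value the probability n A/card S, and
    is compared with \<open>Q\<close>.\<close>
  have "(\<Sum>A\<in>S. ln (card S * Q (F A)/n A)) \<le> (\<Sum>A\<in>S. card S * Q (F A)/n A - 1)"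
    using n Qpos cS by (intro sum_mono ln_le_minus_one) auto
  also have "\<dots> = card S * (\<Sum>A\<in>S. Q (F A)/n A) - card S"
    by (simp add: sum_subtractf sum_distrib_left)
  also have "(\<Sum>A\<in>S. Q (F A)/n A) = (\<Sum>\<beta>\<in>F ` S. Q \<beta>)"
    unfolding n_def by (rule sum_inverse_fibre_card[OF S(1)])
  also have "card S * \<dots> - card S \<le> 0" using Q1 cS by simp
  finally have 1: "(\<Sum>A\<in>S. ln (card S * Q (F A)/n A)) \<le> 0" .
  have lnQ: "ln (Q (F A)) = - (\<Sum>j\<in>J. 4 * exp (- L j) + L j * \<bar>real_of_int (F A j)\<bar>)" for A
  proof -
    have "Q (F A) = exp (\<Sum>j\<in>J. - (4 * exp (- L j)) - L j * \<bar>real_of_int (F A j)\<bar>)"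
      using J by (simp add: Q_def q_def exp_sum)
    thus ?thesis by (simp add: sum_negf[symmetric])
  qed
  have 2: "ln (card S * Q (F A)/n A) = ln (card S/n A) + ln (Q (F A))" if "A \<in> S" for A
    using ln_mult[of "card S/n A" "Q (F A)"] n[OF that] Qpos[of "F A"] cS by (simp add: mult.commute)
  have "(\<Sum>A\<in>S. ln (card S/n A)) \<le> (\<Sum>A\<in>S. \<Sum>j\<in>J. 4 * exp (- L j) + L j * \<bar>real_of_int (F A j)\<bar>)"
    using 1 by (simp only: 2 lnQ sum.distrib[of "\<lambda>A. ln (card S/n A)"] sum_negf cong: sum.cong)
  also have "\<dots> \<le> (\<Sum>A\<in>S. H)" using H by (subst sum.swap) simp
  \<comment> \<open>The average of ln(card S/n A) is at most \<open>H\<close>, so some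
    \<open>A\<close> does not exceed it.\<close>
  finally have "\<not> (\<forall>A\<in>S. H < ln (card S/n A))"
    using sum_strict_mono[OF S, of "\<lambda>_. H" "\<lambda>A. ln (card S/n A)"] by auto
  then obtain A where A: "A \<in> S" "ln (card S/n A) \<le> H" by (auto simp: not_less)
  have "card S/n A \<le> exp H"
    using A n cS by (metis divide_pos_pos exp_le_cancel_iff exp_ln)
  hence "card S * exp (- H) \<le> n A"
    using n[OF A(1)] by (simp add: field_simps exp_minus)
  thus ?thesis using A by (auto simp: n_def)
qed

lemma sum_power_card_Pow:
  fixes x :: real
  assumes "finite G"
  shows "(\<Sum>A\<in>Pow G. x^card A) = (1 + x)^card G"
proof -
  have "(\<Prod>g\<in>G. x + 1) = (\<Sum>A\<in>Pow G. (\<Prod>g\<in>A. x) * (\<Prod>g\<in>G - A. 1))"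
    using assms by (rule prod_add)
  thus ?thesis by (simp add: add.commute)
qed

text \<open>A Hamming ball of radius m/10, where m = card G, is too small to contain the family.
  Weighing a difference \<open>D\<close> with (1/2)^card D bounds the ball by exp(m/10) (3/2)^m, and
  exp(1/5) * 3/2 < 2.\<close>

lemma exists_far_pair:
  assumes G: "finite G" "G \<noteq> {}" and \<F>: "\<F> \<subseteq> Pow G"
    and big: "2^card G * exp (- (real (card G)/10)) \<le> real (card \<F>)"
  shows "\<exists>A\<in>\<F>. \<exists>B\<in>\<F>. real (card (sym_diff A B)) > real (card G)/10"
proof (rule ccontr)
  define m where "m = card G"
  have m: "m > 0" using G by (simp add: m_def card_gt_0_iff)
  assume "\<not> ?thesis"
  hence near: "real (card (sym_diff A B)) \<le> real m/10" if "A \<in> \<F>" "B \<in> \<F>" for A B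
    using that by (auto simp: m_def not_less)
  have "real (card \<F>) > 0" by (rule less_le_trans[OF _ big]) simp
  then obtain A0 where A0: "A0 \<in> \<F>" by fastforce
  have fF: "finite \<F>" using \<F> G by (meson finite_Pow_iff finite_subset)
  have inj: "inj_on (\<lambda>A. sym_diff A A0) \<F>" by (auto simp: inj_on_def)
  have two: "(2::real)^k \<le> exp (real k)" for k
  proof -
    have "(2::real)^k \<le> exp 1^k"
      using exp_ge_add_one_self[of 1] by (intro power_mono) auto
    thus ?thesis by (simp add: exp_of_nat_mult[symmetric])
  qed
  have "real (card \<F>) = (\<Sum>A\<in>\<F>. 1)" by simp
  also have "\<dots> \<le> (\<Sum>A\<in>\<F>. exp (real m/10) * (1/2)^card (sym_diff A A0))"
  proof (rule sum_mono)
    fix A assume "A \<in> \<F>"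
    from near[OF this A0] have "2^card (sym_diff A A0) \<le> exp (real m/10)"
      using two[of "card (sym_diff A A0)"] by (meson exp_le_cancel_iff order_trans)
    thus "1 \<le> exp (real m/10) * (1/2)^card (sym_diff A A0)"
      by (simp add: power_one_over field_simps)
  qed
  also have "\<dots> = exp (real m/10) * (\<Sum>D\<in>(\<lambda>A. sym_diff A A0) ` \<F>. (1/2)^card D)"
    using inj by (simp add: sum.reindex sum_distrib_left)
  also have "\<dots> \<le> exp (real m/10) * (\<Sum>D\<in>Pow G. (1/2)^card D)"
    using G A0 \<F> by (intro mult_left_mono sum_mono2) auto
  also have "\<dots> = exp (real m/10) * (3/2)^m"
    using G by (simp add: sum_power_card_Pow m_def)
  finally have "2^m * exp (- (real m/10)) \<le> exp (real m/10) * (3/2)^m"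
    using big unfolding m_def by linarith
  hence "2^m \<le> exp (real m/10) * exp (real m/10) * (3/2)^m"
    by (simp add: exp_minus field_simps)
  also have "exp (real m/10) * exp (real m/10) = exp (1/5)^m"
    by (simp add: exp_of_nat_mult[symmetric] exp_add[symmetric])
  also have "exp (1/5)^m * (3/2)^m = (exp (1/5) * (3/2) :: real)^m"
    by (simp only: power_mult_distrib)
  also have "\<dots> < 2^m"
  proof -
    have "exp (1/5) \<le> (1 + 1/5 + (1/5)\<^sup>2 :: real)" by (rule exp_bound) auto
    thus ?thesis using m by (intro power_strict_mono) (auto simp: power2_eq_square)
  qed
  finally show False by simp
qed

text \<open>Beck's partial colouring method: half the difference of two colourings that round alike.\<close>
lemma partial_colouring:
  fixes a :: "'j \<Rightarrow> 'g \<Rightarrow> real"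
  assumes G: "finite G" "G \<noteq> {}" and J: "finite J"
    and a: "\<And>j. j \<in> J \<Longrightarrow> (\<Sum>g\<in>G. (a j g)\<^sup>2) \<le> (\<sigma> j)\<^sup>2"
    and \<sigma>: "\<And>j. j \<in> J \<Longrightarrow> \<sigma> j > 0"
    and K: "\<And>j. j \<in> J \<Longrightarrow> K j \<ge> 4"
    and cost: "(\<Sum>j\<in>J. 6 * exp (- ((K j)\<^sup>2/16))) \<le> real (card G)/10"
  shows "\<exists>\<tau> :: 'g \<Rightarrow> real. (\<forall>g. \<tau> g \<in> {-1, 0, 1}) \<and> real (card {g\<in>G. \<tau> g \<noteq> 0}) > real (card G)/10 \<and>
      (\<forall>j\<in>J. \<bar>\<Sum>g\<in>G. \<tau> g * a j g\<bar> \<le> K j * \<sigma> j)"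
proof -
  define F where "F A j = (if j \<in> J then rnd (K j * \<sigma> j) (signed_sum G (a j) A) else 0)" for A j
  have fP: "finite (Pow G)" using G by simp
  have c: "real (card (Pow G)) = 2^card G" using G by (simp add: card_Pow)
  have Kd: "K j * \<sigma> j > 0" if "j \<in> J" for j
    using K[OF that] \<sigma>[OF that] by (intro mult_pos_pos) auto
  \<comment> \<open>The rate y = K^2/16 is half the exponent K^2/8 of the tail bound: one half of
    the decay absorbs the factor y, the other half survives as exp(-y).\<close>
  have each: "(\<Sum>A\<in>Pow G. 4 * exp (- ((K j)\<^sup>2/16)) + (K j)\<^sup>2/16 * \<bar>real_of_int (F A j)\<bar>)
      \<le> 2^card G * (6 * exp (- ((K j)\<^sup>2/16)))" if j: "j \<in> J" for j
  proof -
    define y where "y = (K j)\<^sup>2/16"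
    have y0: "y \<ge> 0" by (simp add: y_def)
    have Kj: "K j \<ge> 2" using K[OF j] by simp
    have "(\<Sum>A\<in>Pow G. 4 * exp (- y) + y * \<bar>real_of_int (F A j)\<bar>) =
       2^card G * (4 * exp (- y)) + y * (\<Sum>A\<in>Pow G. \<bar>real_of_int (F A j)\<bar>)"
      by (simp add: sum.distrib sum_distrib_left c[symmetric])
    also have "\<dots> \<le> 2^card G * (4 * exp (- y)) + y * (2^card G * (2 * (exp (- y) * exp (- y))))"
    proof -
      have "(\<Sum>A\<in>Pow G. \<bar>real_of_int (F A j)\<bar>) \<le> 2^card G * (2 * exp (- ((K j)\<^sup>2/8)))"
        using sum_abs_rnd_le[OF G(1) a[OF j] \<sigma>[OF j] Kj] j by (simp add: F_def)
      also have "exp (- ((K j)\<^sup>2/8)) = exp (- y) * exp (- y)"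
        by (simp add: y_def exp_add[symmetric])
      finally show ?thesis using y0 by (intro add_left_mono mult_left_mono)
    qed
    also have "2^card G * (4 * exp (- y)) + y * (2^card G * (2 * (exp (- y) * exp (- y)))) =
        2^card G * (4 * exp (- y) + 2 * exp (- y) * (y * exp (- y)))"
      by (simp add: algebra_simps)
    also have "\<dots> \<le> 2^card G * (4 * exp (- y) + 2 * exp (- y) * 1)"
    proof -
      have "y * exp (- y) \<le> exp y * exp (- y)"
        using exp_ge_add_one_self[of y] by (intro mult_right_mono) (auto simp del: exp_ge_add_one_self)
      hence "y * exp (- y) \<le> 1" by (simp add: exp_add[symmetric])
      thus ?thesis by (intro mult_left_mono add_left_mono) auto
    qed
    finally have "(\<Sum>A\<in>Pow G. 4 * exp (- y) + y * \<bar>real_of_int (F A j)\<bar>) \<le>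
        2^card G * (4 * exp (- y) + 2 * exp (- y) * 1)" .
    moreover have "4 * exp (- y) + 2 * exp (- y) * 1 = 6 * exp (- y)" by simp
    ultimately show ?thesis unfolding y_def by (simp only:)
  qed
  have "\<exists>A\<in>Pow G. real (card (Pow G)) * exp (- (real (card G)/10)) \<le> real (card {B\<in>Pow G. F B = F A})"
  proof (rule exists_large_fibre[OF fP _ J, where L = "\<lambda>j. (K j)\<^sup>2/16"])
    fix j assume "j \<in> J"
    thus "1 \<le> (K j)\<^sup>2/16" using power_mono[OF K, of j 2] by simp
  next
    have "(\<Sum>j\<in>J. \<Sum>A\<in>Pow G. 4 * exp (- ((K j)\<^sup>2/16)) + (K j)\<^sup>2/16 * \<bar>real_of_int (F A j)\<bar>)
        \<le> (\<Sum>j\<in>J. 2^card G * (6 * exp (- ((K j)\<^sup>2/16))))"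
      by (intro sum_mono each)
    also have "\<dots> \<le> 2^card G * (real (card G)/10)"
      using cost by (simp only: sum_distrib_left[symmetric]) (intro mult_left_mono, auto)
    finally show "(\<Sum>j\<in>J. \<Sum>A\<in>Pow G. 4 * exp (- ((K j)\<^sup>2/16)) + (K j)\<^sup>2/16 * \<bar>real_of_int (F A j)\<bar>)
        \<le> real (card (Pow G)) * (real (card G)/10)" by (simp add: c)
  qed (auto simp: F_def)
  then obtain A0 where A0: "2^card G * exp (- (real (card G)/10)) \<le> real (card {B\<in>Pow G. F B = F A0})"
    by (auto simp: c)
  obtain A B where AB: "A \<subseteq> G" "B \<subseteq> G" "F A = F A0" "F B = F A0"
      "real (card (sym_diff A B)) > real (card G)/10"
    using exists_far_pair[OF G _ A0] by auto
  define \<tau> :: "'g \<Rightarrow> real" where "\<tau> g = (if g \<in> A - B then 1 else if g \<in> B - A then - 1 else 0)" for g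
  have "{g\<in>G. \<tau> g \<noteq> 0} = sym_diff A B" using AB by (auto simp: \<tau>_def)
  moreover have "\<bar>\<Sum>g\<in>G. \<tau> g * a j g\<bar> \<le> K j * \<sigma> j" if j: "j \<in> J" for j
  proof -
    have "rnd (K j * \<sigma> j) (signed_sum G (a j) A) = rnd (K j * \<sigma> j) (signed_sum G (a j) B)"
    proof -
      have "F A j = F B j" by (simp only: AB(3,4))
      thus ?thesis using j by (simp only: F_def if_True)
    qed
    hence "\<bar>signed_sum G (a j) A - signed_sum G (a j) B\<bar> \<le> K j * \<sigma> j"
      by (rule rnd_eq_imp_close[OF Kd[OF j]])
    also have "signed_sum G (a j) A - signed_sum G (a j) B = (\<Sum>g\<in>G. 2 * (\<tau> g * a j g))"
      unfolding signed_sum_def sum_subtractf[symmetric] by (intro sum.cong) (auto simp: \<tau>_def)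
    finally show ?thesis by (simp add: sum_distrib_left[symmetric])
  qed
  ultimately show ?thesis using AB(5) by (intro exI[of _ \<tau>]) (auto simp: \<tau>_def)
qed

section \<open>Cells on the cube\<close>

text \<open>The cell \<open>(f, a, b)\<close> of level \<open>M\<close> is the square \<open>[a/M, (a+1)/M] \<times> [b/M, (b+1)/M]\<close> on the face
  \<open>x $ f = 1\<close> of the cube; the indices \<open>f, f + 1, f + 2\<close> are taken cyclically in the type \<open>3\<close>.
  Opposite faces are identified, since only the absolute values \<open>|u \<bullet> x|\<close> matter.\<close>
type_synonym cell = "3 \<times> int \<times> int"

text \<open>The index \<open>M\<close> is included because a coordinate ratio equal to 1 has it as
  its floor in \<open>cell_index\<close>.\<close>

definition cells :: "nat \<Rightarrow> cell set" where
  "cells M = UNIV \<times> {- int M..int M} \<times> {- int M..int M}"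

text \<open>Without denominators the conditions define a closed convex cone, so membership survives
  both the rescaling of atoms and integration.\<close>

definition in_cone :: "nat \<Rightarrow> cell \<Rightarrow> real^3 \<Rightarrow> bool" where
  "in_cone M c x \<longleftrightarrow> (case c of (f, a, b) \<Rightarrow> 0 \<le> x $ f \<and>
     of_int a * x $ f \<le> M * x $ (f + 1) \<and> M * x $ (f + 1) \<le> (of_int a + 1) * x $ f \<and>
     of_int b * x $ f \<le> M * x $ (f + 2) \<and> M * x $ (f + 2) \<le> (of_int b + 1) * x $ f)"

text \<open>\<open>M\<close> times the value of the functional \<open>u\<close> at the corner (1,
  a/M, b/M) of the cell.\<close>

definition corner :: "nat \<Rightarrow> real^3 \<Rightarrow> cell \<Rightarrow> real" where
  "corner M u c = (case c of (f, a, b) \<Rightarrow> M * u $ f + of_int a * u $ (f + 1) + of_int b * u $ (f + 2))"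

text \<open>If a cell does not straddle the plane orthogonal to \<open>u\<close>, then \<open>|u \<bullet> x|\<close> is linear on its cone.\<close>
definition straddles :: "nat \<Rightarrow> real^3 \<Rightarrow> cell \<Rightarrow> bool" where
  "straddles M u c \<longleftrightarrow> (case c of (f, a, b) \<Rightarrow>
     \<bar>corner M u c\<bar> < \<bar>u $ (f + 1)\<bar> + \<bar>u $ (f + 2)\<bar>)"

section \<open>Linear functionals on the cones over cells\<close>

lemma UNIV_shift3: "(UNIV :: 3 set) = {f, f + 1, f + 2}"
proof -
  have "card {f, f + 1, f + 2} = 3" by simp
  hence "card {f, f + 1, f + 2} = card (UNIV :: 3 set)" by simp
  thus ?thesis using card_subset_eq[of UNIV "{f, f + 1, f + 2}"] by auto
qed

lemma forall_shift3: "(\<forall>i. P i) \<longleftrightarrow> P f \<and> P (f + 1) \<and> P (f + 2)" for f :: 3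
proof -
  have "(\<forall>i. P i) \<longleftrightarrow> (\<forall>i\<in>(UNIV :: 3 set). P i)" by simp
  also have "\<dots> \<longleftrightarrow> P f \<and> P (f + 1) \<and> P (f + 2)" unfolding UNIV_shift3[of f] by simp
  finally show ?thesis .
qed

lemma sum_shift3: "(\<Sum>i\<in>UNIV. g i) = g f + g (f + 1) + g (f + 2)" for f :: 3
  unfolding UNIV_shift3[of f] by (simp add: add.assoc)

lemma inner_shift3: "u \<bullet> x = u $ f * x $ f + u $ (f + 1) * x $ (f + 1) + u $ (f + 2) * x $ (f + 2)"
  for u x :: "real^3"
  unfolding inner_vec_def by (simp add: sum_shift3[of _ f])

lemma norm_le_shift3: "norm x \<le> \<bar>x $ f\<bar> + \<bar>x $ (f + 1)\<bar> + \<bar>x $ (f + 2)\<bar>" for x :: "real^3"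
  using norm_le_l1_cart[of x] by (simp add: sum_shift3[of _ f])

lemma finite_cells [simp]: "finite (cells M)"
  by (simp add: cells_def)

lemma card_cells: "M \<ge> 1 \<Longrightarrow> card (cells M) \<le> 27 * M\<^sup>2"
proof -
  assume M: "M \<ge> 1"
  have "card {- int M..int M} = 2 * M + 1"
  proof -
    have "int M - - int M + 1 = int (2 * M + 1)" by simp
    thus ?thesis unfolding card_atLeastAtMost_int by (simp only: nat_int)
  qed
  hence "card (cells M) = 3 * (2 * M + 1) * (2 * M + 1)"
    unfolding cells_def card_cartesian_product by (simp add: algebra_simps del: card_atLeastAtMost_int)
  also have "\<dots> \<le> 3 * (3 * M) * (3 * M)"
    using M by (intro mult_mono) auto
  finally show ?thesis by (simp add: power2_eq_square)
qed

text \<open>Along the cone the functional differs from its value at the corner by at most its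
  oscillation over one mesh square.\<close>

lemma in_cone_inner:
  assumes "in_cone M (f, a, b) x"
  shows "\<bar>M * (u \<bullet> x) - x $ f * corner M u (f, a, b)\<bar> \<le> x $ f * (\<bar>u $ (f + 1)\<bar> + \<bar>u $ (f + 2)\<bar>)"
proof -
  define y where "y = M * x $ (f + 1) - of_int a * x $ f"
  define z where "z = M * x $ (f + 2) - of_int b * x $ f"
  have yz: "\<bar>y\<bar> \<le> x $ f" "\<bar>z\<bar> \<le> x $ f" "x $ f \<ge> 0"
    using assms by (auto simp: in_cone_def y_def z_def algebra_simps)
  have "M * (u \<bullet> x) - x $ f * corner M u (f, a, b) = u $ (f + 1) * y + u $ (f + 2) * z"
    unfolding inner_shift3[of u x f] corner_def y_def z_def by (simp add: algebra_simps)
  also have "\<bar>\<dots>\<bar> \<le> \<bar>u $ (f + 1)\<bar> * \<bar>y\<bar> + \<bar>u $ (f + 2)\<bar> * \<bar>z\<bar>"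
    by (metis abs_mult abs_triangle_ineq)
  also have "\<dots> \<le> \<bar>u $ (f + 1)\<bar> * x $ f + \<bar>u $ (f + 2)\<bar> * x $ f"
    using yz by (intro add_mono mult_left_mono) auto
  finally show ?thesis by (simp add: algebra_simps)
qed

text \<open>The corner value dominates the oscillation and therefore decides the sign. If it is 0,
  the oscillation bound is 0 too and both sides vanish.\<close>

lemma abs_inner_not_straddles:
  assumes cone: "in_cone M c x" and M: "M \<ge> 1" and ns: "\<not> straddles M u c"
  shows "\<bar>u \<bullet> x\<bar> = sgn (corner M u c) * (u \<bullet> x)"
proof -
  obtain f a b where c: "c = (f, a, b)" by (cases c) auto
  define L S where "L = corner M u c" and "S = \<bar>u $ (f + 1)\<bar> + \<bar>u $ (f + 2)\<bar>"
  note near = in_cone_inner[OF cone[unfolded c], of u, folded c L_def S_def]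
  have xf: "x $ f \<ge> 0" using cone by (simp add: in_cone_def c)
  have "S \<le> \<bar>L\<bar>" using ns by (simp add: straddles_def L_def S_def c)
  hence LS: "x $ f * S \<le> x $ f * \<bar>L\<bar>" using xf by (rule mult_left_mono)
  consider "L > 0" | "L < 0" | "L = 0" by linarith
  thus ?thesis
  proof cases
    case 1
    hence "M * (u \<bullet> x) \<ge> 0" using near LS by simp
    hence "u \<bullet> x \<ge> 0" using M by (simp add: zero_le_mult_iff)
    thus ?thesis using 1 by (simp add: L_def)
  next
    case 2
    hence "M * (u \<bullet> x) \<le> 0" using near LS by simp
    hence "u \<bullet> x \<le> 0" using M by (simp add: mult_le_0_iff)
    thus ?thesis using 2 by (simp add: L_def)
  next
    case 3
    hence "\<bar>M * (u \<bullet> x)\<bar> \<le> 0" using near LS by simp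
    thus ?thesis using M by simp
  qed
qed

text \<open>Corner value and oscillation are each at most |u $ (f + 1)| + |u $ (f + 2)| <= 2 norm
  u.\<close>

lemma abs_inner_straddles:
  assumes cone: "in_cone M c x" and M: "M \<ge> 1" and ns: "straddles M u c"
  shows "\<bar>u \<bullet> x\<bar> \<le> 4 * norm u/M * norm x"
proof -
  obtain f a b where c: "c = (f, a, b)" by (cases c) auto
  define L S where "L = corner M u c" and "S = \<bar>u $ (f + 1)\<bar> + \<bar>u $ (f + 2)\<bar>"
  note near = in_cone_inner[OF cone[unfolded c], of u, folded c L_def S_def]
  have xf: "x $ f \<ge> 0" using cone by (simp add: in_cone_def c)
  have "\<bar>L\<bar> \<le> S" using ns by (simp add: straddles_def L_def S_def c)
  hence "x $ f * \<bar>L\<bar> \<le> x $ f * S" using xf by (rule mult_left_mono)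
  hence "\<bar>x $ f * L\<bar> \<le> x $ f * S" using xf by (simp add: abs_mult)
  hence "\<bar>M * (u \<bullet> x)\<bar> \<le> 2 * (x $ f * S)" using near by linarith
  also have "x $ f * S \<le> norm x * (2 * norm u)"
    using component_le_norm_cart[of u "f + 1"] component_le_norm_cart[of u "f + 2"]
      component_le_norm_cart[of x f] xf
    unfolding S_def by (intro mult_mono) auto
  finally have "M * \<bar>u \<bullet> x\<bar> \<le> 4 * norm u * norm x" by (simp add: abs_mult algebra_simps)
  thus ?thesis using M by (simp add: field_simps)
qed

section \<open>Counting the cells met by a plane\<close>

definition hit :: "nat \<Rightarrow> real^3 \<Rightarrow> cell set" where
  "hit M u = {c \<in> cells M. straddles M u c}"

lemma finite_hit [simp]: "finite (hit M u)"
  by (simp add: hit_def)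

text \<open>Solving for the index with the larger coefficient confines \<open>a\<close>, for each
  \<open>b\<close>, to an open interval of length 4, that is to at most four values. If p = 0 then
  also q = 0, and the strict inequality excludes every pair.\<close>

lemma card_strip_le:
  fixes k p q :: real
  assumes M: "M \<ge> 1" and pq: "\<bar>q\<bar> \<le> \<bar>p\<bar>"
  shows "card {(a, b). a \<in> {- int M..int M} \<and> b \<in> {- int M..int M} \<and>
     \<bar>k + of_int a * p + of_int b * q\<bar> < \<bar>p\<bar> + \<bar>q\<bar>} \<le> 12 * M"
proof (cases "p = 0")
  case False
  define t where "t b = - (k + of_int b * q)/p" for b :: int
  define T where "T = (SIGMA b:{- int M..int M}. {\<lfloor>t b\<rfloor> - 1..\<lfloor>t b\<rfloor> + 2})"
  have "{(a, b). a \<in> {- int M..int M} \<and> b \<in> {- int M..int M} \<and>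
     \<bar>k + of_int a * p + of_int b * q\<bar> < \<bar>p\<bar> + \<bar>q\<bar>} \<subseteq> prod.swap ` T"
  proof clarify
    fix a b assume ab: "a \<in> {- int M..int M}" "b \<in> {- int M..int M}"
      and lt: "\<bar>k + of_int a * p + of_int b * q\<bar> < \<bar>p\<bar> + \<bar>q\<bar>"
    have "p * (of_int a - t b) = k + of_int a * p + of_int b * q"
      using False by (simp add: t_def field_simps)
    hence "\<bar>p\<bar> * \<bar>of_int a - t b\<bar> < \<bar>p\<bar> * 2"
      using lt pq by (simp add: abs_mult[symmetric])
    hence "\<bar>of_int a - t b\<bar> < 2" using False by simp
    hence "a \<in> {\<lfloor>t b\<rfloor> - 1..\<lfloor>t b\<rfloor> + 2}" by (simp, linarith)
    hence "(b, a) \<in> T" using ab by (simp add: T_def)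
    thus "(a, b) \<in> prod.swap ` T" by (force simp: image_iff)
  qed
  hence "card {(a, b). a \<in> {- int M..int M} \<and> b \<in> {- int M..int M} \<and>
     \<bar>k + of_int a * p + of_int b * q\<bar> < \<bar>p\<bar> + \<bar>q\<bar>} \<le> card (prod.swap ` T)"
    by (intro card_mono) (auto simp: T_def)
  also have "\<dots> \<le> card T" by (rule card_image_le) (simp add: T_def)
  also have "\<dots> = 4 * (2 * M + 1)"
    by (simp add: T_def nat_add_distrib)
  also have "\<dots> \<le> 12 * M" using M by simp
  finally show ?thesis .
qed (use pq in auto)

lemma card_straddling_le:
  assumes M: "M \<ge> 1"
  shows "card (hit M u) \<le> 36 * M"
proof -
  define S where "S f = {(a, b). a \<in> {- int M..int M} \<and> b \<in> {- int M..int M} \<and>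
     \<bar>M * u $ f + of_int a * u $ (f + 1) + of_int b * u $ (f + 2)\<bar> < \<bar>u $ (f + 1)\<bar> + \<bar>u $ (f + 2)\<bar>}" for f
  have S: "card (S f) \<le> 12 * M" for f
  proof (cases "\<bar>u $ (f + 2)\<bar> \<le> \<bar>u $ (f + 1)\<bar>")
    case True
    thus ?thesis unfolding S_def by (rule card_strip_le[OF M])
  next
    case False
    hence "card {(b, a). b \<in> {- int M..int M} \<and> a \<in> {- int M..int M} \<and>
       \<bar>M * u $ f + of_int b * u $ (f + 2) + of_int a * u $ (f + 1)\<bar> < \<bar>u $ (f + 2)\<bar> + \<bar>u $ (f + 1)\<bar>} \<le> 12 * M"
      by (intro card_strip_le[OF M]) auto
    also have "{(b, a). b \<in> {- int M..int M} \<and> a \<in> {- int M..int M} \<and>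
       \<bar>M * u $ f + of_int b * u $ (f + 2) + of_int a * u $ (f + 1)\<bar> < \<bar>u $ (f + 2)\<bar> + \<bar>u $ (f + 1)\<bar>} = prod.swap ` S f"
      by (auto simp: S_def image_iff algebra_simps)
    also have "card (prod.swap ` S f) = card (S f)" by (intro card_image) auto
    finally show ?thesis .
  qed
  have "hit M u = (SIGMA f:UNIV. S f)"
    by (auto simp: hit_def cells_def straddles_def corner_def S_def)
  moreover have "finite (S f)" for f
    by (rule finite_subset[of _ "{- int M..int M} \<times> {- int M..int M}"]) (auto simp: S_def)
  ultimately have "card (hit M u) = (\<Sum>f\<in>UNIV. card (S f))"
    by (simp only:) (rule card_SigmaI, auto)
  also have "\<dots> \<le> (\<Sum>f\<in>(UNIV::3 set). 12 * M)" by (intro sum_mono S)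
  finally show ?thesis by simp
qed

text \<open>Greedy choice: once no cell holds five ungrouped indices, each occupied cell has at most
  four left over.\<close>

lemma exists_groups_of_five:
  fixes \<kappa> :: "'i \<Rightarrow> 'c"
  assumes "finite I"
  shows "\<exists>G. finite G \<and> disjoint G \<and> (\<forall>g\<in>G. g \<subseteq> I \<and> card g = 5 \<and> (\<exists>c. \<forall>i\<in>g. \<kappa> i = c)) \<and>
      card I \<le> 5 * card G + 4 * card (\<kappa> ` I)"
  using assms
proof (induction "card I" arbitrary: I rule: less_induct)
  case less
  show ?case
  proof (cases "\<exists>c. card {i\<in>I. \<kappa> i = c} \<ge> 5")
    case False
    have "card I = (\<Sum>c\<in>\<kappa> ` I. card {i\<in>I. \<kappa> i = c})"
      using sum.image_gen[OF less.prems, of "\<lambda>_. 1::nat" \<kappa>] by simp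
    also have "\<dots> \<le> (\<Sum>c\<in>\<kappa> ` I. 4)"
    proof (rule sum_mono, rule ccontr)
      fix c assume "\<not> card {i\<in>I. \<kappa> i = c} \<le> 4"
      hence "card {i\<in>I. \<kappa> i = c} \<ge> 5" by simp
      with False show False by blast
    qed
    finally show ?thesis by (intro exI[of _ "{}"]) (simp add: disjoint_def)
  next
    case True
    then obtain c where "card {i\<in>I. \<kappa> i = c} \<ge> 5" by blast
    then obtain g where g: "g \<subseteq> {i\<in>I. \<kappa> i = c}" "card g = 5"
      by (meson obtain_subset_with_card_n)
    have gI: "g \<subseteq> I" using g by auto
    have fg: "finite g" using gI less.prems by (rule finite_subset)
    have cI: "card I = card (I - g) + 5"
      using g fg gI less.prems card_mono[OF less.prems gI] by (simp add: card_Diff_subset)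
    hence lt: "card (I - g) < card I" and fd: "finite (I - g)" using less.prems by auto
    from less.hyps[OF lt fd] obtain G where GG: "finite G \<and> disjoint G \<and> (\<forall>h\<in>G. h \<subseteq> I - g \<and> card h = 5 \<and> (\<exists>c. \<forall>i\<in>h. \<kappa> i = c)) \<and>
        card (I - g) \<le> 5 * card G + 4 * card (\<kappa> ` (I - g))" ..
    note G = GG[THEN conjunct1] GG[THEN conjunct2, THEN conjunct1]
      GG[THEN conjunct2, THEN conjunct2, THEN conjunct1] GG[THEN conjunct2, THEN conjunct2, THEN conjunct2]
    have ng: "g \<notin> G"
    proof
      assume "g \<in> G"
      with G(3) have "g \<subseteq> I - g" by blast
      hence "g = {}" by blast
      with g(2) show False by simp
    qed
    have "card (\<kappa> ` (I - g)) \<le> card (\<kappa> ` I)"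
      using less.prems by (intro card_mono) auto
    hence "card I \<le> 5 * card (insert g G) + 4 * card (\<kappa> ` I)"
      using cI G(1,4) ng by simp
    moreover have "disjoint (insert g G)"
    proof -
      have "h \<inter> g = {}" if "h \<in> G" for h using G(3) that by blast
      thus ?thesis using G(2) unfolding disjoint_def by blast
    qed
    moreover have "\<forall>h\<in>insert g G. h \<subseteq> I \<and> card h = 5 \<and> (\<exists>c. \<forall>i\<in>h. \<kappa> i = c)"
    proof
      fix h assume "h \<in> insert g G"
      then consider "h = g" | "h \<in> G" by blast
      thus "h \<subseteq> I \<and> card h = 5 \<and> (\<exists>c. \<forall>i\<in>h. \<kappa> i = c)"
      proof cases
        case 1
        thus ?thesis using g gI by blast
      next
        case 2
        with G(3) show ?thesis by blast
      qed
    qed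
    ultimately show ?thesis using G(1) by (intro exI[of _ "insert g G"]) simp
  qed
qed

text \<open>Five vectors \<open>(x i, norm (x i))\<close> in a space of dimension four are dependent.\<close>
lemma exists_mass_preserving_direction:
  fixes x :: "'i \<Rightarrow> real^3"
  assumes g: "card g = 5"
  shows "\<exists>\<eta>. (\<forall>i\<in>g. \<bar>\<eta> i\<bar> \<le> 1) \<and> (\<exists>i\<in>g. \<eta> i = - 1) \<and>
     (\<Sum>i\<in>g. \<eta> i *\<^sub>R x i) = 0 \<and> (\<Sum>i\<in>g. \<eta> i * norm (x i)) = (0::real)"
proof -
  define y where "y i = (x i, norm (x i))" for i
  have fg: "finite g" using g by (metis card.infinite zero_neq_numeral)
  have "\<exists>\<nu>. (\<exists>i\<in>g. \<nu> i \<noteq> 0) \<and> (\<Sum>i\<in>g. \<nu> i *\<^sub>R y i) = 0"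
  \<comment> \<open>\<open>dependent\<close> is a property of sets, so coinciding vectors need a
    relation of their own: the difference of two indicators.\<close>
  proof (cases "inj_on y g")
    case True
    hence "card (y ` g) = 5" using g by (simp add: card_image)
    hence "dependent (y ` g)"
      by (intro dependent_biggerset) (auto simp: )
    then obtain u where u: "\<exists>v\<in>y ` g. u v \<noteq> 0" "(\<Sum>v\<in>y ` g. u v *\<^sub>R v) = 0"
      using dependent_finite[of "y ` g"] fg by auto
    thus ?thesis using True by (intro exI[of _ "\<lambda>i. u (y i)"]) (auto simp: sum.reindex)
  next
    case False
    then obtain i j where ij: "i \<in> g" "j \<in> g" "i \<noteq> j" "y i = y j"
      by (auto simp: inj_on_def)
    define \<nu> :: "'i \<Rightarrow> real" where "\<nu> k = (if k = i then 1 else 0) - (if k = j then 1 else 0)" for k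
    have "(\<Sum>k\<in>g. \<nu> k *\<^sub>R y k) = (\<Sum>k\<in>g. if k = i then y k else 0) - (\<Sum>k\<in>g. if k = j then y k else 0)"
      unfolding sum_subtractf[symmetric] by (intro sum.cong) (auto simp: \<nu>_def scaleR_left_diff_distrib)
    also have "\<dots> = 0" using ij fg by simp
    finally show ?thesis using ij by (intro exI[of _ \<nu>]) (auto simp: \<nu>_def)
  qed
  then obtain \<nu> where \<nu>: "\<exists>i\<in>g. \<nu> i \<noteq> 0" "(\<Sum>i\<in>g. \<nu> i *\<^sub>R y i) = 0" by blast
  have ne: "g \<noteq> {}" using g by auto
  have "Max ((\<lambda>i. \<bar>\<nu> i\<bar>) ` g) \<in> (\<lambda>i. \<bar>\<nu> i\<bar>) ` g"
    using fg ne by (intro Max_in) auto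
  then obtain k where k: "k \<in> g" "Max ((\<lambda>i. \<bar>\<nu> i\<bar>) ` g) = \<bar>\<nu> k\<bar>" by blast
  have kmax: "\<bar>\<nu> i\<bar> \<le> \<bar>\<nu> k\<bar>" if "i \<in> g" for i
    unfolding k(2)[symmetric] using fg that by (intro Max_ge) auto
  have k0: "\<nu> k \<noteq> 0" using kmax \<nu>(1) by fastforce
  have s: "(\<Sum>i\<in>g. \<nu> i *\<^sub>R x i) = 0" "(\<Sum>i\<in>g. \<nu> i * norm (x i)) = 0"
    using arg_cong[OF \<nu>(2), of fst] arg_cong[OF \<nu>(2), of snd]
    by (simp_all add: fst_sum snd_sum y_def)
  \<comment> \<open>Division by the entry of largest modulus, with the sign that turns this entry
    into -1: the weight 1 + \<eta> then vanishes at \<open>k\<close> and is nonnegative on the rest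
    of the group.\<close>
  define \<eta> where "\<eta> i = (- 1/\<nu> k) * \<nu> i" for i
  have "(\<Sum>i\<in>g. \<eta> i *\<^sub>R x i) = (- 1/\<nu> k) *\<^sub>R (\<Sum>i\<in>g. \<nu> i *\<^sub>R x i)"
    unfolding \<eta>_def scaleR_sum_right by simp
  moreover have "(\<Sum>i\<in>g. \<eta> i * norm (x i)) = (- 1/\<nu> k) * (\<Sum>i\<in>g. \<nu> i * norm (x i))"
    unfolding \<eta>_def sum_distrib_left by (simp add: mult.assoc)
  moreover have "\<bar>\<eta> i\<bar> \<le> 1" if "i \<in> g" for i
    using kmax[OF that] k0 by (simp add: \<eta>_def abs_mult abs_divide)
  moreover have "\<eta> k = - 1" using k0 by (simp add: \<eta>_def)
  ultimately show ?thesis using s k(1) by (intro exI[of _ \<eta>]) auto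
qed

section \<open>One reduction step\<close>

definition support_sum :: "'i set \<Rightarrow> ('i \<Rightarrow> real^3) \<Rightarrow> real^3 \<Rightarrow> real" where
  "support_sum I x u = (\<Sum>i\<in>I. \<bar>u \<bullet> x i\<bar>)"

text \<open>The l2 norm is at most the l1 norm. This is applied to the groups of one cell, where
  only their total mass is under control.\<close>

lemma sum_squares_le_square_sum:
  fixes a :: "'g \<Rightarrow> real"
  assumes "finite G"
  shows "(\<Sum>g\<in>G. (a g)\<^sup>2) \<le> (\<Sum>g\<in>G. \<bar>a g\<bar>)\<^sup>2"
  using assms
proof (induction G rule: finite_induct)
  case (insert h G)
  have "(\<bar>a h\<bar> + (\<Sum>g\<in>G. \<bar>a g\<bar>))\<^sup>2 = (a h)\<^sup>2 + (\<Sum>g\<in>G. \<bar>a g\<bar>)\<^sup>2 + 2 * \<bar>a h\<bar> * (\<Sum>g\<in>G. \<bar>a g\<bar>)"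
    by (simp add: power2_sum)
  moreover have "0 \<le> 2 * \<bar>a h\<bar> * (\<Sum>g\<in>G. \<bar>a g\<bar>)" by (simp add: sum_nonneg)
  ultimately have "(a h)\<^sup>2 + (\<Sum>g\<in>G. (a g)\<^sup>2) \<le> (\<bar>a h\<bar> + (\<Sum>g\<in>G. \<bar>a g\<bar>))\<^sup>2"
    using insert.IH by linarith
  thus ?case using insert.hyps by simp
qed simp

text \<open>Variance arithmetic: n m straddled cells, each contributing the square of a factor c/(q
  m) times the cell mass 1/m^2.\<close>

lemma scale_square:
  fixes m q c n :: real
  assumes "m > 0" "q > 0"
  shows "(n * m) * (c/(q * m)/m\<^sup>2)\<^sup>2 = n * c\<^sup>2/(q\<^sup>2 * m^5)"
proof -
  have "(c/(q * m)/m\<^sup>2)\<^sup>2 = c\<^sup>2/(q\<^sup>2 * (m * m^5))"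
    by (simp add: power_divide power_mult_distrib power2_eq_square eval_nat_numeral mult_ac)
  thus ?thesis using assms by simp
qed

text \<open>Of order n^(-5/4) when \<open>M\<close> is of order n^(1/2). In 2306 = 2304 + 2 the
  first part comes from the chain of nets and the second from the gap below the finest net.\<close>

definition step_error :: "nat \<Rightarrow> real" where
  "step_error M = 2306/((real M)\<^sup>2 * sqrt (real M))"

text \<open>The middle clause says that each cell keeps its total length. Arbitrary weights
  \<open>w\<close> on cells yield the masses of coarser cells and the total mass as
  instances.\<close>

definition reduces :: "'i set \<Rightarrow> ('i \<Rightarrow> cell) \<Rightarrow> nat \<Rightarrow> ('i \<Rightarrow> real^3) \<Rightarrow> ('i \<Rightarrow> real) \<Rightarrow> bool" where
  "reduces I \<kappa> M x t \<longleftrightarrow> (\<forall>i\<in>I. 0 \<le> t i) \<and>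
     (\<forall>w. (\<Sum>i\<in>I. t i * (w (\<kappa> i) * norm (x i))) = (\<Sum>i\<in>I. w (\<kappa> i) * norm (x i))) \<and>
     (\<forall>u. \<bar>(\<Sum>i\<in>I. t i * \<bar>u \<bullet> x i\<bar>) - support_sum I x u\<bar> \<le> step_error M * norm u)"

text \<open>The data of one step: cells, groups and their perturbations \<open>\<eta>\<close>.
  \<open>G_large\<close> pays for the entropy in \<open>exists_colouring\<close>, where the
  constraints cost a multiple of M^2 and a fixed fraction of the number of groups is
  available.\<close>

locale rounding_step =
  fixes I :: "'i set" and x :: "'i \<Rightarrow> real^3" and \<kappa> :: "'i \<Rightarrow> cell" and M p :: nat
    and G :: "'i set set" and \<eta> :: "'i set \<Rightarrow> 'i \<Rightarrow> real" and cellof :: "'i set \<Rightarrow> cell"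
  assumes finI: "finite I" and M: "M = 2^p"
    and cone: "\<And>i. i \<in> I \<Longrightarrow> \<kappa> i \<in> cells M \<and> in_cone M (\<kappa> i) (x i)"
    and cell_mass: "\<And>c. (\<Sum>i\<in>{i\<in>I. \<kappa> i = c}. norm (x i)) \<le> 1/(real M)\<^sup>2"
    and total_mass: "(\<Sum>i\<in>I. norm (x i)) \<le> 1"
    and finG: "finite G" and disj: "disjoint G" and GI: "\<And>g. g \<in> G \<Longrightarrow> g \<subseteq> I"
    and cellof: "\<And>g i. g \<in> G \<Longrightarrow> i \<in> g \<Longrightarrow> \<kappa> i = cellof g"
    and G_large: "216 * (real M)\<^sup>2 \<le> 10 * real (card G)"
    and \<eta>1: "\<And>g i. g \<in> G \<Longrightarrow> i \<in> g \<Longrightarrow> \<bar>\<eta> g i\<bar> \<le> 1"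
    and \<eta>_kill: "\<And>g. g \<in> G \<Longrightarrow> \<exists>i\<in>g. \<eta> g i = - 1"
    and \<eta>_vec: "\<And>g. g \<in> G \<Longrightarrow> (\<Sum>i\<in>g. \<eta> g i *\<^sub>R x i) = 0"
    and \<eta>_norm: "\<And>g. g \<in> G \<Longrightarrow> (\<Sum>i\<in>g. \<eta> g i * norm (x i)) = 0"
begin

text \<open>The first-order effect of group \<open>g\<close>: the change of the support sum at
  \<open>u\<close> if \<eta> g is added to the weights 1.\<close>

definition D :: "real^3 \<Rightarrow> 'i set \<Rightarrow> real" where
  "D u g = (\<Sum>i\<in>g. \<eta> g i * \<bar>u \<bullet> x i\<bar>)"

definition mass :: "'i set \<Rightarrow> real" where
  "mass g = (\<Sum>i\<in>g. norm (x i))"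

lemma M1: "M \<ge> 1" by (simp add: M)

lemma fing: "g \<in> G \<Longrightarrow> finite g"
  using GI finI finite_subset by blast

lemma mass_nonneg: "mass g \<ge> 0"
  by (simp add: mass_def sum_nonneg)

lemma cone_g: "g \<in> G \<Longrightarrow> i \<in> g \<Longrightarrow> in_cone M (cellof g) (x i)"
  using cone GI cellof by (metis subsetD)

text \<open>Here |u . x| is linear on the cone of the cell, and \<eta> preserves the vector sum of
  the group.\<close>

lemma D_not_straddles:
  assumes g: "g \<in> G" and ns: "\<not> straddles M u (cellof g)"
  shows "D u g = 0"
proof -
  have "D u g = (\<Sum>i\<in>g. sgn (corner M u (cellof g)) * (u \<bullet> (\<eta> g i *\<^sub>R x i)))"
    unfolding D_def
    using abs_inner_not_straddles[OF cone_g[OF g] M1 ns] by (intro sum.cong) auto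
  also have "\<dots> = sgn (corner M u (cellof g)) * (u \<bullet> (\<Sum>i\<in>g. \<eta> g i *\<^sub>R x i))"
    by (simp only: inner_sum_right sum_distrib_left)
  finally show ?thesis by (simp add: \<eta>_vec[OF g])
qed

lemma abs_eta_sum_le:
  assumes g: "g \<in> G" and "\<And>i. i \<in> g \<Longrightarrow> \<bar>\<phi> i\<bar> \<le> \<gamma> * norm (x i)"
  shows "\<bar>\<Sum>i\<in>g. \<eta> g i * \<phi> i\<bar> \<le> \<gamma> * mass g"
proof -
  have "\<bar>\<Sum>i\<in>g. \<eta> g i * \<phi> i\<bar> \<le> (\<Sum>i\<in>g. \<bar>\<eta> g i * \<phi> i\<bar>)" by (rule sum_abs)
  also have "\<dots> \<le> (\<Sum>i\<in>g. \<gamma> * norm (x i))"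
  proof (rule sum_mono)
    fix i assume i: "i \<in> g"
    have "\<bar>\<eta> g i * \<phi> i\<bar> \<le> 1 * (\<gamma> * norm (x i))"
      unfolding abs_mult using \<eta>1[OF g i] assms(2)[OF i] by (intro mult_mono) auto
    thus "\<bar>\<eta> g i * \<phi> i\<bar> \<le> \<gamma> * norm (x i)" by simp
  qed
  finally show ?thesis by (simp add: mass_def sum_distrib_left)
qed

lemma D_le:
  assumes g: "g \<in> G"
  shows "\<bar>D u g\<bar> \<le> 4 * norm u/M * mass g"
proof (cases "straddles M u (cellof g)")
  case True
  show ?thesis unfolding D_def
    using abs_inner_straddles[OF cone_g[OF g] M1 True] by (intro abs_eta_sum_le[OF g]) auto
next
  case False
  thus ?thesis using D_not_straddles[OF g] mass_nonneg by simp
qed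

lemma D_diff_le:
  assumes g: "g \<in> G"
  shows "\<bar>D u g - D v g\<bar> \<le> norm (u - v) * mass g"
proof -
  have "D u g - D v g = (\<Sum>i\<in>g. \<eta> g i * (\<bar>u \<bullet> x i\<bar> - \<bar>v \<bullet> x i\<bar>))"
    by (simp add: D_def sum_subtractf right_diff_distrib)
  also have "\<bar>\<dots>\<bar> \<le> norm (u - v) * mass g"
  proof (rule abs_eta_sum_le[OF g])
    fix i
    have "\<bar>\<bar>u \<bullet> x i\<bar> - \<bar>v \<bullet> x i\<bar>\<bar> \<le> \<bar>(u - v) \<bullet> x i\<bar>"
      by (simp add: inner_diff_left)
    also have "\<dots> \<le> norm (u - v) * norm (x i)" by (rule Cauchy_Schwarz_ineq2)
    finally show "\<bar>\<bar>u \<bullet> x i\<bar> - \<bar>v \<bullet> x i\<bar>\<bar> \<le> norm (u - v) * norm (x i)" .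
  qed
  finally show ?thesis .
qed

lemma sum_groups_le:
  assumes "H \<subseteq> G" "\<And>g. g \<in> H \<Longrightarrow> g \<subseteq> A" "finite A" "\<And>i. i \<in> A \<Longrightarrow> (0::real) \<le> \<phi> i"
  shows "(\<Sum>g\<in>H. \<Sum>i\<in>g. \<phi> i) \<le> (\<Sum>i\<in>A. \<phi> i)"
proof -
  have "(\<Sum>g\<in>H. \<Sum>i\<in>g. \<phi> i) = (\<Sum>i\<in>\<Union>H. \<phi> i)"
    using assms(1) disj fing finG
    by (subst sum.Union_disjoint) (auto simp: disjoint_def)
  also have "\<dots> \<le> (\<Sum>i\<in>A. \<phi> i)" using assms by (intro sum_mono2) auto
  finally show ?thesis .
qed

text \<open>The variance bound behind all increments: disjoint groups of one cell have total mass at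
  most 1/M^2, so each relevant cell contributes at most (\<gamma>/M^2)^2.\<close>

lemma sum_squares_le:
  assumes C0: "finite C0" "real (card C0) \<le> n0" and \<gamma>: "\<gamma> \<ge> 0"
    and a: "\<And>g. g \<in> G \<Longrightarrow> \<bar>a g\<bar> \<le> \<gamma> * mass g"
    and a0: "\<And>g. g \<in> G \<Longrightarrow> cellof g \<notin> C0 \<Longrightarrow> a g = 0"
  shows "(\<Sum>g\<in>G. (a g)\<^sup>2) \<le> n0 * (\<gamma>/(real M)\<^sup>2)\<^sup>2"
proof -
  have cellwise: "(\<Sum>g\<in>{g\<in>G. cellof g = c}. (a g)\<^sup>2) \<le> (\<gamma>/(real M)\<^sup>2)\<^sup>2" for c
  proof -
    have "(\<Sum>g\<in>{g\<in>G. cellof g = c}. (a g)\<^sup>2) \<le> (\<Sum>g\<in>{g\<in>G. cellof g = c}. \<bar>a g\<bar>)\<^sup>2"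
      using finG by (intro sum_squares_le_square_sum) auto
    also have "\<dots> \<le> (\<gamma>/(real M)\<^sup>2)\<^sup>2"
    proof (intro power_mono sum_nonneg)
      have "(\<Sum>g\<in>{g\<in>G. cellof g = c}. \<bar>a g\<bar>) \<le> (\<Sum>g\<in>{g\<in>G. cellof g = c}. \<gamma> * mass g)"
        using a by (intro sum_mono) auto
      also have "\<dots> = \<gamma> * (\<Sum>g\<in>{g\<in>G. cellof g = c}. \<Sum>i\<in>g. norm (x i))"
        by (simp add: mass_def sum_distrib_left)
      also have "\<dots> \<le> \<gamma> * (\<Sum>i\<in>{i\<in>I. \<kappa> i = c}. norm (x i))"
        using \<gamma> finI GI cellof by (intro mult_left_mono sum_groups_le) auto
      also have "\<dots> \<le> \<gamma> * (1/(real M)\<^sup>2)"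
        by (intro mult_left_mono cell_mass \<gamma>)
      finally show "(\<Sum>g\<in>{g\<in>G. cellof g = c}. \<bar>a g\<bar>) \<le> \<gamma>/(real M)\<^sup>2" by simp
    qed auto
    finally show ?thesis .
  qed
  have "(\<Sum>g\<in>G. (a g)\<^sup>2) = (\<Sum>g\<in>{g\<in>G. cellof g \<in> C0}. (a g)\<^sup>2)"
    using finG a0 by (intro sum.mono_neutral_right) auto
  also have "\<dots> = (\<Sum>c\<in>C0. \<Sum>g\<in>{g\<in>G. cellof g = c}. (a g)\<^sup>2)"
    using finG C0 by (subst sum.group[symmetric, where T = C0 and g = cellof])
      (auto intro!: sum.cong)
  also have "\<dots> \<le> (\<Sum>c\<in>C0. (\<gamma>/(real M)\<^sup>2)\<^sup>2)"
    by (intro sum_mono cellwise)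
  also have "\<dots> \<le> n0 * (\<gamma>/(real M)\<^sup>2)\<^sup>2"
    using C0 by (simp add: mult_right_mono)
  finally show ?thesis .
qed

text \<open>Chaining: the nets have mesh \<open>1/(4^k M)\<close>. At level \<open>k\<close> the increments have standard deviation
  at most \<open>dev k\<close>, of order \<open>4^(- k)\<close>, and are kept below \<open>16 * 2^k * dev k\<close>: the entropies and the
  bounds are then both summable over \<open>k\<close>.\<close>
definition pt :: "nat \<Rightarrow> 3 \<Rightarrow> int \<Rightarrow> int \<Rightarrow> real^3" where
  "pt k f s t = (\<chi> i. if i = f then 1 else if i = f + 1 then of_int s/(4^k * real M)
      else of_int t/(4^k * real M))"

lemma pt_nth: "pt k f s t $ f = 1" "pt k f s t $ (f + 1) = of_int s/(4^k * real M)"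
  "pt k f s t $ (f + 2) = of_int t/(4^k * real M)"
  by (simp_all add: pt_def)

definition net :: "nat \<Rightarrow> (3 \<times> int \<times> int) set" where
  "net k = UNIV \<times> {- int (4^k * M)..int (4^k * M)} \<times> {- int (4^k * M)..int (4^k * M)}"

text \<open>Grid points of mesh 1/(4^k M) are the corners of the cells of level 4^k M, so
  \<open>card_cells\<close> counts them.\<close>

lemma net_cells: "net k = cells (4^k * M)"
  by (simp add: net_def cells_def)

text \<open>The parent of a grid point has its indices divided by 4 and rounded down. At level 0
  there is no parent, and the increment is the value itself.\<close>

definition incr :: "nat \<times> 3 \<times> int \<times> int \<Rightarrow> 'i set \<Rightarrow> real" where
  "incr j g = (case j of (k, f, s, t) \<Rightarrow>
     D (pt k f s t) g - (if k = 0 then 0 else D (pt (k - 1) f (s div 4) (t div 4)) g))"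

text \<open>72^2 = 36 * 12^2 is the bound at level 0, from 36 M straddled cells and 4 norm u <= 12.
  The later levels give only 72 * 8^2.\<close>

definition dev :: "nat \<Rightarrow> real" where
  "dev k = 72/(4^k * ((real M)\<^sup>2 * sqrt (real M)))"

lemma dev_pos: "dev k > 0"
  using M1 by (simp add: dev_def)

lemma dev_sq: "(dev k)\<^sup>2 = 5184/(16^k * real M^5)"
proof -
  have "(dev k)\<^sup>2 = 72\<^sup>2/((4^k)\<^sup>2 * (((real M)\<^sup>2)\<^sup>2 * (sqrt (real M))\<^sup>2))"
    by (simp add: dev_def power_divide power_mult_distrib)
  also have "(4^k :: real)\<^sup>2 = 16^k"
    by (simp add: power_mult[symmetric] mult.commute[of k] power_mult)
  moreover have "((real M)\<^sup>2)\<^sup>2 * (sqrt (real M))\<^sup>2 = real M^5"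
    by (simp add: eval_nat_numeral)
  ultimately show ?thesis by simp
qed

text \<open>An increment vanishes on groups whose cell is straddled by neither the point nor its
  parent; this leaves at most 72 M cells. On these the Lipschitz bound applies with distance at most
  8/(4^k M). Level 0 uses the smallness of |u . x| on straddled cells instead.\<close>

lemma incr_squares:
  assumes j: "(f, s, t) \<in> net k"
  shows "(\<Sum>g\<in>G. (incr (k, f, s, t) g)\<^sup>2) \<le> (dev k)\<^sup>2"
proof (cases k)
  case 0
  define u where "u = pt 0 f s t"
  have nu: "norm u \<le> 3"
  proof -
    have "norm u \<le> \<bar>u $ f\<bar> + \<bar>u $ (f + 1)\<bar> + \<bar>u $ (f + 2)\<bar>" by (rule norm_le_shift3)
    also have "\<dots> \<le> 1 + 1 + 1"
      unfolding u_def pt_nth using j M1 0 by (intro add_mono) (auto simp: net_def abs_le_iff)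
    finally show ?thesis by simp
  qed
  have "(\<Sum>g\<in>G. (D u g)\<^sup>2) \<le> (36 * M) * (12/M/(real M)\<^sup>2)\<^sup>2"
  proof (rule sum_squares_le[where ?C0.0 = "hit M u"])
    show "real (card (hit M u)) \<le> 36 * M"
      using card_straddling_le[OF M1, of u] by linarith
    fix g assume g: "g \<in> G"
    have "\<bar>D u g\<bar> \<le> 4 * norm u/M * mass g" by (rule D_le[OF g])
    also have "\<dots> \<le> 12/M * mass g"
      using nu by (intro mult_right_mono mass_nonneg divide_right_mono) auto
    finally show "\<bar>D u g\<bar> \<le> 12/M * mass g" .
    obtain i where "i \<in> g" using \<eta>_kill[OF g] by blast
    hence "cellof g \<in> cells M" using cone GI cellof g by (metis subsetD)
    thus "cellof g \<notin> hit M u \<Longrightarrow> D u g = 0"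
      using D_not_straddles[OF g] by (auto simp: hit_def)
  qed auto
  also have "\<dots> = (dev k)\<^sup>2"
    using M1 scale_square[of "real M" 1 36 12] unfolding dev_sq 0 by simp
  finally show ?thesis by (simp add: incr_def 0 u_def)
next
  case (Suc k')
  define u where "u = pt k f s t"
  define v where "v = pt k' f (s div 4) (t div 4)"
  have Mp: "real M > 0" using M1 by simp
  have dv: "\<bar>of_int z/(4^k * real M) - of_int (z div 4)/(4^k' * real M)\<bar> \<le> 4/(4^k * real M)" for z :: int
  proof -
    have e1: "of_int z/(4^k * real M) - of_int (z div 4)/(4^k' * real M) = of_int (z mod 4)/(4^k * real M)"
    proof -
      have "real_of_int z = of_int (4 * (z div 4) + z mod 4)" by simp
      hence "real_of_int z = 4 * of_int (z div 4) + of_int (z mod 4)"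
        unfolding of_int_add of_int_mult by simp
      thus ?thesis using Mp by (simp add: Suc field_simps)
    qed
    have "\<bar>real_of_int (z mod 4)/(4^k * real M)\<bar> = of_int (z mod 4)/(4^k * real M)"
      using Mp by simp
    also have "\<dots> \<le> 4/(4^k * real M)"
    proof (rule divide_right_mono)
      have "z mod 4 \<le> 4" using pos_mod_bound[of 4 z] by simp
      thus "real_of_int (z mod 4) \<le> 4" by linarith
    qed (use Mp in simp)
    finally show ?thesis unfolding e1 .
  qed
  have nuv: "norm (u - v) \<le> 8/(4^k * real M)"
  proof -
    have "norm (u - v) \<le> \<bar>(u - v) $ f\<bar> + \<bar>(u - v) $ (f + 1)\<bar> + \<bar>(u - v) $ (f + 2)\<bar>" by (rule norm_le_shift3)
    also have "\<dots> \<le> 0 + 4/(4^k * real M) + 4/(4^k * real M)"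
      unfolding u_def v_def vector_minus_component pt_nth
      by (intro add_mono dv) simp
    also have "0 + 4/(4^k * real M) + 4/(4^k * real M) = 8/(4^k * real M)"
      unfolding add_0 add_divide_distrib[symmetric] by simp
    finally show ?thesis .
  qed
  have "(\<Sum>g\<in>G. (D u g - D v g)\<^sup>2) \<le> (72 * M) * (8/(4^k * real M)/(real M)\<^sup>2)\<^sup>2"
  proof (rule sum_squares_le[where ?C0.0 = "hit M u \<union> hit M v"])
    have "card (hit M u \<union> hit M v) \<le> 36 * M + 36 * M"
      using card_straddling_le[OF M1, of u] card_straddling_le[OF M1, of v] card_Un_le
      by (meson add_mono le_trans)
    thus "real (card (hit M u \<union> hit M v)) \<le> 72 * M"
      by linarith
    fix g assume g: "g \<in> G"
    have "\<bar>D u g - D v g\<bar> \<le> norm (u - v) * mass g" by (rule D_diff_le[OF g])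
    also have "\<dots> \<le> 8/(4^k * real M) * mass g"
      using nuv by (intro mult_right_mono mass_nonneg)
    finally show "\<bar>D u g - D v g\<bar> \<le> 8/(4^k * real M) * mass g" .
    obtain i where "i \<in> g" using \<eta>_kill[OF g] by blast
    hence "cellof g \<in> cells M" using cone GI cellof g by (metis subsetD)
    thus "cellof g \<notin> hit M u \<union> hit M v \<Longrightarrow> D u g - D v g = 0"
      using D_not_straddles[OF g] by (auto simp: hit_def)
  qed auto
  also have "\<dots> = 4608/(16^k * real M^5)"
  proof -
    have "(4^k :: real)\<^sup>2 = 16^k"
      by (simp add: power_mult[symmetric] mult.commute[of k] power_mult)
    thus ?thesis using scale_square[OF Mp, of "4^k" 72 8] by simp
  qed
  also have "\<dots> \<le> (dev k)\<^sup>2" unfolding dev_sq by (intro divide_right_mono) auto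
  finally show ?thesis by (simp add: incr_def Suc u_def v_def)
qed


text \<open>From exp(y/3) >= y/3. Cubic decay is what the chaining needs: net \<open>k\<close> has
  order 16^k M^2 points and y is 16 * 4^k, which leaves the summable factor 4^(-k).\<close>

lemma exp_minus_le: "exp (- y) \<le> 27/y^3" if "y > 0" for y :: real
proof -
  have "(y/3)^3 \<le> exp (y/3)^3"
    using that exp_ge_add_one_self[of "y/3"] by (intro power_mono) linarith+
  also have "\<dots> = exp y" by (simp add: exp_of_nat_mult[symmetric])
  finally have "y^3/27 \<le> exp y" by (simp add: power_divide)
  thus ?thesis using that by (simp add: exp_minus field_simps)
qed

lemma sum_geometric_le: "0 < r \<Longrightarrow> r < 1 \<Longrightarrow> (\<Sum>k\<le>n. r^k) \<le> 1/(1 - r)" for r :: real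
  by (simp add: sum_gp0 divide_right_mono)

text \<open>With K = 16 * 2^k the cost of level \<open>k\<close> is of order M^2 4^(-k). The total
  is below 2.16 M^2, and \<open>G_large\<close> says that card G/10 is at least that.\<close>

lemma exists_colouring:
  "\<exists>\<tau> :: 'i set \<Rightarrow> real. (\<forall>g. \<tau> g \<in> {-1, 0, 1}) \<and> real (card {g\<in>G. \<tau> g \<noteq> 0}) > real (card G)/10 \<and>
     (\<forall>k\<le>p. \<forall>(f, s, t)\<in>net k. \<bar>\<Sum>g\<in>G. \<tau> g * incr (k, f, s, t) g\<bar> \<le> 16 * 2^k * dev k)"
proof -
  define J where "J = (SIGMA k:{..p}. net k)"
  have finnet: "finite (net k)" for k by (simp add: net_def)
  have Mp: "real M > 0" using M1 by simp
  have Gne: "G \<noteq> {}" using G_large Mp by auto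
  have "\<exists>\<tau> :: 'i set \<Rightarrow> real. (\<forall>g. \<tau> g \<in> {-1, 0, 1}) \<and> real (card {g\<in>G. \<tau> g \<noteq> 0}) > real (card G)/10 \<and>
     (\<forall>j\<in>J. \<bar>\<Sum>g\<in>G. \<tau> g * incr j g\<bar> \<le> (16 * 2^fst j) * dev (fst j))"
  proof (rule partial_colouring[OF finG Gne])
    show "finite J" unfolding J_def by (intro finite_SigmaI finnet) auto
    show "(\<Sum>g\<in>G. (incr j g)\<^sup>2) \<le> (dev (fst j))\<^sup>2" if "j \<in> J" for j
      using that incr_squares by (auto simp: J_def)
    show "dev (fst j) > 0" for j :: "nat \<times> 3 \<times> int \<times> int" by (rule dev_pos)
    have "(1::real) \<le> 2^k" for k by simp
    thus "4 \<le> 16 * (2::real)^fst j" for j :: "nat \<times> 3 \<times> int \<times> int"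
      using \<open>\<And>k. (1::real) \<le> 2^k\<close>[of "fst j"] by linarith
    have each: "(\<Sum>i\<in>net k. 6 * exp (- ((16 * 2^k)\<^sup>2/16))) \<le> (27 * 6 * 27/4096) * (real M)\<^sup>2 * (1/4)^k" for k
    proof -
      have y: "(16 * 2^k)\<^sup>2/16 = 16 * (4::real)^k"
        by (simp add: power_mult_distrib power_mult[symmetric] mult.commute[of k] power_mult)
      have "card (net k) \<le> 27 * (4^k * M)\<^sup>2"
        unfolding net_cells using M1 by (intro card_cells) simp
      hence c: "real (card (net k)) \<le> 27 * (4^k * real M)\<^sup>2"
        using of_nat_mono[where 'a = real] by fastforce
      have "exp (- (16 * (4::real)^k)) \<le> 27/(16 * 4^k)^3"
        by (rule exp_minus_le) simp
      hence "real (card (net k)) * (6 * exp (- (16 * 4^k))) \<le>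
          (27 * (4^k * real M)\<^sup>2) * (6 * (27/(16 * 4^k)^3))"
        by (intro mult_mono c) auto
      also have "\<dots> = (27 * 6 * 27/4096) * (real M)\<^sup>2 * (1/4)^k"
      proof -
        have "q > 0 \<Longrightarrow> (27 * (q * m)\<^sup>2) * (6 * (27/(16 * q)^3)) = (27 * 6 * 27/4096) * m\<^sup>2 * (1/q)"
          for q m :: real by (simp add: field_simps eval_nat_numeral)
        from this[of "4^k" "real M"] show ?thesis by (simp add: power_one_over)
      qed
      finally show ?thesis unfolding y by simp
    qed
    have "(\<Sum>j\<in>J. 6 * exp (- ((16 * 2^fst j)\<^sup>2/16))) =
        (\<Sum>k\<le>p. \<Sum>i\<in>net k. 6 * exp (- ((16 * 2^k)\<^sup>2/16)))"
      unfolding J_def using finnet by (subst sum.Sigma) (auto simp: case_prod_beta)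
    also have "\<dots> \<le> (\<Sum>k\<le>p. (27 * 6 * 27/4096) * (real M)\<^sup>2 * (1/4)^k)"
      by (intro sum_mono each)
    also have "\<dots> = (27 * 6 * 27/4096) * (real M)\<^sup>2 * (\<Sum>k\<le>p. (1/4)^k)"
      by (simp only: sum_distrib_left)
    also have "\<dots> \<le> (27 * 6 * 27/4096) * (real M)\<^sup>2 * (4/3)"
      using sum_geometric_le[of "1/4" p] by (intro mult_left_mono) auto
    also have "\<dots> \<le> real (card G)/10"
    proof -
      have "(27 * 6 * 27/4096) * (real M)\<^sup>2 * (4/3) \<le> (216/100) * (real M)\<^sup>2" by simp
      thus ?thesis using G_large by linarith
    qed
    finally show "(\<Sum>j\<in>J. 6 * exp (- ((16 * 2^fst j)\<^sup>2/16))) \<le> real (card G)/10" .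
  qed
  then obtain \<tau> :: "'i set \<Rightarrow> real" where \<tau>: "\<forall>g. \<tau> g \<in> {-1, 0, 1}"
    "real (card {g\<in>G. \<tau> g \<noteq> 0}) > real (card G)/10"
    "\<forall>j\<in>J. \<bar>\<Sum>g\<in>G. \<tau> g * incr j g\<bar> \<le> (16 * 2^fst j) * dev (fst j)" by (elim exE conjE)
  have "\<bar>\<Sum>g\<in>G. \<tau> g * incr (k, f, s, t) g\<bar> \<le> 16 * 2^k * dev k" if "k \<le> p" "(f, s, t) \<in> net k" for k f s t
    using bspec[OF \<tau>(3), of "(k, f, s, t)"] that by (simp add: J_def)
  thus ?thesis using \<tau>(1,2) by (intro exI[of _ \<tau>]) auto
qed

definition grid :: "3 \<Rightarrow> real^3 \<Rightarrow> nat \<Rightarrow> real^3" where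
  "grid f w k = pt k f \<lfloor>4^k * real M * w $ (f + 1)\<rfloor> \<lfloor>4^k * real M * w $ (f + 2)\<rfloor>"

lemma floor_div4: "\<lfloor>4^Suc k * real M * y\<rfloor> div 4 = \<lfloor>4^k * real M * y\<rfloor>"
proof -
  have "\<lfloor>4^Suc k * real M * y\<rfloor> div 4 = \<lfloor>4^Suc k * real M * y/real_of_int 4\<rfloor>"
    by (rule floor_divide_real_eq_div[symmetric]) simp
  also have "4^Suc k * real M * y/real_of_int 4 = 4^k * real M * y" by simp
  finally show ?thesis .
qed

text \<open>A telescoping sum: by \<open>floor_div4\<close> the parent of the grid point below
  \<open>w\<close> at one level is the grid point below \<open>w\<close> at the previous
  level.\<close>

lemma sum_incr_grid:
  "(\<Sum>k\<le>q. incr (k, f, \<lfloor>4^k * real M * w $ (f + 1)\<rfloor>, \<lfloor>4^k * real M * w $ (f + 2)\<rfloor>) g) = D (grid f w q) g"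
proof (induction q)
  case (Suc q)
  show ?case
  proof -
    have "incr (Suc q, f, \<lfloor>4^Suc q * real M * w $ (f + 1)\<rfloor>, \<lfloor>4^Suc q * real M * w $ (f + 2)\<rfloor>) g =
        D (grid f w (Suc q)) g - D (grid f w q) g"
      by (simp only: incr_def prod.case floor_div4 grid_def diff_Suc_1 nat.distinct if_False)
    thus ?thesis unfolding sum.atMost_Suc Suc.IH by simp
  qed
qed (simp add: incr_def grid_def)

text \<open>The chain contributes a geometric series: 16 * 72 = 1152 with ratio 1/2, hence 2304 in
  units of \<open>\<nu>\<close>. The remaining distance to the finest net is covered by the
  Lipschitz bound and the total mass.\<close>

lemma patch_bound:
  assumes \<tau>1: "\<And>g. \<bar>\<tau> g\<bar> \<le> 1"
    and \<tau>: "\<And>k f s t. k \<le> p \<Longrightarrow> (f, s, t) \<in> net k \<Longrightarrow> \<bar>\<Sum>g\<in>G. \<tau> g * incr (k, f, s, t) g\<bar> \<le> 16 * 2^k * dev k"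
    and w: "w $ f = 1" "\<And>i. \<bar>w $ i\<bar> \<le> 1"
  shows "\<bar>\<Sum>g\<in>G. \<tau> g * D w g\<bar> \<le> step_error M"
proof -
  define v where "v = grid f w p"
  define \<nu> where "\<nu> = 1/((real M)\<^sup>2 * sqrt (real M))"
  have Mp: "real M \<ge> 1" using M1 by simp
  have fl: "\<lfloor>4^k * real M * w $ i\<rfloor> \<in> {- int (4^k * M)..int (4^k * M)}" for k i
  proof -
    have "\<bar>4^k * real M * w $ i\<bar> \<le> 4^k * real M * 1"
      unfolding abs_mult using w(2)[of i] by (intro mult_mono) auto
    hence "- real_of_int (int (4^k * M)) \<le> 4^k * real M * w $ i" "4^k * real M * w $ i \<le> real_of_int (int (4^k * M))"
      by (simp_all add: abs_le_iff)
    hence "- int (4^k * M) \<le> \<lfloor>4^k * real M * w $ i\<rfloor>" "\<lfloor>4^k * real M * w $ i\<rfloor> \<le> int (4^k * M)"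
      by linarith+
    thus ?thesis by simp
  qed
  have "(\<Sum>g\<in>G. \<tau> g * D v g) = (\<Sum>k\<le>p. \<Sum>g\<in>G. \<tau> g * incr (k, f, \<lfloor>4^k * real M * w $ (f + 1)\<rfloor>, \<lfloor>4^k * real M * w $ (f + 2)\<rfloor>) g)"
    unfolding v_def sum_incr_grid[symmetric] sum_distrib_left by (rule sum.swap)
  also have "\<bar>\<dots>\<bar> \<le> (\<Sum>k\<le>p. 16 * 2^k * dev k)"
    using fl by (intro order_trans[OF sum_abs] sum_mono \<tau>) (auto simp: net_def)
  also have "\<dots> = (\<Sum>k\<le>p. 1152 * \<nu> * (1/2)^k)"
  proof (rule sum.cong[OF refl])
    fix k
    have "(4::real)^k = 2^k * 2^k" by (simp add: power_mult_distrib[symmetric])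
    thus "16 * 2^k * dev k = 1152 * \<nu> * (1/2)^k"
      by (simp add: dev_def \<nu>_def power_one_over)
  qed
  also have "\<dots> = 1152 * \<nu> * (\<Sum>k\<le>p. (1/2)^k)" by (simp only: sum_distrib_left)
  also have "\<dots> \<le> 1152 * \<nu> * 2"
    using sum_geometric_le[of "1/2" p] by (intro mult_left_mono) (auto simp: \<nu>_def)
  finally have 1: "\<bar>\<Sum>g\<in>G. \<tau> g * D v g\<bar> \<le> 2304 * \<nu>" by simp
  have rnd: "\<bar>y - of_int \<lfloor>4^p * real M * y\<rfloor>/(4^p * real M)\<bar> \<le> 1/(4^p * real M)" for y
  proof -
    have q: "4^p * real M > 0" using Mp by simp
    have "\<bar>4^p * real M * y - of_int \<lfloor>4^p * real M * y\<rfloor>\<bar> \<le> 1" by linarith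
    hence "\<bar>4^p * real M * y - of_int \<lfloor>4^p * real M * y\<rfloor>\<bar>/(4^p * real M) \<le> 1/(4^p * real M)"
      using q by (intro divide_right_mono) auto
    also have "\<bar>4^p * real M * y - of_int \<lfloor>4^p * real M * y\<rfloor>\<bar>/(4^p * real M) =
       \<bar>(4^p * real M * y - of_int \<lfloor>4^p * real M * y\<rfloor>)/(4^p * real M)\<bar>"
      using q by (simp only: abs_divide abs_of_pos)
    also have "(4^p * real M * y - of_int \<lfloor>4^p * real M * y\<rfloor>)/(4^p * real M) =
       y - of_int \<lfloor>4^p * real M * y\<rfloor>/(4^p * real M)"
      using Mp by (simp add: diff_divide_distrib)
    finally show ?thesis .
  qed
  have "norm (w - v) \<le> \<bar>(w - v) $ f\<bar> + \<bar>(w - v) $ (f + 1)\<bar> + \<bar>(w - v) $ (f + 2)\<bar>" by (rule norm_le_shift3)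
  also have "\<dots> \<le> 0 + 1/(4^p * real M) + 1/(4^p * real M)"
    unfolding v_def grid_def vector_minus_component pt_nth w(1)
    by (intro add_mono rnd) simp
  \<comment> \<open>This fixes the last level: 4^p = M^2, so the finest mesh 1/M^3 lies below the
    target M^(-5/2).\<close>
  also have "\<dots> = 2/((real M)\<^sup>2 * real M)"
  proof -
    have "(4::real)^p = (real M)\<^sup>2" unfolding M by (simp add: power_mult[symmetric] mult.commute[of p] power_mult)
    thus ?thesis by simp
  qed
  also have "\<dots> \<le> 2 * \<nu>"
  proof -
    have "sqrt (real M) * 1 \<le> sqrt (real M) * sqrt (real M)" using Mp by (intro mult_left_mono) auto
    hence "sqrt (real M) \<le> real M" by simp
    hence "(real M)\<^sup>2 * sqrt (real M) \<le> (real M)\<^sup>2 * real M" by (intro mult_left_mono) auto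
    thus ?thesis unfolding \<nu>_def using Mp by (simp add: frac_le)
  qed
  finally have nwv: "norm (w - v) \<le> 2 * \<nu>" .
  have "(\<Sum>g\<in>G. mass g) \<le> (\<Sum>i\<in>I. norm (x i))"
    unfolding mass_def using GI finI by (intro sum_groups_le) auto
  hence mG: "(\<Sum>g\<in>G. mass g) \<le> 1" using total_mass by linarith
  have "\<bar>\<Sum>g\<in>G. \<tau> g * (D w g - D v g)\<bar> \<le> (\<Sum>g\<in>G. norm (w - v) * mass g)"
  proof (rule order_trans[OF sum_abs sum_mono])
    fix g assume g: "g \<in> G"
    have "\<bar>\<tau> g * (D w g - D v g)\<bar> \<le> 1 * (norm (w - v) * mass g)"
      unfolding abs_mult by (intro mult_mono \<tau>1 D_diff_le[OF g]) auto
    thus "\<bar>\<tau> g * (D w g - D v g)\<bar> \<le> norm (w - v) * mass g" by simp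
  qed
  also have "\<dots> = norm (w - v) * (\<Sum>g\<in>G. mass g)" by (simp only: sum_distrib_left)
  also have "\<dots> \<le> (2 * \<nu>) * 1"
    using nwv mG mass_nonneg by (intro mult_mono) (auto simp: sum_nonneg \<nu>_def)
  finally have "\<bar>(\<Sum>g\<in>G. \<tau> g * D w g) - (\<Sum>g\<in>G. \<tau> g * D v g)\<bar> \<le> 2 * \<nu>"
    by (simp add: sum_subtractf right_diff_distrib)
  with 1 have "\<bar>\<Sum>g\<in>G. \<tau> g * D w g\<bar> \<le> 2306 * \<nu>" by linarith
  thus ?thesis by (simp add: \<nu>_def step_error_def)
qed

lemma D_scale: "D (c *\<^sub>R w) g = \<bar>c\<bar> * D w g"
  by (simp add: D_def abs_mult sum_distrib_left mult.left_commute)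

text \<open>Both sides are absolutely homogeneous in \<open>u\<close>, so dividing by the coordinate
  of largest modulus moves \<open>u\<close> to a face of the cube.\<close>

lemma global_bound:
  assumes \<tau>1: "\<And>g. \<bar>\<tau> g\<bar> \<le> 1"
    and \<tau>: "\<And>k f s t. k \<le> p \<Longrightarrow> (f, s, t) \<in> net k \<Longrightarrow> \<bar>\<Sum>g\<in>G. \<tau> g * incr (k, f, s, t) g\<bar> \<le> 16 * 2^k * dev k"
  shows "\<bar>\<Sum>g\<in>G. \<tau> g * D u g\<bar> \<le> step_error M * norm u"
proof (cases "u = 0")
  case False
  have "Max (range (\<lambda>i. \<bar>u $ i\<bar>)) \<in> range (\<lambda>i. \<bar>u $ i\<bar>)" by (intro Max_in) auto
  then obtain f where f: "Max (range (\<lambda>i. \<bar>u $ i\<bar>)) = \<bar>u $ f\<bar>" by blast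
  have fmax: "\<bar>u $ i\<bar> \<le> \<bar>u $ f\<bar>" for i
    unfolding f[symmetric] by (intro Max_ge) auto
  have uf: "u $ f \<noteq> 0"
  proof
    assume "u $ f = 0"
    hence "u $ i = 0" for i using fmax[of i] by simp
    thus False using False by (simp add: vec_eq_iff)
  qed
  define w where "w = (1/u $ f) *\<^sub>R u"
  have uw: "u = (u $ f) *\<^sub>R w" using uf by (simp add: w_def)
  have "\<bar>\<Sum>g\<in>G. \<tau> g * D w g\<bar> \<le> step_error M"
  proof (rule patch_bound[OF \<tau>1 \<tau>])
    show "w $ f = 1" using uf by (simp add: w_def)
    show "\<bar>w $ i\<bar> \<le> 1" for i using fmax[of i] uf by (simp add: w_def abs_divide)
  qed
  hence "\<bar>u $ f\<bar> * \<bar>\<Sum>g\<in>G. \<tau> g * D w g\<bar> \<le> norm u * (step_error M)"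
    by (intro mult_mono component_le_norm_cart) auto
  moreover have "(\<Sum>g\<in>G. \<tau> g * D u g) = \<bar>u $ f\<bar> * (\<Sum>g\<in>G. \<tau> g * D w g)"
    by (subst uw, subst D_scale) (simp add: sum_distrib_left mult.left_commute)
  ultimately show ?thesis by (simp add: abs_mult mult.commute)
qed (simp add: D_def)


lemma exists_reduced_weights:
  "\<exists>t :: 'i \<Rightarrow> real. reduces I \<kappa> M x t \<and> 200 * card {i\<in>I. t i \<noteq> 0} + 10 * card G \<le> 200 * card I"
proof -
  from exists_colouring obtain \<tau>0 :: "'i set \<Rightarrow> real" where \<tau>0: "\<forall>g. \<tau>0 g \<in> {-1, 0, 1}"
    "real (card {g\<in>G. \<tau>0 g \<noteq> 0}) > real (card G)/10"
    "\<forall>k\<le>p. \<forall>(f, s, t)\<in>net k. \<bar>\<Sum>g\<in>G. \<tau>0 g * incr (k, f, s, t) g\<bar> \<le> 16 * 2^k * dev k"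
    by (elim exE conjE)
  \<comment> \<open>Only sign +1 deletes an atom. A global flip makes at least half of the decided
    groups positive without affecting the bounds on absolute values, so at least card G/20 atoms
    disappear.\<close>
  define \<theta> :: real where "\<theta> = (if card {g\<in>G. \<tau>0 g = 1} \<ge> card {g\<in>G. \<tau>0 g = - 1} then 1 else - 1)"
  define \<tau> where "\<tau> g = \<theta> * \<tau>0 g" for g
  have \<theta>: "\<theta> = 1 \<or> \<theta> = - 1" by (simp add: \<theta>_def)
  have \<tau>1: "\<bar>\<tau> g\<bar> \<le> 1" for g
    using \<tau>0(1)[rule_format, of g] \<theta> by (auto simp: \<tau>_def)
  have \<tau>: "\<bar>\<Sum>g\<in>G. \<tau> g * incr (k, f, s, t) g\<bar> \<le> 16 * 2^k * dev k" if "k \<le> p" "(f, s, t) \<in> net k" for k f s t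
  proof -
    have "(\<Sum>g\<in>G. \<tau> g * incr (k, f, s, t) g) = \<theta> * (\<Sum>g\<in>G. \<tau>0 g * incr (k, f, s, t) g)"
      by (simp add: \<tau>_def sum_distrib_left mult.assoc)
    moreover have "\<bar>\<Sum>g\<in>G. \<tau>0 g * incr (k, f, s, t) g\<bar> \<le> 16 * 2^k * dev k"
      using \<tau>0(3) that by blast
    ultimately show ?thesis using \<theta> by (auto simp: abs_mult)
  qed
  define P where "P = {g\<in>G. \<tau> g = 1}"
  have finP: "finite P" using finG by (simp add: P_def)
  have cardP: "20 * card P \<ge> card G"
  proof -
    have "{g\<in>G. \<tau>0 g \<noteq> 0} = {g\<in>G. \<tau>0 g = 1} \<union> {g\<in>G. \<tau>0 g = - 1}"
    proof (intro equalityI subsetI)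
      fix g assume "g \<in> {g\<in>G. \<tau>0 g \<noteq> 0}"
      thus "g \<in> {g\<in>G. \<tau>0 g = 1} \<union> {g\<in>G. \<tau>0 g = - 1}"
        using \<tau>0(1)[rule_format, of g] by auto
    qed auto
    hence "card {g\<in>G. \<tau>0 g \<noteq> 0} \<le> card {g\<in>G. \<tau>0 g = 1} + card {g\<in>G. \<tau>0 g = - 1}"
      by (simp only: card_Un_le)
    moreover have "card {g\<in>G. \<tau>0 g = 1} \<le> card P" "card {g\<in>G. \<tau>0 g = - 1} \<le> card P"
    proof -
      have e: "P = (if \<theta> = 1 then {g\<in>G. \<tau>0 g = 1} else {g\<in>G. \<tau>0 g = - 1})"
        using \<theta> by (auto simp: P_def \<tau>_def minus_equation_iff)
      show "card {g\<in>G. \<tau>0 g = 1} \<le> card P" "card {g\<in>G. \<tau>0 g = - 1} \<le> card P"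
        unfolding e by (auto simp: \<theta>_def)
    qed
    ultimately show ?thesis using \<tau>0(2) by linarith
  qed
  \<comment> \<open>Groups are disjoint, so the sum has at most one term; writing it as a sum allows
    the exchange of summations in \<open>key\<close>.\<close>
  define t where "t i = 1 + (\<Sum>g\<in>{g\<in>G. i \<in> g}. \<tau> g * \<eta> g i)" for i
  have t_in: "t i = 1 + \<tau> g * \<eta> g i" if "g \<in> G" "i \<in> g" for g i
  proof -
    have "{h\<in>G. i \<in> h} = {g}" using disj that by (auto simp: disjoint_def)
    thus ?thesis by (simp add: t_def)
  qed
  have t_out: "t i = 1" if "\<And>g. g \<in> G \<Longrightarrow> i \<notin> g" for i
  proof -
    have "{h\<in>G. i \<in> h} = {}" using that by blast
    thus ?thesis by (simp only: t_def) simp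
  qed
  have t0: "0 \<le> t i" for i
  proof (cases "\<exists>g\<in>G. i \<in> g")
    case True
    then obtain g where g: "g \<in> G" "i \<in> g" by blast
    have "\<bar>\<tau> g * \<eta> g i\<bar> \<le> 1 * 1"
      unfolding abs_mult using \<tau>1 \<eta>1[OF g] by (intro mult_mono) auto
    thus ?thesis using t_in[OF g] by linarith
  next
    case False
    thus ?thesis using t_out[of i] by auto
  qed
  \<comment> \<open>Used twice: with cell-weighted lengths, where every group term vanishes, and
    with |u . x i|, where the group terms are \<open>D u g\<close>.\<close>
  have key: "(\<Sum>i\<in>I. t i * \<phi> i) = (\<Sum>i\<in>I. \<phi> i) + (\<Sum>g\<in>G. \<tau> g * (\<Sum>i\<in>g. \<eta> g i * \<phi> i))" for \<phi>
  proof -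
    have "(\<Sum>i\<in>I. t i * \<phi> i) = (\<Sum>i\<in>I. \<phi> i) + (\<Sum>i\<in>I. \<Sum>g\<in>{g\<in>G. i \<in> g}. \<tau> g * \<eta> g i * \<phi> i)"
      by (simp add: t_def distrib_right sum.distrib sum_distrib_right)
    also have "(\<Sum>i\<in>I. \<Sum>g\<in>{g\<in>G. i \<in> g}. \<tau> g * \<eta> g i * \<phi> i) = (\<Sum>g\<in>G. \<Sum>i\<in>{i\<in>I. i \<in> g}. \<tau> g * \<eta> g i * \<phi> i)"
      by (rule sum.swap_restrict[OF finI finG])
    also have "\<dots> = (\<Sum>g\<in>G. \<tau> g * (\<Sum>i\<in>g. \<eta> g i * \<phi> i))"
    proof (rule sum.cong[OF refl])
      fix g assume "g \<in> G"
      hence "{i\<in>I. i \<in> g} = g" using GI by blast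
      thus "(\<Sum>i\<in>{i\<in>I. i \<in> g}. \<tau> g * \<eta> g i * \<phi> i) = \<tau> g * (\<Sum>i\<in>g. \<eta> g i * \<phi> i)"
        by (simp add: sum_distrib_left mult.assoc)
    qed
    finally show ?thesis .
  qed
  have "\<forall>g\<in>P. \<exists>i. i \<in> g \<and> \<eta> g i = - 1" using \<eta>_kill by (auto simp: P_def)
  then obtain kill where kill: "\<And>g. g \<in> P \<Longrightarrow> kill g \<in> g \<and> \<eta> g (kill g) = - 1"
    by metis
  have PG: "P \<subseteq> G" by (auto simp: P_def)
  have injk: "inj_on kill P"
  proof (rule inj_onI)
    fix g h assume "g \<in> P" "h \<in> P" "kill g = kill h"
    moreover from this have "kill g \<in> g \<inter> h" using kill[of g] kill[of h] by auto
    ultimately show "g = h" using disj PG unfolding disjoint_def by blast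
  qed
  have tk: "t (kill g) = 0" if "g \<in> P" for g
    using t_in[of g "kill g"] kill[OF that] that by (auto simp: P_def)
  have "{i\<in>I. t i \<noteq> 0} \<subseteq> I - kill ` P" using tk by auto
  hence "card {i\<in>I. t i \<noteq> 0} \<le> card (I - kill ` P)" using finI by (intro card_mono) auto
  also have "\<dots> = card I - card P"
    using finP kill PG GI injk by (subst card_Diff_subset) (auto simp: card_image)
  finally have "card {i\<in>I. t i \<noteq> 0} \<le> card I - card P" .
  moreover have "card P \<le> card I"
  proof -
    have "kill ` P \<subseteq> I" using kill PG GI by blast
    hence "card (kill ` P) \<le> card I" using finI by (intro card_mono)
    thus ?thesis using injk by (simp add: card_image)
  qed
  ultimately have "200 * card {i\<in>I. t i \<noteq> 0} + 10 * card G \<le> 200 * card I" using cardP by linarith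
  moreover have "(\<Sum>i\<in>I. t i * (w (\<kappa> i) * norm (x i))) = (\<Sum>i\<in>I. w (\<kappa> i) * norm (x i))" for w
  proof -
    have "(\<Sum>i\<in>g. \<eta> g i * (w (\<kappa> i) * norm (x i))) = 0" if g: "g \<in> G" for g
    proof -
      have "(\<Sum>i\<in>g. \<eta> g i * (w (\<kappa> i) * norm (x i))) = (\<Sum>i\<in>g. w (cellof g) * (\<eta> g i * norm (x i)))"
        using cellof[OF g] by (intro sum.cong) auto
      also have "\<dots> = w (cellof g) * (\<Sum>i\<in>g. \<eta> g i * norm (x i))" by (simp only: sum_distrib_left)
      finally show ?thesis by (simp add: \<eta>_norm[OF g])
    qed
    thus ?thesis unfolding key by simp
  qed
  moreover have "\<bar>(\<Sum>i\<in>I. t i * \<bar>u \<bullet> x i\<bar>) - support_sum I x u\<bar> \<le> step_error M * norm u" for u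
    using global_bound[OF \<tau>1 \<tau>, of u] unfolding key support_sum_def D_def by simp
  ultimately show ?thesis using t0 unfolding reduces_def by (intro exI[of _ t]) auto
qed

end

text \<open>216 = 2 * 4 * 27: at most 27 M^2 cells are occupied, so at most 108 M^2 <= card I/2
  atoms stay ungrouped and 10 card G >= card I. A loss of card G/20 atoms is then a loss of card
  I/200.\<close>

lemma reduction_step:
  fixes I :: "'i set" and x :: "'i \<Rightarrow> real^3"
  assumes finI: "finite I" and M: "M = 2^p"
    and cone: "\<And>i. i \<in> I \<Longrightarrow> \<kappa> i \<in> cells M \<and> in_cone M (\<kappa> i) (x i)"
    and cell_mass: "\<And>c. (\<Sum>i\<in>{i\<in>I. \<kappa> i = c}. norm (x i)) \<le> 1/(real M)\<^sup>2"
    and total_mass: "(\<Sum>i\<in>I. norm (x i)) \<le> 1"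
    and large: "216 * M\<^sup>2 \<le> card I"
  shows "\<exists>t. reduces I \<kappa> M x t \<and> 200 * card {i\<in>I. t i \<noteq> 0} \<le> 199 * card I"
proof -
  from exists_groups_of_five[OF finI, of \<kappa>] obtain G where
    G: "finite G" "disjoint G" "\<forall>g\<in>G. g \<subseteq> I \<and> card g = 5 \<and> (\<exists>c. \<forall>i\<in>g. \<kappa> i = c)"
      "card I \<le> 5 * card G + 4 * card (\<kappa> ` I)" by (elim exE conjE)
  have M1: "M \<ge> 1" by (simp add: M)
  have "card (\<kappa> ` I) \<le> card (cells M)" using cone by (intro card_mono) auto
  also have "\<dots> \<le> 27 * M\<^sup>2" by (rule card_cells[OF M1])
  finally have cardI: "card I \<le> 10 * card G" using G(4) large by linarith
  have "\<forall>g\<in>G. \<exists>\<eta>. (\<forall>i\<in>g. \<bar>\<eta> i\<bar> \<le> 1) \<and> (\<exists>i\<in>g. \<eta> i = - 1) \<and>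
     (\<Sum>i\<in>g. \<eta> i *\<^sub>R x i) = 0 \<and> (\<Sum>i\<in>g. \<eta> i * norm (x i)) = (0::real)"
    using G(3) by (intro ballI exists_mass_preserving_direction) auto
  from bchoice[OF this] obtain \<eta> where \<eta>: "\<forall>g\<in>G. (\<forall>i\<in>g. \<bar>\<eta> g i\<bar> \<le> 1) \<and> (\<exists>i\<in>g. \<eta> g i = - 1) \<and>
     (\<Sum>i\<in>g. \<eta> g i *\<^sub>R x i) = 0 \<and> (\<Sum>i\<in>g. \<eta> g i * norm (x i)) = (0::real)" ..
  have "\<forall>g\<in>G. \<exists>c. \<forall>i\<in>g. \<kappa> i = c" using G(3) by blast
  from bchoice[OF this] obtain cellof where cellof: "\<forall>g\<in>G. \<forall>i\<in>g. \<kappa> i = cellof g" ..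
  have lg: "216 * (real M)\<^sup>2 \<le> 10 * real (card G)"
  proof -
    have "216 * M\<^sup>2 \<le> 10 * card G" using large cardI by linarith
    hence "real (216 * M\<^sup>2) \<le> real (10 * card G)" by (simp only: of_nat_le_iff)
    thus ?thesis by simp
  qed
  interpret rounding_step I x \<kappa> M p G \<eta> cellof
  proof
    fix g assume g: "g \<in> G"
    show "g \<subseteq> I" using G(3) g by blast
    show "\<kappa> i = cellof g" if "i \<in> g" for i using cellof g that by blast
    note \<eta>g = \<eta>[rule_format, OF g]
    show "\<bar>\<eta> g i\<bar> \<le> 1" if "i \<in> g" for i using \<eta>g that by blast
    show "\<exists>i\<in>g. \<eta> g i = - 1" using \<eta>g by blast
    show "(\<Sum>i\<in>g. \<eta> g i *\<^sub>R x i) = 0" using \<eta>g by blast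
    show "(\<Sum>i\<in>g. \<eta> g i * norm (x i)) = 0" using \<eta>g by blast
  qed (fact finI M cone cell_mass total_mass G(1,2) lg)+
  from exists_reduced_weights obtain t :: "'i \<Rightarrow> real" where
    "reduces I \<kappa> M x t" "200 * card {i\<in>I. t i \<noteq> 0} + 10 * card G \<le> 200 * card I" by blast
  thus ?thesis using cardI by (intro exI[of _ t]) linarith
qed

section \<open>Iterating the reduction\<close>

definition coarse :: "nat \<Rightarrow> cell \<Rightarrow> cell" where
  "coarse k c = (case c of (f, a, b) \<Rightarrow> (f, a div 2^k, b div 2^k))"

lemma coarse_coarse: "coarse j (coarse k c) = coarse (k + j) c"
  by (cases c) (simp add: coarse_def zdiv_zmult2_eq power_add)

lemma coarse_in_cells:
  assumes "c \<in> cells (2^(p + k))"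
  shows "coarse k c \<in> cells (2^p)"
proof -
  have *: "a div 2^k \<in> {- (2^p)..2^p}" if "a \<in> {- (2^(p + k))..2^(p + k)}" for a :: int
  proof -
    have "a div 2^k \<le> (2^p * 2^k) div 2^k"
      using that by (intro zdiv_mono1) (auto simp: power_add)
    moreover have "(- (2^p) * 2^k) div 2^k \<le> a div 2^k"
      using that by (intro zdiv_mono1) (auto simp: power_add)
    moreover have "(- (2^p) * 2^k) div 2^k = - (2^p :: int)"
      by (rule nonzero_mult_div_cancel_right) simp
    ultimately show ?thesis by simp
  qed
  obtain f a b where c: "c = (f, a, b)" by (cases c) auto
  have "a \<in> {- (2^(p + k))..2^(p + k)}" "b \<in> {- (2^(p + k))..2^(p + k)}"
    using assms by (simp_all add: c cells_def)
  from *[OF this(1)] *[OF this(2)] show ?thesis by (simp add: c cells_def coarse_def)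
qed

lemma coarse_bounds:
  fixes z y :: real and a :: int
  assumes z: "0 \<le> z" and lo: "of_int a * z \<le> 2^(p + k) * y" and hi: "2^(p + k) * y \<le> (of_int a + 1) * z"
  shows "of_int (a div 2^k) * z \<le> 2^p * y" "2^p * y \<le> (of_int (a div 2^k) + 1) * z"
proof -
  define d where "d = a div 2^k"
  have ad: "a = 2^k * d + a mod 2^k" by (simp add: d_def)
  have m: "0 \<le> a mod 2^k" "a mod 2^k < 2^k" by simp_all
  have i1: "2^k * d \<le> a" "a + 1 \<le> 2^k * (d + 1)"
    using ad m unfolding distrib_left mult_1_right by linarith+
  have "real_of_int (2^k * d) \<le> of_int a" "real_of_int (a + 1) \<le> of_int (2^k * (d + 1))"
    using i1 by (simp_all only: of_int_le_iff)
  hence r: "2^k * of_int d \<le> real_of_int a" "real_of_int a + 1 \<le> 2^k * (of_int d + 1)"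
    by simp_all
  have "2^k * (of_int d * z) \<le> 2^k * (2^p * y)"
  proof -
    have "2^k * (of_int d * z) = (2^k * of_int d) * z" by simp
    also have "\<dots> \<le> of_int a * z" using r(1) z by (rule mult_right_mono)
    also have "\<dots> \<le> 2^(p + k) * y" by (rule lo)
    also have "\<dots> = 2^k * (2^p * y)" by (simp add: power_add)
    finally show ?thesis .
  qed
  thus "of_int (a div 2^k) * z \<le> 2^p * y" by (simp add: d_def)
  have "2^k * (2^p * y) \<le> 2^k * ((of_int d + 1) * z)"
  proof -
    have "2^k * (2^p * y) = 2^(p + k) * y" by (simp add: power_add)
    also have "\<dots> \<le> (of_int a + 1) * z" by (rule hi)
    also have "\<dots> \<le> (2^k * (of_int d + 1)) * z" using r(2) z by (rule mult_right_mono)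
    finally show ?thesis by (simp add: mult.assoc)
  qed
  thus "2^p * y \<le> (of_int (a div 2^k) + 1) * z" by (simp add: d_def)
qed

lemma coarse_in_cone:
  assumes "in_cone (2^(p + k)) c x"
  shows "in_cone (2^p) (coarse k c) x"
proof -
  obtain f a b where c: "c = (f, a, b)" by (cases c) auto
  note h = assms[unfolded in_cone_def c prod.case of_nat_power of_nat_numeral]
  have z: "0 \<le> x $ f" using h by blast
  have 1: "of_int a * x $ f \<le> 2^(p + k) * x $ (f + 1)" "2^(p + k) * x $ (f + 1) \<le> (of_int a + 1) * x $ f"
    "of_int b * x $ f \<le> 2^(p + k) * x $ (f + 2)" "2^(p + k) * x $ (f + 2) \<le> (of_int b + 1) * x $ f"
    using h by blast+
  show ?thesis
    unfolding in_cone_def c coarse_def prod.case of_nat_power of_nat_numeral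
    using coarse_bounds[OF z 1(1,2)] coarse_bounds[OF z 1(3,4)] z by blast
qed

lemma in_cone_scale: "0 \<le> t \<Longrightarrow> in_cone M c x \<Longrightarrow> in_cone M c (t *\<^sub>R x)"
  unfolding in_cone_def
  by (auto simp: mult.left_commute[of _ t] intro!: mult_left_mono split: prod.splits)

text \<open>Only the levels coarse enough to be used by a later step are controlled.\<close>
definition spread :: "nat \<Rightarrow> cell set \<Rightarrow> (cell \<Rightarrow> real^3) \<Rightarrow> bool" where
  "spread P I x \<longleftrightarrow> I \<subseteq> cells (2^P) \<and> (\<forall>i\<in>I. in_cone (2^P) i (x i)) \<and>
     (\<Sum>i\<in>I. norm (x i)) \<le> 1 \<and>
     (\<forall>p k c. P = p + k \<longrightarrow> 216 * (2^p)\<^sup>2 \<le> card I \<longrightarrow>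
        (\<Sum>i\<in>{i\<in>I. coarse k i = c}. norm (x i)) \<le> 1/(2^p)\<^sup>2)"

text \<open>864 = 4 * 216: the finest admissible level satisfies card I < 864 M^2, which turns
  M^(-5/2) into (card I/864)^(-5/4).\<close>

definition step_const :: real where
  "step_const = 2306 * 864 powr (5/4)"

lemma step_const_pos: "step_const > 0"
  by (simp add: step_const_def)

text \<open>The reduction is run at the finest dyadic level \<open>p\<close> with 216 M^2 <= card I,
  so that \<open>M\<close> is comparable to the square root of card I.\<close>

lemma spread_step:
  assumes sp: "spread P I x" and N: "216 \<le> card I"
  obtains J y where "spread P J y" "200 * card J \<le> 199 * card I"
    "\<And>u. \<bar>support_sum J y u - support_sum I x u\<bar> \<le> step_const * card I powr (-5/4) * norm u"
proof -
  have finI: "finite I" using N by (metis card.infinite not_numeral_le_zero)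
  have IP: "I \<subseteq> cells (2^P)" using sp by (simp add: spread_def)
  define Q where "Q p \<longleftrightarrow> 216 * (2^p :: nat)\<^sup>2 \<le> card I" for p
  have "Q 0" using N by (simp add: Q_def)
  have cardI: "card I \<le> 27 * (2^P)\<^sup>2"
    using card_mono[OF _ IP] card_cells[of "2^P"] by (simp add: order_trans)
  \<comment> \<open>At most 27 * 4^P atoms exist, fewer than 216 * 4^P, so an admissible level is
    strictly coarser than the initial one.\<close>
  have Qlt: "p < P" if "Q p" for p
  proof (rule ccontr)
    assume "\<not> p < P"
    hence "((2::nat)^P)\<^sup>2 \<le> (2^p)\<^sup>2" by (intro power_mono power_increasing) auto
    moreover have "0 < ((2::nat)^P)\<^sup>2" by simp
    ultimately show False using that cardI unfolding Q_def by linarith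
  qed
  have "\<exists>p. Q p \<and> (\<forall>q. Q q \<longrightarrow> q \<le> p)"
    using Qlt \<open>Q 0\<close> by (intro Nat.ex_has_greatest_nat[of Q 0 P]) (auto intro: less_imp_le)
  then obtain p where p: "Q p" "\<And>q. Q q \<Longrightarrow> q \<le> p" by blast
  define k where "k = P - p"
  have Pk: "P = p + k" using Qlt[OF p(1)] by (simp add: k_def)
  define M :: nat where "M = 2^p"
  have M1: "M \<ge> 1" by (simp add: M_def)
  have big: "card I < 864 * M\<^sup>2"
  proof -
    have "\<not> Q (Suc p)" using p(2)[of "Suc p"] by auto
    thus ?thesis by (simp add: Q_def M_def power_mult_distrib)
  qed
  have cone: "coarse k i \<in> cells M \<and> in_cone M (coarse k i) (x i)" if "i \<in> I" for i
    using sp that coarse_in_cells[of i p k] coarse_in_cone[of p k i "x i"]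
    unfolding spread_def Pk M_def by blast
  have mass: "(\<Sum>i\<in>{i\<in>I. coarse k i = c}. norm (x i)) \<le> 1/(real M)\<^sup>2" for c
  proof -
    have "\<forall>p k c. P = p + k \<longrightarrow> 216 * (2^p)\<^sup>2 \<le> card I \<longrightarrow>
        (\<Sum>i\<in>{i\<in>I. coarse k i = c}. norm (x i)) \<le> 1/(2^p)\<^sup>2"
      using sp unfolding spread_def by blast
    from this[rule_format, OF Pk] p(1) show ?thesis unfolding Q_def M_def by simp
  qed
  have tot: "(\<Sum>i\<in>I. norm (x i)) \<le> 1" using sp by (simp add: spread_def)
  have lg: "216 * M\<^sup>2 \<le> card I" using p(1) by (simp add: Q_def M_def)
  obtain t where red: "reduces I (coarse k) M x t" and card_t: "200 * card {i\<in>I. t i \<noteq> 0} \<le> 199 * card I"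
    using reduction_step[OF finI M_def cone mass tot lg] by blast
  note t = red[unfolded reduces_def, THEN conjunct1, rule_format] card_t
    red[unfolded reduces_def, THEN conjunct2, THEN conjunct1, rule_format]
    red[unfolded reduces_def, THEN conjunct2, THEN conjunct2, rule_format]
  define J where "J = {i\<in>I. t i \<noteq> 0}"
  define y where "y i = t i *\<^sub>R x i" for i
  have JI: "J \<subseteq> I" by (auto simp: J_def)
  have tJ: "(\<Sum>i\<in>J. t i * \<phi> i) = (\<Sum>i\<in>I. t i * \<phi> i)" for \<phi>
    using finI by (intro sum.mono_neutral_left) (auto simp: J_def)
  have ny: "norm (y i) = t i * norm (x i)" if "i \<in> J" for i
    using t(1) that by (simp add: y_def J_def)
  have "support_sum J y u = (\<Sum>i\<in>J. t i * \<bar>u \<bullet> x i\<bar>)" for u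
    unfolding support_sum_def using t(1) by (intro sum.cong) (auto simp: y_def J_def abs_mult)
  hence supp: "support_sum J y u = (\<Sum>i\<in>I. t i * \<bar>u \<bullet> x i\<bar>)" for u
    by (simp add: tJ)
  have weighted: "(\<Sum>i\<in>J. w (coarse k i) * norm (y i)) = (\<Sum>i\<in>I. w (coarse k i) * norm (x i))" for w
  proof -
    have "(\<Sum>i\<in>J. w (coarse k i) * norm (y i)) = (\<Sum>i\<in>J. t i * (w (coarse k i) * norm (x i)))"
      by (intro sum.cong) (auto simp: ny)
    thus ?thesis by (simp add: tJ t(3))
  qed
  show ?thesis
  proof (rule that[of J y])
    show "200 * card J \<le> 199 * card I" using t(2) by (simp add: J_def)
    show "spread P J y"
      unfolding spread_def
    proof (intro conjI allI impI ballI)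
      show "J \<subseteq> cells (2^P)" using JI IP by blast
      show "in_cone (2^P) i (y i)" if "i \<in> J" for i
        using that sp t(1)[of i] by (auto simp: y_def J_def spread_def intro!: in_cone_scale)
      show "(\<Sum>i\<in>J. norm (y i)) \<le> 1" using weighted[of "\<lambda>_. 1"] tot by simp
      fix q l c assume ql: "P = q + l" "216 * (2^q)\<^sup>2 \<le> card J"
      have "card J \<le> card I" using finI JI by (rule card_mono)
      hence Qq: "Q q" using ql(2) by (simp add: Q_def)
      \<comment> \<open>As card J <= card I, a level \<open>q\<close> still to be controlled is at
        most \<open>p\<close>. Its cells are unions of cells of level \<open>p\<close>, whose masses
        the step has preserved.\<close>
      have lk: "l = k + (l - k)" using p(2)[OF Qq] Pk ql(1) by simp
      define w where "w c' = (if coarse (l - k) c' = c then 1 else 0 :: real)" for c'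
      have wc: "w (coarse k i) = (if coarse l i = c then 1 else 0)" for i
        unfolding w_def coarse_coarse lk[symmetric] ..
      have "(\<Sum>i\<in>{i\<in>J. coarse l i = c}. norm (y i)) = (\<Sum>i\<in>J. w (coarse k i) * norm (y i))"
        unfolding wc using finite_subset[OF JI finI] by (subst sum.inter_filter) (auto intro!: sum.cong)
      also have "\<dots> = (\<Sum>i\<in>I. w (coarse k i) * norm (x i))" by (rule weighted)
      also have "\<dots> = (\<Sum>i\<in>{i\<in>I. coarse l i = c}. norm (x i))"
        unfolding wc using finI by (subst sum.inter_filter) (auto intro!: sum.cong)
      also have "\<dots> \<le> 1/(2^q)\<^sup>2" using sp ql(1) Qq unfolding spread_def Q_def by blast
      finally show "(\<Sum>i\<in>{i\<in>J. coarse l i = c}. norm (y i)) \<le> 1/(2^q)\<^sup>2" .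
    qed
    fix u :: "real^3"
    have "step_error M \<le> step_const * card I powr (-5/4)"
    proof -
      have Npos: "real (card I) > 0" using N by simp
      have "real (card I)/864 \<le> (real M)\<^sup>2"
      proof -
        have "real (card I) \<le> real (864 * M\<^sup>2)" using big by (simp only: of_nat_le_iff)
        thus ?thesis by simp
      qed
      hence "(real (card I)/864) powr (5/4) \<le> ((real M)\<^sup>2) powr (5/4)"
        by (intro powr_mono2) auto
      also have "((real M)\<^sup>2) powr (5/4) = (real M) powr (2 + 1/2)"
        using M1 by (simp add: powr_powr flip: powr_numeral)
      also have "\<dots> = (real M)\<^sup>2 * sqrt (real M)"
        using M1 by (simp only: powr_add powr_half_sqrt of_nat_0_le_iff) simp
      finally have "2306/((real M)\<^sup>2 * sqrt (real M)) \<le> 2306/(real (card I)/864) powr (5/4)"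
        using Npos M1 by (intro divide_left_mono mult_pos_pos) auto
      also have "\<dots> = step_const * card I powr (-5/4)"
        using Npos by (simp add: step_const_def powr_divide powr_minus field_simps)
      finally show ?thesis unfolding step_error_def .
    qed
    hence "step_error M * norm u \<le> step_const * card I powr (-5/4) * norm u"
      by (rule mult_right_mono) simp
    thus "\<bar>support_sum J y u - support_sum I x u\<bar> \<le> step_const * card I powr (-5/4) * norm u"
      using t(4)[of u] unfolding supp by linarith
  qed
qed

text \<open>A potential for the induction on N = card I. A step costs step_const N^(-5/4) and brings
  N down to at most 199/200 of its value, so N^(-5/4) grows by at least 1/200 of itself, which pays
  for the step. The factor 2 keeps at least 200 step_const n^(-5/4) in reserve while N >= n, enough
  for the last step, which reaches \<open>n\<close> or less.\<close>

definition budget :: "nat \<Rightarrow> nat \<Rightarrow> real" where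
  "budget n N = 200 * step_const * (2 * n powr (-5/4) - N powr (-5/4))"

lemma spread_reduce_aux:
  fixes n :: nat
  assumes "spread P I x" and "card I > n" and n: "n \<ge> 216"
  shows "\<exists>J y. spread P J y \<and> card J \<le> n \<and>
    (\<forall>u. \<bar>support_sum J y u - support_sum I x u\<bar> \<le> budget n (card I) * norm u)"
  using assms(1,2)
proof (induction "card I" arbitrary: I x rule: less_induct)
  case less
  define N where "N = card I"
  have N: "N > n" "N > 216" using less.prems n by (simp_all add: N_def)
  obtain J y where J: "spread P J y" "200 * card J \<le> 199 * card I"
    "\<And>u. \<bar>support_sum J y u - support_sum I x u\<bar> \<le> step_const * card I powr (-5/4) * norm u"
    using spread_step[OF less.prems(1)] N(2) unfolding N_def by (metis less_imp_le)
  have mono: "real N powr (-5/4) \<le> real n powr (-5/4)"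
    using N n by (intro powr_mono2') auto
  note sc = step_const_pos
  show ?case
  proof (cases "card J \<le> n")
    case True
    have "step_const * N powr (-5/4) \<le> budget n N"
    proof -
      have "step_const * N powr (-5/4) \<le> step_const * (200 * (2 * n powr (-5/4) - N powr (-5/4)))"
      proof (rule mult_left_mono)
        have "N powr (-5/4) \<le> 200 * N powr (-5/4)" by simp
        also have "\<dots> \<le> 200 * (2 * n powr (-5/4) - N powr (-5/4))"
          using mono by (intro mult_left_mono) simp_all
        finally show "N powr (-5/4) \<le> 200 * (2 * n powr (-5/4) - N powr (-5/4))" .
      qed (use sc in simp)
      also have "step_const * (200 * X) = 200 * step_const * X" for X by simp
      finally show ?thesis unfolding budget_def .
    qed
    hence "step_const * N powr (-5/4) * norm u \<le> budget n N * norm u" for u :: "real^3"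
      by (rule mult_right_mono) simp
    hence "\<bar>support_sum J y u - support_sum I x u\<bar> \<le> budget n (card I) * norm u" for u
      using J(3)[of u] unfolding N_def by (rule order_trans[rotated])
    thus ?thesis using J(1) True by blast
  next
    case False
    define N1 where "N1 = card J"
    have N1: "N1 > n" "N1 < N" "200 * N1 \<le> 199 * N" using False J(2) N by (auto simp: N1_def N_def)
    have "\<exists>K z. spread P K z \<and> card K \<le> n \<and>
      (\<forall>u. \<bar>support_sum K z u - support_sum J y u\<bar> \<le> budget n (card J) * norm u)"
      using N1 by (intro less.hyps[OF _ J(1)]) (simp_all add: N1_def N_def)
    then obtain K z where K: "spread P K z" "card K \<le> n"
      "\<forall>u. \<bar>support_sum K z u - support_sum J y u\<bar> \<le> budget n (card J) * norm u"
      by (elim exE conjE)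
    \<comment> \<open>The exponent is weakened to -1: (199/200)^(-5/4) >= 200/199 >=
      201/200.\<close>
    have gain: "201/200 * real N powr (-5/4) \<le> real N1 powr (-5/4)"
    proof -
      have pos: "real N > 0" "real N1 > 0" using N N1 by auto
      have "real N1 \<le> 199/200 * real N" using N1(3) by linarith
      hence "(199/200 * real N) powr (-5/4) \<le> real N1 powr (-5/4)"
        using pos by (intro powr_mono2') auto
      moreover have "(199/200 * real N) powr (-5/4) = (199/200) powr (-5/4) * real N powr (-5/4)"
        by (rule powr_mult)
      moreover have "201/200 \<le> (199/200 :: real) powr (-5/4)"
      proof -
        have "(199/200 :: real) powr (-1) \<le> (199/200) powr (-5/4)"
          by (rule powr_mono') auto
        thus ?thesis by (simp add: powr_minus)
      qed
      ultimately show ?thesis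
        using mult_right_mono[of "201/200" "(199/200 :: real) powr (-5/4)" "real N powr (-5/4)"] by simp
    qed
    have comb: "step_const * N powr (-5/4) + budget n N1 \<le>
        budget n N"
    proof -
      have "step_const * (N powr (-5/4) + 200 * (2 * n powr (-5/4) - N1 powr (-5/4))) \<le>
          step_const * (200 * (2 * n powr (-5/4) - N powr (-5/4)))"
      proof (rule mult_left_mono)
        have "201/200 * a \<le> b \<Longrightarrow> a + 200 * (2 * c - b) \<le> 200 * (2 * c - a)" for a b c :: real
          unfolding right_diff_distrib by linarith
        from this[OF gain] show "N powr (-5/4) + 200 * (2 * n powr (-5/4) - N1 powr (-5/4)) \<le>
            200 * (2 * n powr (-5/4) - N powr (-5/4))" .
      qed (use sc in simp)
      moreover have "step_const * (200 * X) = 200 * step_const * X" for X by simp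
      ultimately show ?thesis by (simp only: budget_def distrib_left)
    qed
    have "\<bar>support_sum K z u - support_sum I x u\<bar> \<le> budget n (card I) * norm u" for u
    proof -
      have "\<bar>support_sum K z u - support_sum I x u\<bar> \<le>
          (step_const * N powr (-5/4) + budget n N1) * norm u"
        using J(3)[of u] spec[OF K(3), of u] unfolding distrib_right N_def N1_def by linarith
      also have "\<dots> \<le> budget n N * norm u"
        by (intro mult_right_mono comb) simp
      finally show ?thesis unfolding N_def .
    qed
    thus ?thesis using K(1,2) by blast
  qed
qed

lemma spread_reduce:
  fixes n :: nat
  assumes sp: "spread P I x" and n: "n \<ge> 216"
  obtains J :: "cell set" and y where "finite J" "card J \<le> n" "(\<Sum>i\<in>J. norm (y i)) \<le> 1"
    "\<And>u. \<bar>support_sum J y u - support_sum I x u\<bar> \<le> 400 * step_const * n powr (-5/4) * norm u"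
proof (cases "card I > n")
  case False
  thus ?thesis using sp step_const_pos
    by (intro that[of I x]) (auto simp: spread_def intro: finite_subset[OF _ finite_cells])
next
  case True
  obtain J y where J: "spread P J y" "card J \<le> n"
    "\<forall>u. \<bar>support_sum J y u - support_sum I x u\<bar> \<le> budget n (card I) * norm u"
    using spread_reduce_aux[OF sp True n] by (elim exE conjE)
  have "budget n (card I) * norm u \<le> 400 * step_const * n powr (-5/4) * norm u" for u :: "real^3"
  proof (rule mult_right_mono)
    have "budget n (card I) \<le> 200 * step_const * (2 * n powr (-5/4))"
      unfolding budget_def using step_const_pos by (intro mult_left_mono) auto
    thus "budget n (card I) \<le> 400 * step_const * n powr (-5/4)" by simp
  qed simp
  hence "\<bar>support_sum J y u - support_sum I x u\<bar> \<le> 400 * step_const * n powr (-5/4) * norm u" for u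
    using spec[OF J(3), of u] by (rule order_trans[rotated])
  thus ?thesis using J(1,2) by (intro that[of J y]) (auto simp: spread_def intro: finite_subset[OF _ finite_cells])
qed

section \<open>The initial configuration\<close>

abbreviation unit_cball :: "(real^3) set" where
  "unit_cball \<equiv> cball 0 1"

lemma unit_cball_sets [measurable]: "unit_cball \<in> sets borel"
  by (intro borel_closed) simp

text \<open>pi (1 - y^2) is the area of the slice of the unit ball at height y.\<close>

lemma nn_integral_abs_profile:
  "(\<integral>\<^sup>+y. ennreal (pi * (\<bar>y\<bar> * (1 - y\<^sup>2))) * indicator {-1..1} y \<partial>lborel) = ennreal (pi/2)"
proof -
  have "(\<integral>\<^sup>+y. ennreal (pi * (\<bar>y\<bar> * (1 - y\<^sup>2))) * indicator {-1..1} y \<partial>lborel) =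
     (\<integral>\<^sup>+y. ennreal (- pi * (y * (1 - y\<^sup>2))) * indicator {-1..0} y + ennreal (pi * (y * (1 - y\<^sup>2))) * indicator {0..1} y \<partial>lborel)"
    by (intro nn_integral_cong) (auto simp: indicator_def)
  also have "\<dots> = (\<integral>\<^sup>+y. ennreal (- pi * (y * (1 - y\<^sup>2))) * indicator {-1..0} y \<partial>lborel) +
     (\<integral>\<^sup>+y. ennreal (pi * (y * (1 - y\<^sup>2))) * indicator {0..1} y \<partial>lborel)"
    by (intro nn_integral_add) auto
  also have "(\<integral>\<^sup>+y. ennreal (- pi * (y * (1 - y\<^sup>2))) * indicator {-1..0} y \<partial>lborel) =
      ennreal ((- pi * (0\<^sup>2/2 - 0^4/4)) - (- pi * ((-1)\<^sup>2/2 - (-1)^4/4)))"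
  proof (rule nn_integral_FTC_Icc[where F = "\<lambda>y. - pi * (y\<^sup>2/2 - y^4/4)"])
    fix y :: real assume "y \<in> {-1..0}"
    hence y: "-1 \<le> y" "y \<le> 0" by auto
    show "((\<lambda>y. - pi * (y\<^sup>2/2 - y^4/4)) has_real_derivative - pi * (y * (1 - y\<^sup>2))) (at y)"
      by (auto intro!: derivative_eq_intros simp: power2_eq_square power3_eq_cube algebra_simps)
    have "y\<^sup>2 \<le> 1" using y by (simp add: abs_square_le_1)
    thus "0 \<le> - pi * (y * (1 - y\<^sup>2))" using y
      by (simp add: mult_nonpos_nonneg mult_nonneg_nonpos)
  qed auto
  also have "(\<integral>\<^sup>+y. ennreal (pi * (y * (1 - y\<^sup>2))) * indicator {0..1} y \<partial>lborel) =
      ennreal ((pi * (1\<^sup>2/2 - 1^4/4)) - (pi * (0\<^sup>2/2 - 0^4/4)))"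
  proof (rule nn_integral_FTC_Icc[where F = "\<lambda>y. pi * (y\<^sup>2/2 - y^4/4)"])
    fix y :: real assume "y \<in> {0..1}"
    hence y: "0 \<le> y" "y \<le> 1" by auto
    show "((\<lambda>y. pi * (y\<^sup>2/2 - y^4/4)) has_real_derivative pi * (y * (1 - y\<^sup>2))) (at y)"
      by (auto intro!: derivative_eq_intros simp: power2_eq_square power3_eq_cube algebra_simps)
    have "y\<^sup>2 \<le> 1" using y by (simp add: abs_square_le_1)
    thus "0 \<le> pi * (y * (1 - y\<^sup>2))" using y by simp
  qed auto
  finally show ?thesis by (simp add: ennreal_plus[symmetric] field_simps del: ennreal_plus)
qed

lemma nn_integral_ball_abs_coordinate:
  fixes b :: "real^3"
  assumes b: "b \<in> Basis"
  shows "(\<integral>\<^sup>+v. ennreal \<bar>v \<bullet> b\<bar> * indicator (cball 0 1) v \<partial>lborel) = ennreal (pi/2)"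
proof -
  interpret product_sigma_finite "\<lambda>_::real^3. lborel :: real measure" ..
  define A where "A = Basis - {b}"
  have A: "finite A" "b \<notin> A" "Basis = insert b A" using b by (auto simp: A_def)
  have cA: "card A = 2"
  proof -
    have "card (insert b A) = 3" unfolding A(3)[symmetric] by simp
    thus ?thesis using A(1,2) by simp
  qed
  define lin where "lin f = (\<Sum>b'\<in>Basis. f b' *\<^sub>R b')" for f :: "real^3 \<Rightarrow> real"
  have lin_b: "lin (x(b := y)) \<bullet> b = y" for x y
    using b by (simp add: lin_def)
  have nlin: "norm (lin (x(b := y))) \<le> 1 \<longleftrightarrow> y\<^sup>2 + (\<Sum>i\<in>A. (x i)\<^sup>2) \<le> 1" for x y
  proof -
    have "(norm (lin (x(b := y))))\<^sup>2 = (\<Sum>i\<in>Basis. ((x(b := y)) i)\<^sup>2)"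
      unfolding power2_norm_eq_inner by (subst euclidean_inner) (simp add: lin_def power2_eq_square)
    also have "\<dots> = y\<^sup>2 + (\<Sum>i\<in>A. ((x(b := y)) i)\<^sup>2)" unfolding A(3) using A(1,2) by simp
    also have "(\<Sum>i\<in>A. ((x(b := y)) i)\<^sup>2) = (\<Sum>i\<in>A. (x i)\<^sup>2)" using A(2) by (intro sum.cong) auto
    finally have e: "(norm (lin (x(b := y))))\<^sup>2 = y\<^sup>2 + (\<Sum>i\<in>A. (x i)\<^sup>2)" .
    show ?thesis unfolding e[symmetric] by (simp add: abs_square_le_1)
  qed
  have linm [measurable]: "lin \<in> borel_measurable (Pi\<^sub>M (insert b A) (\<lambda>_. lborel))"
    unfolding lin_def A(3)[symmetric] by measurable
  have "(\<integral>\<^sup>+v. ennreal \<bar>v \<bullet> b\<bar> * indicator (cball 0 1) v \<partial>lborel) =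
     (\<integral>\<^sup>+f. ennreal \<bar>lin f \<bullet> b\<bar> * indicator (cball 0 1) (lin f) \<partial>(Pi\<^sub>M Basis (\<lambda>_. lborel)))"
  proof -
    have m1: "(\<lambda>f. \<Sum>b\<in>Basis. f b *\<^sub>R b) \<in> Pi\<^sub>M Basis (\<lambda>_. lborel) \<rightarrow>\<^sub>M (borel :: (real^3) measure)"
      by measurable
    have m2: "(\<lambda>v. ennreal \<bar>v \<bullet> b\<bar> * indicator unit_cball v) \<in> borel_measurable borel"
      by measurable
    show ?thesis
      unfolding lin_def by (subst lborel_eq, subst nn_integral_distr[OF m1]) (use m2 in simp_all)
  qed
  also have "\<dots> = (\<integral>\<^sup>+y. (\<integral>\<^sup>+x. ennreal \<bar>lin (x(b := y)) \<bullet> b\<bar> * indicator (cball 0 1) (lin (x(b := y)))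
      \<partial>(Pi\<^sub>M A (\<lambda>_. lborel))) \<partial>lborel)"
    unfolding A(3) by (rule product_nn_integral_insert_rev[OF A(1,2)]) measurable
  also have "\<dots> = (\<integral>\<^sup>+y. ennreal (pi * (\<bar>y\<bar> * (1 - y\<^sup>2))) * indicator {-1..1} y \<partial>lborel)"
  proof (rule nn_integral_cong_AE)
    \<comment> \<open>At y = 1 and y = -1 the slice has radius 0, while
      \<open>emeasure_cball_aux\<close> is applied with a positive radius; two points form a null
      set.\<close>
    have "AE y in lborel. y \<noteq> 1 \<and> y \<noteq> (- 1 :: real)"
      using AE_lborel_singleton[of 1] AE_lborel_singleton[of "- 1 :: real"] by eventually_elim simp
    thus "AE y in lborel. (\<integral>\<^sup>+x. ennreal \<bar>lin (x(b := y)) \<bullet> b\<bar> * indicator (cball 0 1) (lin (x(b := y)))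
      \<partial>(Pi\<^sub>M A (\<lambda>_. lborel))) = ennreal (pi * (\<bar>y\<bar> * (1 - y\<^sup>2))) * indicator {-1..1} y"
    proof eventually_elim
      case (elim y)
      show ?case
      proof (cases "\<bar>y\<bar> < 1")
        case True
        define r where "r = sqrt (1 - y\<^sup>2)"
        have y2: "y\<^sup>2 < 1" using True by (simp add: abs_square_less_1)
        hence r: "r > 0" by (simp add: r_def)
        let ?S = "{f. sqrt (\<Sum>i\<in>A. (f i)\<^sup>2) \<le> r} \<inter> space (Pi\<^sub>M A (\<lambda>_. lborel :: real measure))"
        have "(\<integral>\<^sup>+x. ennreal \<bar>lin (x(b := y)) \<bullet> b\<bar> * indicator (cball 0 1) (lin (x(b := y))) \<partial>(Pi\<^sub>M A (\<lambda>_. lborel))) =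
           (\<integral>\<^sup>+x. ennreal \<bar>y\<bar> * indicator ?S x \<partial>(Pi\<^sub>M A (\<lambda>_. lborel)))"
        proof (rule nn_integral_cong)
          fix x assume "x \<in> space (Pi\<^sub>M A (\<lambda>_. lborel :: real measure))"
          moreover have "norm (lin (x(b := y))) \<le> 1 \<longleftrightarrow> sqrt (\<Sum>i\<in>A. (x i)\<^sup>2) \<le> r"
            unfolding nlin r_def by auto
          ultimately show "ennreal \<bar>lin (x(b := y)) \<bullet> b\<bar> * indicator (cball 0 1) (lin (x(b := y))) =
             ennreal \<bar>y\<bar> * indicator ?S x"
            by (simp add: lin_b indicator_def)
        qed
        also have "\<dots> = ennreal \<bar>y\<bar> * emeasure (Pi\<^sub>M A (\<lambda>_. lborel)) ?S"
          by (intro nn_integral_cmult_indicator) measurable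
        also have "\<dots> = ennreal \<bar>y\<bar> * ennreal (pi * r\<^sup>2)"
          by (subst emeasure_cball_aux[OF A(1) r]) (simp add: cA unit_ball_vol_2)
        also have "r\<^sup>2 = 1 - y\<^sup>2" using y2 by (simp add: r_def)
        also have "ennreal \<bar>y\<bar> * ennreal (pi * (1 - y\<^sup>2)) = ennreal (pi * (\<bar>y\<bar> * (1 - y\<^sup>2))) * indicator {-1..1} y"
        proof -
          have "y \<in> {-1..1}" using True by auto
          thus ?thesis by (simp add: ennreal_mult'[symmetric] mult_ac)
        qed
        finally show ?thesis .
      next
        case False
        hence out: "1 < \<bar>y\<bar>" using elim by linarith
        hence "1 < y\<^sup>2" by (metis abs_square_less_1 linorder_neqE_linordered_idom abs_square_eq_1 less_irrefl less_asym)
        hence "\<not> norm (lin (x(b := y))) \<le> 1" for x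
          unfolding nlin using sum_nonneg[of A "\<lambda>i. (x i)\<^sup>2"] by simp
        moreover have "y \<notin> {-1..1}" using out by auto
        ultimately show ?thesis by simp
      qed
    qed
  qed
  also have "\<dots> = ennreal (pi/2)" by (rule nn_integral_abs_profile)
  finally show ?thesis .
qed

lemma set_integral_cball_eq:
  fixes f :: "real^3 \<Rightarrow> real"
  assumes "continuous_on (cball 0 s) f"
  shows "set_integrable lborel (cball 0 s) f" "(LINT v:cball 0 s|lborel. f v) = integral (cball 0 s) f"
proof -
  show "set_integrable lborel (cball 0 s) f"
    unfolding set_integrable_def using assms by (intro borel_integrable_compact) auto
  thus "(LINT v:cball 0 s|lborel. f v) = integral (cball 0 s) f"
    by (rule set_borel_integral_eq_integral)
qed

text \<open>The formula for vector-valued integrands, with \<open>f\<close> regarded as a map into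
  \<open>real^1\<close>.\<close>

lemma real_integral_change_of_variables_linear:
  fixes f :: "real^3 \<Rightarrow> real" and g :: "real^3 \<Rightarrow> real^3"
  assumes g: "linear g" and f: "f absolutely_integrable_on (g ` S)"
  shows "integral (g ` S) f = \<bar>det (matrix g)\<bar> *\<^sub>R integral S (\<lambda>v. f (g v))"
proof -
  define F :: "real^3 \<Rightarrow> real^1" where "F v = vec (f v)" for v
  have "F absolutely_integrable_on (g ` S)"
    using f by (simp add: absolutely_integrable_on_1_iff F_def)
  hence "integral (g ` S) F = \<bar>det (matrix g)\<bar> *\<^sub>R integral S (F \<circ> g)"
    using g by (intro integral_change_of_variables_linear) auto
  from arg_cong[OF this, of "\<lambda>w. w $ 1"] show ?thesis
    by (simp add: integral_on_1_eq F_def o_def)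
qed

text \<open>An orthogonal map takes \<open>u\<close> to a multiple of a coordinate axis and
  preserves the ball and its volume, which reduces the claim to one coordinate.\<close>

lemma integral_ball_abs_inner:
  fixes u :: "real^3"
  shows "(LINT v:unit_cball|lborel. \<bar>u \<bullet> v\<bar>) = pi/2 * norm u"
proof -
  define b :: "real^3" where "b = axis 1 1"
  have b: "b \<in> Basis" by (simp add: b_def axis_in_Basis_iff)
  have nb: "norm u = norm (norm u *\<^sub>R b)" by (simp add: b_def)
  obtain T where T: "orthogonal_transformation T" "T u = norm u *\<^sub>R b"
    using orthogonal_transformation_exists[OF nb] by blast
  have linT: "linear T" using T(1) by (rule orthogonal_transformation_linear)
  have img: "T ` unit_cball = unit_cball"
    using image_orthogonal_transformation_cball[OF T(1), of 0 1] linear_0[OF linT] by simp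
  have cont: "continuous_on (cball 0 s) (\<lambda>v. \<bar>w \<bullet> v\<bar>)" for s and w :: "real^3"
    by (intro continuous_intros)
  have T_inner: "T x \<bullet> T y = x \<bullet> y" for x y using T(1) by (simp add: orthogonal_transformation_def)
  have "integral (T ` unit_cball) (\<lambda>v. \<bar>T u \<bullet> v\<bar>) = \<bar>det (matrix T)\<bar> *\<^sub>R integral unit_cball (\<lambda>v. \<bar>T u \<bullet> T v\<bar>)"
  proof (rule real_integral_change_of_variables_linear[OF linT])
    have "(\<lambda>v. \<bar>T u \<bullet> v\<bar>) absolutely_integrable_on unit_cball"
      using set_integral_cball_eq(1)[OF cont, of 1 "T u"]
      by (simp add: set_integrable_def integrable_completion)
    thus "(\<lambda>v. \<bar>T u \<bullet> v\<bar>) absolutely_integrable_on T ` unit_cball"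
      unfolding img .
  qed
  moreover note img
  moreover have "\<bar>det (matrix T)\<bar> = 1" using T(1) by (rule orthogonal_transformation_det)
  ultimately have "integral unit_cball (\<lambda>v. \<bar>T u \<bullet> v\<bar>) = integral unit_cball (\<lambda>v. \<bar>u \<bullet> v\<bar>)"
    by (simp add: T_inner)
  hence "(LINT v:unit_cball|lborel. \<bar>u \<bullet> v\<bar>) = (LINT v:unit_cball|lborel. \<bar>T u \<bullet> v\<bar>)"
    by (simp only: set_integral_cball_eq(2)[OF cont])
  also have "\<dots> = (LINT v:unit_cball|lborel. norm u * \<bar>v \<bullet> b\<bar>)"
    by (simp add: T(2) abs_mult inner_commute)
  also have "\<dots> = norm u * (LINT v:unit_cball|lborel. \<bar>v \<bullet> b\<bar>)"
    by (rule set_integral_mult_right)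
  also have "(LINT v:unit_cball|lborel. \<bar>v \<bullet> b\<bar>) = pi/2"
  proof -
    have "(\<integral>\<^sup>+v. ennreal (indicator unit_cball v *\<^sub>R \<bar>v \<bullet> b\<bar>) \<partial>lborel) =
        (\<integral>\<^sup>+v. ennreal \<bar>v \<bullet> b\<bar> * indicator unit_cball v \<partial>lborel)"
      by (intro nn_integral_cong) (auto simp: indicator_def)
    also have "\<dots> = ennreal (pi/2)" by (rule nn_integral_ball_abs_coordinate[OF b])
    finally have "(\<integral>\<^sup>+v. ennreal (indicator unit_cball v *\<^sub>R \<bar>v \<bullet> b\<bar>) \<partial>lborel) = ennreal (pi/2)" .
    moreover have "(\<lambda>v. indicator unit_cball v *\<^sub>R \<bar>v \<bullet> b\<bar>) \<in> borel_measurable lborel" by measurable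
    ultimately show ?thesis unfolding set_lebesgue_integral_def
      by (intro has_bochner_integral_integral_eq has_bochner_integral_nn_integral) auto
  qed
  finally show ?thesis by simp
qed

text \<open>Homogeneity gives \<open>I s = s^4 * I 1\<close> for the integral over the ball of radius \<open>s\<close>;
  comparing with the volume of the shell between \<open>s\<close> and \<open>1\<close> and letting \<open>s\<close> tend to \<open>1\<close> bounds \<open>I 1\<close>.\<close>
lemma integral_ball_norm_le: "(LINT v:unit_cball|lborel. norm v) \<le> pi"
proof -
  define I where "I s = (LINT v:cball (0::real^3) s|lborel. norm v)" for s
  have cont: "continuous_on (cball (0::real^3) s) norm" for s by (intro continuous_intros)
  note int = set_integral_cball_eq(1)[OF cont]
  have scale: "I s = s^4 * I 1" if s: "0 < s" for s
  proof -
    have img: "(*\<^sub>R) s ` unit_cball = cball 0 s"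
    proof (intro equalityI subsetI)
      fix x :: "real^3" assume "x \<in> cball 0 s"
      hence "x = s *\<^sub>R (x /\<^sub>R s)" "x /\<^sub>R s \<in> unit_cball" using s by (simp_all add: field_simps)
      thus "x \<in> (*\<^sub>R) s ` unit_cball" by blast
    qed (use s in \<open>auto simp: mult_le_cancel_left1\<close>)
    have "integral ((*\<^sub>R) s ` unit_cball) norm = \<bar>det (matrix ((*\<^sub>R) s :: real^3 \<Rightarrow> real^3))\<bar> *\<^sub>R integral unit_cball (\<lambda>v. norm (s *\<^sub>R v))"
    proof (rule real_integral_change_of_variables_linear)
      show "linear ((*\<^sub>R) s :: real^3 \<Rightarrow> real^3)" by (rule linear_scaleR)
      have "norm absolutely_integrable_on (cball (0::real^3) s)"
        using int[of s] by (simp add: set_integrable_def integrable_completion)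
      thus "norm absolutely_integrable_on (*\<^sub>R) s ` unit_cball"
        unfolding img .
    qed
    moreover have "\<bar>det (matrix ((*\<^sub>R) s :: real^3 \<Rightarrow> real^3))\<bar> = s^3" using s by (simp add: det_matrix_scaleR)
    ultimately have "integral (cball (0::real^3) s) norm = s^3 * (s * integral unit_cball norm)"
      using s unfolding img by simp
    thus ?thesis unfolding I_def set_integral_cball_eq(2)[OF cont] by (simp add: eval_nat_numeral)
  qed
  have vol: "measure lborel (cball (0::real^3) s) = 4/3 * pi * s^3" if "0 \<le> s" for s
    using that by (simp add: content_cball unit_ball_vol_3)
  \<comment> \<open>The shell comparison reads I 1 (1 - s^4) <= 4/3 pi (1 - s^3). Both sides contain
    the factor 1 - s, which must be cancelled before s tends to 1.\<close>
  have key: "I 1 * (1 + s + s\<^sup>2 + s^3) \<le> 4/3 * pi * (1 + s + s\<^sup>2)" if s: "0 < s" "s < 1" for s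
  proof -
    let ?S = "unit_cball - cball 0 s"
    have sub: "cball 0 s \<subseteq> unit_cball" using s by auto
    have intS: "set_integrable lborel ?S norm"
      by (rule set_integrable_subset[OF int[of 1]]) auto
    have "I 1 = (LINT v:?S \<union> cball 0 s|lborel. norm v)"
      unfolding I_def by (rule arg_cong[where f = "\<lambda>S. LINT v:S|lborel. norm v"]) (use sub in blast)
    also have "\<dots> = (LINT v:?S|lborel. norm v) + I s"
      unfolding I_def by (rule set_integral_Un[OF _ intS int]) auto
    also have "(LINT v:?S|lborel. norm v) \<le> (LINT v:?S|lborel. 1)"
    proof (rule set_integral_mono[OF intS])
      show "set_integrable lborel ?S (\<lambda>v. 1::real)"
        by (rule set_integrable_subset[OF set_integral_cball_eq(1)[of 1 "\<lambda>_. 1"]]) auto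
    qed auto
    also have "(LINT v:?S|lborel. (1::real)) = measure lborel ?S"
      by (simp add: set_lebesgue_integral_def)
    also have "measure lborel ?S = measure lborel unit_cball - measure lborel (cball (0::real^3) s)"
      by (rule measure_Diff) (use sub emeasure_lborel_cball_finite in \<open>auto simp: emeasure_cball\<close>)
    also have "\<dots> = 4/3 * pi * (1 - s^3)" using s by (simp add: vol algebra_simps)
    finally have "I 1 \<le> 4/3 * pi * (1 - s^3) + I s" by simp
    hence "I 1 \<le> 4/3 * pi * (1 - s^3) + s^4 * I 1"
      unfolding scale[OF s(1)] .
    moreover have "I 1 * (1 - s^4) = I 1 - s^4 * I 1" by (simp add: algebra_simps)
    ultimately have "I 1 * (1 - s^4) \<le> 4/3 * pi * (1 - s^3)" by linarith
    moreover have "I 1 * (1 - s^4) = (1 - s) * (I 1 * (1 + s + s\<^sup>2 + s^3))"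
      "4/3 * pi * (1 - s^3) = (1 - s) * (4/3 * pi * (1 + s + s\<^sup>2))"
      by (simp_all add: algebra_simps eval_nat_numeral)
    ultimately have "(1 - s) * (I 1 * (1 + s + s\<^sup>2 + s^3)) \<le> (1 - s) * (4/3 * pi * (1 + s + s\<^sup>2))"
      by (simp only:)
    thus ?thesis by (rule mult_left_le_imp_le) (use s in simp)
  qed
  have "I 1 * (1 + 1 + 1\<^sup>2 + 1^3) \<le> 4/3 * pi * (1 + 1 + 1\<^sup>2)"
  proof (rule tendsto_le)
    show "((\<lambda>s. 4/3 * pi * (1 + s + s\<^sup>2)) \<longlongrightarrow> 4/3 * pi * (1 + 1 + 1\<^sup>2)) (at_left (1::real))"
      by (intro tendsto_intros)
    show "((\<lambda>s. I 1 * (1 + s + s\<^sup>2 + s^3)) \<longlongrightarrow> I 1 * (1 + 1 + 1\<^sup>2 + 1^3)) (at_left (1::real))"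
      by (intro tendsto_intros)
    show "\<forall>\<^sub>F s in at_left (1::real). I 1 * (1 + s + s\<^sup>2 + s^3) \<le> 4/3 * pi * (1 + s + s\<^sup>2)"
    proof -
      have "\<forall>\<^sub>F s in at_left (1::real). s \<in> {0<..<1}" by (rule eventually_at_left_real) simp
      thus ?thesis by eventually_elim (use key in auto)
    qed
  qed simp
  thus ?thesis unfolding I_def by simp
qed

section \<open>A measurable partition of the ball into cells\<close>

definition face :: "real^3 \<Rightarrow> 3" where
  "face v = (if \<bar>v $ 2\<bar> \<le> \<bar>v $ 1\<bar> \<and> \<bar>v $ 3\<bar> \<le> \<bar>v $ 1\<bar> then 1 else if \<bar>v $ 3\<bar> \<le> \<bar>v $ 2\<bar> then 2 else 3)"

lemma abs_le_face: "\<bar>v $ i\<bar> \<le> \<bar>v $ face v\<bar>"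
proof -
  have "\<forall>i. \<bar>v $ i\<bar> \<le> \<bar>v $ face v\<bar>"
    unfolding forall_3 by (auto simp: face_def)
  thus ?thesis ..
qed

text \<open>Ties between coordinates go to the smallest index in \<open>face\<close>, so every
  vector has exactly one cell. At the origin the quotients by 0 are 0, which gives the cell (1, 0,
  0).\<close>

definition cell_index :: "nat \<Rightarrow> real^3 \<Rightarrow> cell" where
  "cell_index M v = (let f = face v in
     (f, \<lfloor>M * (v $ (f + 1)/v $ f)\<rfloor>, \<lfloor>M * (v $ (f + 2)/v $ f)\<rfloor>))"

lemma cell_index_in_cells: "cell_index M v \<in> cells M"
proof -
  define f where "f = face v"
  have "\<lfloor>M * (v $ i/v $ f)\<rfloor> \<in> {- int M..int M}" for i
  proof -
    have "\<bar>v $ i/v $ f\<bar> \<le> 1"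
      using abs_le_face[of v i] by (simp add: f_def abs_divide divide_le_eq_1)
    hence le: "\<bar>M * (v $ i/v $ f)\<bar> \<le> real M * 1"
      unfolding abs_mult by (intro mult_mono) auto
    define z where "z = M * (v $ i/v $ f)"
    from le have "\<bar>z\<bar> \<le> real M" unfolding z_def mult_1_right .
    hence "- real M \<le> z" "z \<le> real M" by linarith+
    hence "real_of_int (- int M) \<le> z" "z < real_of_int (int M) + 1" by simp_all
    hence "- int M \<le> \<lfloor>z\<rfloor>" "\<lfloor>z\<rfloor> \<le> int M" unfolding le_floor_iff floor_le_iff .
    thus ?thesis by (simp add: z_def)
  qed
  thus ?thesis by (simp add: cell_index_def cells_def f_def Let_def)
qed

text \<open>Since opposite faces are identified, the sign of the leading coordinate selects
  whichever of \<open>v\<close> and \<open>- v\<close> lies in the cone.\<close>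

lemma in_cone_cell_index:
  assumes c: "cell_index M v = c"
  shows "in_cone M c (sgn (v $ fst c) *\<^sub>R v)"
proof -
  define f where "f = face v"
  define s where "s = sgn (v $ f)"
  have c': "c = (f, \<lfloor>M * (v $ (f + 1)/v $ f)\<rfloor>, \<lfloor>M * (v $ (f + 2)/v $ f)\<rfloor>)"
    using c by (simp add: cell_index_def f_def Let_def)
  show ?thesis
  proof (cases "v $ f = 0")
    case True
    thus ?thesis unfolding c' by (simp add: in_cone_def)
  next
    case False
    have sf: "s * v $ f = \<bar>v $ f\<bar>" by (simp add: s_def sgn_mult_self_eq abs_sgn mult.commute)
    have *: "of_int \<lfloor>M * (v $ i/v $ f)\<rfloor> * (s * v $ f) \<le> M * (s * v $ i)"
      "M * (s * v $ i) \<le> (of_int \<lfloor>M * (v $ i/v $ f)\<rfloor> + 1) * (s * v $ f)" for i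
    proof -
      have e: "M * (s * v $ i) = (M * (v $ i/v $ f)) * (s * v $ f)" using False by simp
      show "of_int \<lfloor>M * (v $ i/v $ f)\<rfloor> * (s * v $ f) \<le> M * (s * v $ i)"
        unfolding e unfolding sf by (intro mult_right_mono of_int_floor_le) simp
      show "M * (s * v $ i) \<le> (of_int \<lfloor>M * (v $ i/v $ f)\<rfloor> + 1) * (s * v $ f)"
        unfolding e unfolding sf by (rule mult_right_mono, linarith, simp)
    qed
    have "0 \<le> s * v $ f" unfolding sf by simp
    thus ?thesis unfolding c' in_cone_def prod.case fst_conv s_def[symmetric] vector_scaleR_component real_scaleR_def
      using * by blast
  qed
qed

lemma sgn_face_coordinate:
  assumes "cell_index M v = c" "v \<noteq> 0"
  shows "sgn (v $ fst c) = 1 \<or> sgn (v $ fst c) = - 1"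
proof -
  have "v $ fst c \<noteq> 0"
  proof
    assume "v $ fst c = 0"
    hence "v $ i = 0" for i
      using abs_le_face[of v i] assms(1) by (auto simp: cell_index_def Let_def)
    thus False using assms(2) by (simp add: vec_eq_iff)
  qed
  thus ?thesis by (simp add: sgn_real_def)
qed

lemma vec_nth_measurable [measurable]: "(\<lambda>v :: real^3. v $ i) \<in> borel_measurable borel"
  by (intro borel_measurable_continuous_onI continuous_intros)

lemma cell_index_sets: "{v. cell_index M v = c} \<in> sets borel"
proof -
  obtain f a b where c: "c = (f, a, b)" by (cases c) auto
  have face_set: "{v. face v = g} \<in> sets borel" for g
  proof -
    have "g = 1 \<or> g = 2 \<or> g = 3" by (rule exhaust_3)
    moreover have "{v :: real^3. \<bar>v $ 2\<bar> \<le> \<bar>v $ 1\<bar> \<and> \<bar>v $ 3\<bar> \<le> \<bar>v $ (1::3)\<bar>} \<in> sets borel"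
      "{v :: real^3. \<not> (\<bar>v $ 2\<bar> \<le> \<bar>v $ 1\<bar> \<and> \<bar>v $ 3\<bar> \<le> \<bar>v $ (1::3)\<bar>) \<and> \<bar>v $ 3\<bar> \<le> \<bar>v $ 2\<bar>} \<in> sets borel"
      "{v :: real^3. \<not> (\<bar>v $ 2\<bar> \<le> \<bar>v $ 1\<bar> \<and> \<bar>v $ 3\<bar> \<le> \<bar>v $ (1::3)\<bar>) \<and> \<not> \<bar>v $ 3\<bar> \<le> \<bar>v $ 2\<bar>} \<in> sets borel"
      by measurable
    moreover have "{v. face v = 1} = {v :: real^3. \<bar>v $ 2\<bar> \<le> \<bar>v $ 1\<bar> \<and> \<bar>v $ 3\<bar> \<le> \<bar>v $ (1::3)\<bar>}"
      "{v. face v = 2} = {v :: real^3. \<not> (\<bar>v $ 2\<bar> \<le> \<bar>v $ 1\<bar> \<and> \<bar>v $ 3\<bar> \<le> \<bar>v $ (1::3)\<bar>) \<and> \<bar>v $ 3\<bar> \<le> \<bar>v $ 2\<bar>}"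
      "{v. face v = 3} = {v :: real^3. \<not> (\<bar>v $ 2\<bar> \<le> \<bar>v $ 1\<bar> \<and> \<bar>v $ 3\<bar> \<le> \<bar>v $ (1::3)\<bar>) \<and> \<not> \<bar>v $ 3\<bar> \<le> \<bar>v $ 2\<bar>}"
      by (auto simp: face_def)
    ultimately show ?thesis by metis
  qed
  have fl: "{v. \<lfloor>real M * (v $ i/v $ f)\<rfloor> = z} \<in> sets borel" for i z
  proof -
    have "{v. \<lfloor>real M * (v $ i/v $ f)\<rfloor> = z} =
        {v. of_int z \<le> real M * (v $ i/v $ f) \<and> real M * (v $ i/v $ f) < of_int z + 1}"
      by (auto simp: floor_eq_iff)
    also have "\<dots> \<in> sets borel" by measurable
    finally show ?thesis .
  qed
  have "{v. cell_index M v = c} = {v. face v = f} \<inter> {v. \<lfloor>real M * (v $ (f + 1)/v $ f)\<rfloor> = a} \<inter>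
      {v. \<lfloor>real M * (v $ (f + 2)/v $ f)\<rfloor> = b}"
    by (auto simp: cell_index_def c Let_def)
  thus ?thesis using face_set fl by (simp add: sets.Int)
qed

section \<open>The volume of the cone over a cell\<close>

lemma in_cone_coordinates:
  assumes "in_cone M (f, a, b) v" "norm v \<le> 1" "M \<ge> 1"
  shows "0 \<le> v $ f" "v $ f \<le> 1" "0 \<le> v $ (f + 1) - a/M * v $ f" "v $ (f + 1) - a/M * v $ f \<le> 1/M"
    "0 \<le> v $ (f + 2) - b/M * v $ f" "v $ (f + 2) - b/M * v $ f \<le> 1/M"
proof -
  have vf: "0 \<le> v $ f" "v $ f \<le> 1"
    using assms component_le_norm_cart[of v f] by (auto simp: in_cone_def)
  thus "0 \<le> v $ f" "v $ f \<le> 1" .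
  have h: "a * v $ f \<le> M * v $ (f + 1)" "M * v $ (f + 1) \<le> a * v $ f + 1"
    "b * v $ f \<le> M * v $ (f + 2)" "M * v $ (f + 2) \<le> b * v $ f + 1"
    using assms(1) vf by (auto simp: in_cone_def distrib_right)
  have coord: "0 \<le> x - d/M * y \<and> x - d/M * y \<le> 1/M" if "d * y \<le> M * x" "M * x \<le> d * y + 1" for x y d :: real
  proof -
    have "x - d/M * y = (M * x - d * y)/M" using assms(3) by (simp add: diff_divide_distrib)
    moreover have "0 \<le> (M * x - d * y)/M" using that by simp
    moreover have "(M * x - d * y)/M \<le> 1/M" using that by (intro divide_right_mono) auto
    ultimately show ?thesis by simp
  qed
  show "0 \<le> v $ (f + 1) - a/M * v $ f" "v $ (f + 1) - a/M * v $ f \<le> 1/M"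
    "0 \<le> v $ (f + 2) - b/M * v $ f" "v $ (f + 2) - b/M * v $ f \<le> 1/M"
    using coord[OF h(1,2)] coord[OF h(3,4)] by simp_all
qed

text \<open>A unimodular map that tilts the axis \<open>f\<close> to the edge (1, \<alpha>, \<beta>)
  of the cone. It carries a box with sides 1, 1/M, 1/M onto a parallelepiped containing the part of
  the cone in the unit ball.\<close>

definition shear :: "3 \<Rightarrow> real \<Rightarrow> real \<Rightarrow> real^3 \<Rightarrow> real^3" where
  "shear f \<alpha> \<beta> y = (\<chi> i. if i = f then y $ f else if i = f + 1 then y $ (f + 1) + \<alpha> * y $ f
     else y $ (f + 2) + \<beta> * y $ f)"

lemma shear_nth: "shear f \<alpha> \<beta> y $ f = y $ f" "shear f \<alpha> \<beta> y $ (f + 1) = y $ (f + 1) + \<alpha> * y $ f"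
  "shear f \<alpha> \<beta> y $ (f + 2) = y $ (f + 2) + \<beta> * y $ f"
  by (simp_all add: shear_def)

lemma linear_shear: "linear (shear f \<alpha> \<beta>)"
  by (rule linearI) (simp_all add: shear_def vec_eq_iff algebra_simps)

lemma vec_eq_shift3: "x = y \<longleftrightarrow> x $ f = y $ f \<and> x $ (f + 1) = y $ (f + 1) \<and> x $ (f + 2) = y $ (f + 2)"
  for x y :: "'a^3"
  unfolding vec_eq_iff by (rule forall_shift3)

lemma det_shear: "det (matrix (shear f \<alpha> \<beta>)) = 1"
proof -
  have "f = 1 \<or> f = 2 \<or> f = 3" by (rule exhaust_3)
  thus ?thesis by (elim disjE) (simp_all add: det_3 matrix_def shear_def axis_def)
qed

lemma shear_box_measure:
  fixes f :: 3
  assumes "M \<ge> (1::nat)"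
  defines "w \<equiv> (\<chi> i. if i = f then 1 else 1/real M) :: real^3"
  shows "shear f \<alpha> \<beta> ` cbox 0 w \<in> lmeasurable" "measure lebesgue (shear f \<alpha> \<beta> ` cbox 0 w) = 1/(real M)\<^sup>2"
    "shear f \<alpha> \<beta> ` cbox (- w) 0 \<in> lmeasurable" "measure lebesgue (shear f \<alpha> \<beta> ` cbox (- w) 0) = 1/(real M)\<^sup>2"
proof -
  have "prod (\<lambda>i. w $ i) UNIV = w $ f * (w $ (f + 1) * w $ (f + 2))"
    unfolding UNIV_shift3[of f] by simp
  hence p: "prod (\<lambda>i. w $ i) UNIV = 1/(real M)\<^sup>2"
    by (simp add: w_def power2_eq_square)
  have w0: "0 \<le> w $ i" for i using assms(1) by (simp add: w_def)
  have "measure lebesgue (cbox 0 w) = 1/(real M)\<^sup>2" "measure lebesgue (cbox (- w) 0) = 1/(real M)\<^sup>2"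
    using w0 p by (simp_all add: content_cbox_cart interval_ne_empty_cart)
  thus "shear f \<alpha> \<beta> ` cbox 0 w \<in> lmeasurable" "measure lebesgue (shear f \<alpha> \<beta> ` cbox 0 w) = 1/(real M)\<^sup>2"
    "shear f \<alpha> \<beta> ` cbox (- w) 0 \<in> lmeasurable" "measure lebesgue (shear f \<alpha> \<beta> ` cbox (- w) 0) = 1/(real M)\<^sup>2"
    using measurable_linear_image[OF linear_shear] measure_linear_image[OF linear_shear] det_shear
    by simp_all
qed

text \<open>Two sheared boxes of volume 1/M^2, one for the cone and one for its reflection. The
  bound 2/M^2 becomes less than 1/M^2 after division by pi.\<close>

lemma double_cone_measure:
  assumes M: "M \<ge> 1"
  obtains S where "S \<in> lmeasurable" "measure lebesgue S \<le> 2/(real M)\<^sup>2"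
    "\<And>v. norm v \<le> 1 \<Longrightarrow> in_cone M c v \<Longrightarrow> v \<in> S \<and> - v \<in> S"
proof -
  obtain f a b where c: "c = (f, a, b)" by (cases c) auto
  define \<alpha> \<beta> where "\<alpha> = a/M" and "\<beta> = b/M"
  define w where "w = ((\<chi> i. if i = f then 1 else 1/real M) :: real^3)"
  let ?S = "shear f \<alpha> \<beta> ` cbox 0 w \<union> shear f \<alpha> \<beta> ` cbox (- w) 0"
  note box = shear_box_measure[OF M, of f \<alpha> \<beta>, folded w_def]
  show ?thesis
  proof (rule that[of ?S])
    show "?S \<in> lmeasurable" using box by (intro fmeasurable.Un) auto
    have "measure lebesgue ?S \<le> measure lebesgue (shear f \<alpha> \<beta> ` cbox 0 w) + measure lebesgue (shear f \<alpha> \<beta> ` cbox (- w) 0)"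
      using box by (intro measure_Un_le) (auto intro: fmeasurableD)
    thus "measure lebesgue ?S \<le> 2/(real M)\<^sup>2" using box by simp
    fix v assume v: "norm v \<le> 1" "in_cone M c v"
    note co = in_cone_coordinates[OF v(2)[unfolded c] v(1) M, folded \<alpha>_def \<beta>_def]
    define y where "y = shear f (- \<alpha>) (- \<beta>) v"
    have y: "shear f \<alpha> \<beta> y = v"
      unfolding vec_eq_shift3[of _ _ f] shear_nth y_def by simp
    have yb: "y \<in> cbox 0 w"
      unfolding mem_box_cart forall_shift3[of _ f] y_def shear_nth w_def using co by simp
    have "shear f \<alpha> \<beta> (- y) = - v"
      using linear_neg[OF linear_shear, of f \<alpha> \<beta> y] y by simp
    moreover have "- y \<in> cbox (- w) 0" using yb by (simp add: mem_box_cart)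
    ultimately show "v \<in> ?S \<and> - v \<in> ?S" using y yb by (metis UnI1 UnI2 imageI)
  qed
qed

lemma integrable_on_ball:
  fixes \<phi> :: "real^3 \<Rightarrow> 'b :: {banach, second_countable_topology}"
  assumes [measurable]: "\<phi> \<in> borel_measurable borel" and b: "\<And>v. norm v \<le> 1 \<Longrightarrow> norm (\<phi> v) \<le> K"
    and S [measurable]: "S \<in> sets borel" "S \<subseteq> unit_cball"
  shows "integrable lborel (\<lambda>v. indicator S v *\<^sub>R \<phi> v)"
proof (rule Bochner_Integration.integrable_bound)
  have "emeasure lborel unit_cball < \<infinity>" by (simp add: emeasure_cball)
  thus "integrable lborel (\<lambda>v. K * indicator unit_cball v :: real)"
    by (intro integrable_mult_right integrable_real_indicator) (auto intro: borel_closed)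
  show "AE v in lborel. norm (indicator S v *\<^sub>R \<phi> v) \<le> norm (K * indicator unit_cball v :: real)"
    using S(2) b by (intro AE_I2) (auto simp: indicator_def intro: order_trans[OF _ abs_ge_self])
qed simp

section \<open>Barycentres of the regions\<close>

definition region :: "nat \<Rightarrow> cell \<Rightarrow> (real^3) set" where
  "region M c = {v. cell_index M v = c} \<inter> unit_cball"

lemma region_sets [measurable]: "region M c \<in> sets borel"
  unfolding region_def by (intro sets.Int cell_index_sets borel_closed closed_cball)

lemma region_subset: "region M c \<subseteq> unit_cball" by (auto simp: region_def)

lemma sum_indicator_region: "(\<Sum>c\<in>cells M. indicator (region M c) v) = (indicator unit_cball v :: real)"
proof -
  have "(\<Sum>c\<in>cells M. indicator (region M c) v :: real) =
      (\<Sum>c\<in>cells M. if c = cell_index M v then indicator unit_cball v else 0)"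
    by (intro sum.cong) (auto simp: region_def indicator_def)
  thus ?thesis using cell_index_in_cells by simp
qed

text \<open>A first moment, not an average: its length is the weight of the atom. The sign folds
  opposite parts of the region together so that they do not cancel, and 1/pi normalises the integral
  of |v| over the ball.\<close>

definition barycentre :: "nat \<Rightarrow> cell \<Rightarrow> real^3" where
  "barycentre M c = (1/pi) *\<^sub>R (\<integral>v. indicator (region M c) v *\<^sub>R (sgn (v $ fst c) *\<^sub>R v) \<partial>lborel)"

lemma sgn_vec_measurable [measurable]: "(\<lambda>v :: real^3. sgn (v $ i) *\<^sub>R v) \<in> borel_measurable borel"
  by measurable

lemma integrable_barycentre:
  "integrable lborel (\<lambda>v. indicator (region M c) v *\<^sub>R (sgn (v $ fst c) *\<^sub>R v))"
  by (rule integrable_on_ball[where K = 1, OF _ _ region_sets region_subset])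
    (auto simp: sgn_real_def)

lemma inner_barycentre:
  "y \<bullet> barycentre M c = (1/pi) * (\<integral>v. indicator (region M c) v * (y \<bullet> (sgn (v $ fst c) *\<^sub>R v)) \<partial>lborel)"
proof -
  have "y \<bullet> (\<integral>v. indicator (region M c) v *\<^sub>R (sgn (v $ fst c) *\<^sub>R v) \<partial>lborel) =
      (\<integral>v. y \<bullet> (indicator (region M c) v *\<^sub>R (sgn (v $ fst c) *\<^sub>R v)) \<partial>lborel)"
    by (rule integral_inner_right[symmetric]) (rule integrable_barycentre)
  thus ?thesis by (simp add: barycentre_def mult.assoc)
qed

lemma inner_barycentre_nonneg:
  assumes "\<And>v. in_cone M c v \<Longrightarrow> 0 \<le> y \<bullet> v"
  shows "0 \<le> y \<bullet> barycentre M c"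
proof -
  have "0 \<le> (\<integral>v. indicator (region M c) v * (y \<bullet> (sgn (v $ fst c) *\<^sub>R v)) \<partial>lborel)"
  proof (rule integral_nonneg_AE, rule AE_I2)
    fix v
    show "0 \<le> indicator (region M c) v * (y \<bullet> (sgn (v $ fst c) *\<^sub>R v))"
    proof (cases "v \<in> region M c")
      case True
      hence "0 \<le> y \<bullet> (sgn (v $ fst c) *\<^sub>R v)"
        by (intro assms in_cone_cell_index) (simp add: region_def)
      thus ?thesis by (intro mult_nonneg_nonneg) auto
    qed simp
  qed
  thus ?thesis unfolding inner_barycentre by simp
qed

text \<open>Each inequality defining the cone says that a linear functional is nonnegative, which
  passes to integrals.\<close>

lemma in_cone_barycentre: "in_cone M c (barycentre M c)"
proof -
  obtain f a b where c: "c = (f, a, b)" by (cases c) auto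
  have comb: "(p *\<^sub>R axis i 1 - q *\<^sub>R axis j 1) \<bullet> x = p * x $ i - q * x $ j" for p q i j and x :: "real^3"
    by (simp add: inner_diff_left inner_axis')
  have lin: "0 \<le> p * barycentre M c $ i - q * barycentre M c $ j"
    if "\<And>v. in_cone M c v \<Longrightarrow> 0 \<le> p * v $ i - q * v $ j" for p q i j
    using inner_barycentre_nonneg[of M c "p *\<^sub>R axis i 1 - q *\<^sub>R axis j 1"] that unfolding comb by blast
  have "0 \<le> 1 * barycentre M c $ f - 0 * barycentre M c $ f"
    by (rule lin) (simp add: in_cone_def c)
  moreover have "0 \<le> M * barycentre M c $ (f + 1) - a * barycentre M c $ f"
    by (rule lin) (simp add: in_cone_def c)
  moreover have "0 \<le> (a + 1) * barycentre M c $ f - M * barycentre M c $ (f + 1)"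
    by (rule lin) (simp add: in_cone_def c)
  moreover have "0 \<le> M * barycentre M c $ (f + 2) - b * barycentre M c $ f"
    by (rule lin) (simp add: in_cone_def c)
  moreover have "0 \<le> (b + 1) * barycentre M c $ f - M * barycentre M c $ (f + 2)"
    by (rule lin) (simp add: in_cone_def c)
  ultimately show ?thesis unfolding in_cone_def[of _ c] by (simp add: c)
qed

lemma integrable_region:
  assumes "\<phi> \<in> borel_measurable borel" "\<And>v. norm v \<le> 1 \<Longrightarrow> \<bar>\<phi> v\<bar> \<le> K"
  shows "integrable lborel (\<lambda>v. indicator (region M c) v * \<phi> v :: real)"
  using integrable_on_ball[OF assms(1) _ region_sets region_subset, of K] assms(2) by simp

lemma norm_barycentre_le:
  "norm (barycentre M c) \<le> (1/pi) * (\<integral>v. indicator (region M c) v * norm v \<partial>lborel)"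
proof -
  have "norm (\<integral>v. indicator (region M c) v *\<^sub>R (sgn (v $ fst c) *\<^sub>R v) \<partial>lborel) \<le>
      (\<integral>v. norm (indicator (region M c) v *\<^sub>R (sgn (v $ fst c) *\<^sub>R v)) \<partial>lborel)"
    by (rule integral_norm_bound)
  also have "\<dots> \<le> (\<integral>v. indicator (region M c) v * norm v \<partial>lborel)"
  proof (rule integral_mono)
    show "integrable lborel (\<lambda>v. norm (indicator (region M c) v *\<^sub>R (sgn (v $ fst c) *\<^sub>R v)))"
      by (intro integrable_norm integrable_barycentre)
    show "integrable lborel (\<lambda>v. indicator (region M c) v * norm v)"
      by (rule integrable_region[where K = 1]) auto
  qed (auto simp: indicator_def sgn_real_def)
  finally show ?thesis by (simp add: barycentre_def divide_right_mono)
qed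

lemma sum_integral_region:
  fixes \<phi> :: "real^3 \<Rightarrow> real"
  assumes "\<phi> \<in> borel_measurable borel" "\<And>v. norm v \<le> 1 \<Longrightarrow> \<bar>\<phi> v\<bar> \<le> K"
  shows "(\<Sum>c\<in>cells M. \<integral>v. indicator (region M c) v * \<phi> v \<partial>lborel) = (LINT v:unit_cball|lborel. \<phi> v)"
proof -
  have "(\<Sum>c\<in>cells M. \<integral>v. indicator (region M c) v * \<phi> v \<partial>lborel) =
      (\<integral>v. (\<Sum>c\<in>cells M. indicator (region M c) v * \<phi> v) \<partial>lborel)"
    by (rule Bochner_Integration.integral_sum[symmetric]) (rule integrable_region[OF assms])
  also have "\<dots> = (LINT v:unit_cball|lborel. \<phi> v)"
    unfolding set_lebesgue_integral_def sum_distrib_right[symmetric] sum_indicator_region by simp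
  finally show ?thesis .
qed


text \<open>Lengths of barycentres are bounded by integrals of |v|/pi: at most 1 in total. For a
  coarse cell the integrand is at most 1/pi on a double cone of volume at most 2/4^p, and 2/pi <=
  1.\<close>

lemma spread_barycentre: "spread P (cells (2^P)) (barycentre (2^P))"
proof -
  define M :: nat where "M = 2^P"
  have norm_m: "(norm :: real^3 \<Rightarrow> real) \<in> borel_measurable borel" by simp
  have sum1: "(\<Sum>i\<in>cells M. norm (barycentre M i)) \<le> 1"
  proof -
    have "(\<Sum>i\<in>cells M. norm (barycentre M i)) \<le> (\<Sum>i\<in>cells M. (1/pi) * (\<integral>v. indicator (region M i) v * norm v \<partial>lborel))"
      by (intro sum_mono norm_barycentre_le)
    also have "\<dots> = (1/pi) * (LINT v:unit_cball|lborel. norm v)"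
      unfolding sum_distrib_left[symmetric] by (subst sum_integral_region[OF norm_m, where K = 1]) auto
    also have "\<dots> \<le> (1/pi) * pi" by (intro mult_left_mono integral_ball_norm_le) simp
    finally show ?thesis by simp
  qed
  have mass: "(\<Sum>i\<in>{i\<in>cells M. coarse k i = c}. norm (barycentre M i)) \<le> 1/(2^p)\<^sup>2"
    if Pk: "P = p + k" for p k c
  proof -
    define C where "C = {i\<in>cells M. coarse k i = c}"
    have "(2::nat)^p \<ge> 1" by simp
    then obtain S where S: "S \<in> lmeasurable" "measure lebesgue S \<le> 2/(real (2^p))\<^sup>2"
      "\<And>v. norm v \<le> 1 \<Longrightarrow> in_cone (2^p) c v \<Longrightarrow> v \<in> S \<and> - v \<in> S"
      using double_cone_measure[of "2^p" c] by blast
    have "(\<Sum>i\<in>C. norm (barycentre M i)) \<le>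
        (\<Sum>i\<in>C. (1/pi) * (\<integral>v. indicator (region M i) v * norm v \<partial>lborel))"
      by (intro sum_mono norm_barycentre_le)
    also have "\<dots> = (1/pi) * (\<Sum>i\<in>C. \<integral>v. indicator (region M i) v * norm v \<partial>lborel)"
      by (simp only: sum_distrib_left)
    also have "(\<Sum>i\<in>C. \<integral>v. indicator (region M i) v * norm v \<partial>lborel) =
        (\<integral>v. (\<Sum>i\<in>C. indicator (region M i) v * norm v) \<partial>lborel)"
      by (rule Bochner_Integration.integral_sum[symmetric]) (rule integrable_region[OF norm_m, where K = 1], simp)
    \<comment> \<open>The covering set \<open>S\<close> is known to be Lebesgue measurable only,
      hence the passage to the completed measure.\<close>
    also have "\<dots> = (\<integral>v. (\<Sum>i\<in>C. indicator (region M i) v * norm v) \<partial>lebesgue)"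
      by (rule integral_completion[symmetric])
        (intro borel_measurable_sum borel_measurable_times borel_measurable_indicator, auto)
    also have "\<dots> \<le> (\<integral>v. indicator S v \<partial>lebesgue)"
    proof (rule integral_mono_AE)
      show "integrable lebesgue (\<lambda>v. \<Sum>i\<in>C. indicator (region M i) v * norm v)"
        by (intro Bochner_Integration.integrable_sum integrable_completion[THEN iffD2] integrable_region[OF norm_m, where K = 1]
            borel_measurable_times borel_measurable_indicator) auto
      show "integrable lebesgue (indicator S :: real^3 \<Rightarrow> real)"
        using S(1) by (intro integrable_real_indicator) (auto simp: fmeasurable_def)
      show "AE v in lebesgue. (\<Sum>i\<in>C. indicator (region M i) v * norm v) \<le> (indicator S v :: real)"
      proof (rule AE_I2)
        fix v :: "real^3"
        define i0 where "i0 = cell_index M v"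
        have s: "(\<Sum>i\<in>C. indicator (region M i) v * norm v) =
          (\<Sum>i\<in>C. if i = i0 then indicator unit_cball v * norm v else 0)"
          by (intro sum.cong) (auto simp: region_def indicator_def i0_def)
        show "(\<Sum>i\<in>C. indicator (region M i) v * norm v) \<le> (indicator S v :: real)"
        proof (cases "coarse k i0 = c \<and> norm v \<le> 1 \<and> v \<noteq> 0")
          case True
          define s where "s = sgn (v $ fst i0)"
          have "in_cone (2^(p + k)) i0 (s *\<^sub>R v)"
            using in_cone_cell_index[of M v i0] by (simp add: i0_def M_def Pk s_def)
          hence ic: "in_cone (2^p) c (s *\<^sub>R v)" using coarse_in_cone True by blast
          have "s = 1 \<or> s = - 1"
            unfolding s_def by (rule sgn_face_coordinate[of M v]) (use True in \<open>simp_all add: i0_def\<close>)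
          hence "v \<in> S" using S(3)[OF _ ic] True by auto
          moreover have "(\<Sum>i\<in>C. if i = i0 then indicator unit_cball v * norm v else 0) \<le> 1"
            using True by (simp add: C_def sum.delta indicator_def)
          ultimately show ?thesis unfolding s by simp
        next
          case False
          have "(\<Sum>i\<in>C. if i = i0 then indicator unit_cball v * norm v else 0) = 0"
            using False by (intro sum.neutral) (auto simp: C_def indicator_def)
          thus ?thesis unfolding s by simp
        qed
      qed
    qed
    also have "\<dots> = measure lebesgue S" using S(1) by simp
    also have "(1/pi) * measure lebesgue S \<le> (1/pi) * (2/(real (2^p))\<^sup>2)"
      using S(2) by (intro mult_left_mono) auto
    also have "\<dots> \<le> 1/(2^p)\<^sup>2"
      using pi_gt3 by (simp add: divide_le_eq field_simps)
    finally show ?thesis unfolding C_def[symmetric] by (simp add: divide_right_mono)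
  qed
  show ?thesis
    unfolding spread_def using sum1 mass in_cone_barycentre unfolding M_def by blast
qed

text \<open>Where |u . v| is linear, the barycentre reproduces its integral. A straddled cell loses
  at most 8 norm u/(pi M^3), from |u . v| <= 4 norm u/M on volume 2/M^2; at most 36 M such cells
  give 288/pi <= 100.\<close>

lemma support_sum_barycentre:
  "(1/2 - 100/(2^P)\<^sup>2) * norm u \<le> support_sum (cells (2^P)) (barycentre (2^P)) u"
proof -
  define M :: nat where "M = 2^P"
  have M1: "M \<ge> 1" by (simp add: M_def)
  define E where "E c = (\<integral>v. indicator (region M c) v * \<bar>u \<bullet> v\<bar> \<partial>lborel)" for c
  have um: "(\<lambda>v. \<bar>u \<bullet> v\<bar>) \<in> borel_measurable borel" by simp
  have ub: "\<bar>\<bar>u \<bullet> v\<bar>\<bar> \<le> norm u" if "norm v \<le> 1" for v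
  proof -
    have "\<bar>u \<bullet> v\<bar> \<le> norm u * norm v" by (rule Cauchy_Schwarz_ineq2)
    also have "\<dots> \<le> norm u * 1" using that by (intro mult_left_mono) auto
    finally show ?thesis by simp
  qed
  have calm: "(1/pi) * E c \<le> \<bar>u \<bullet> barycentre M c\<bar>" if ns: "\<not> straddles M u c" for c
  proof -
    define s where "s = sgn (corner M u c)"
    have "s * (u \<bullet> barycentre M c) = (1/pi) * (\<integral>v. s * (indicator (region M c) v * (u \<bullet> (sgn (v $ fst c) *\<^sub>R v))) \<partial>lborel)"
      unfolding inner_barycentre by simp
    also have "(\<integral>v. s * (indicator (region M c) v * (u \<bullet> (sgn (v $ fst c) *\<^sub>R v))) \<partial>lborel) = E c"
      unfolding E_def
    proof (rule Bochner_Integration.integral_cong[OF refl])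
      fix v
      show "s * (indicator (region M c) v * (u \<bullet> (sgn (v $ fst c) *\<^sub>R v))) = indicator (region M c) v * \<bar>u \<bullet> v\<bar>"
      proof (cases "v \<in> region M c")
        case True
        hence ci: "cell_index M v = c" by (simp add: region_def)
        have "\<bar>u \<bullet> (sgn (v $ fst c) *\<^sub>R v)\<bar> = s * (u \<bullet> (sgn (v $ fst c) *\<^sub>R v))"
          unfolding s_def by (rule abs_inner_not_straddles[OF in_cone_cell_index[OF ci] M1 ns])
        moreover have "\<bar>u \<bullet> (sgn (v $ fst c) *\<^sub>R v)\<bar> = \<bar>u \<bullet> v\<bar>"
          using sgn_face_coordinate[OF ci] by (cases "v = 0") auto
        ultimately show ?thesis using True by simp
      qed simp
    qed
    finally have "(1/pi) * E c = s * (u \<bullet> barycentre M c)" by simp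
    also have "\<dots> \<le> \<bar>s * (u \<bullet> barycentre M c)\<bar>" by simp
    also have "\<dots> \<le> \<bar>u \<bullet> barycentre M c\<bar>"
      by (simp add: abs_mult s_def sgn_real_def)
    finally show ?thesis .
  qed
  have E_str: "(1/pi) * E c \<le> 8 * norm u/(pi * (real M^3))" if st: "straddles M u c" for c
  proof -
    obtain S where S: "S \<in> lmeasurable" "measure lebesgue S \<le> 2/(real M)\<^sup>2"
      "\<And>v. norm v \<le> 1 \<Longrightarrow> in_cone M c v \<Longrightarrow> v \<in> S \<and> - v \<in> S"
      using double_cone_measure[OF M1, of c] by blast
    have "E c = (\<integral>v. indicator (region M c) v * \<bar>u \<bullet> v\<bar> \<partial>lebesgue)"
      unfolding E_def by (rule integral_completion[symmetric])
        (intro borel_measurable_times borel_measurable_indicator, auto)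
    also have "\<dots> \<le> (\<integral>v. (4 * norm u/M) * indicator S v \<partial>lebesgue)"
    proof (rule integral_mono_AE)
      show "integrable lebesgue (\<lambda>v. indicator (region M c) v * \<bar>u \<bullet> v\<bar>)"
        by (intro integrable_completion[THEN iffD2] integrable_region[OF um, where K = "norm u"]
            borel_measurable_times borel_measurable_indicator) (use ub in auto)
      show "integrable lebesgue (\<lambda>v. (4 * norm u/M) * indicator S v :: real)"
        using S(1) by (intro integrable_mult_right integrable_real_indicator) (auto simp: fmeasurable_def)
      show "AE v in lebesgue. indicator (region M c) v * \<bar>u \<bullet> v\<bar> \<le> (4 * norm u/M) * (indicator S v :: real)"
      proof (rule AE_I2)
        fix v :: "real^3"
        show "indicator (region M c) v * \<bar>u \<bullet> v\<bar> \<le> (4 * norm u/M) * (indicator S v :: real)"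
        proof (cases "v \<in> region M c \<and> v \<noteq> 0")
          case True
          hence ci: "cell_index M v = c" and nv: "norm v \<le> 1" by (auto simp: region_def)
          define s where "s = sgn (v $ fst c)"
          have s: "s = 1 \<or> s = - 1"
            unfolding s_def using sgn_face_coordinate[OF ci] True by blast
          have ic: "in_cone M c (s *\<^sub>R v)" unfolding s_def by (rule in_cone_cell_index[OF ci])
          have "v \<in> S" using S(3)[OF _ ic] s nv by auto
          moreover have "\<bar>u \<bullet> v\<bar> \<le> 4 * norm u/M"
          proof -
            have "\<bar>u \<bullet> (s *\<^sub>R v)\<bar> \<le> 4 * norm u/M * norm (s *\<^sub>R v)"
              by (rule abs_inner_straddles[OF ic M1 st])
            also have "\<dots> \<le> 4 * norm u/M * 1" using s nv by (intro mult_left_mono) auto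
            finally show ?thesis using s by auto
          qed
          ultimately show ?thesis using True by simp
        next
          case False
          thus ?thesis by (auto simp: indicator_def)
        qed
      qed
    qed
    also have "\<dots> = (4 * norm u/M) * measure lebesgue S" using S(1) by simp
    also have "\<dots> \<le> (4 * norm u/M) * (2/(real M)\<^sup>2)" using S(2) by (intro mult_left_mono) auto
    also have "\<dots> = 8 * norm u/real M^3" by (simp add: eval_nat_numeral)
    finally have "(1/pi) * E c \<le> (1/pi) * (8 * norm u/real M^3)" by (intro mult_left_mono) auto
    thus ?thesis by simp
  qed
  define C0 where "C0 = hit M u"
  have cC0: "real (card C0) \<le> 36 * real M"
    using card_straddling_le[OF M1, of u] unfolding C0_def by linarith
  have "(1/pi) * (pi/2 * norm u) = (1/pi) * (\<Sum>c\<in>cells M. E c)"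
    using sum_integral_region[OF um ub, of M] integral_ball_abs_inner[of u] by (simp add: E_def)
  also have "\<dots> = (\<Sum>c\<in>cells M. (1/pi) * E c)" by (simp only: sum_distrib_left)
  also have "\<dots> \<le> (\<Sum>c\<in>cells M. \<bar>u \<bullet> barycentre M c\<bar> + (if c \<in> C0 then 8 * norm u/(pi * (real M^3)) else 0))"
  proof (rule sum_mono)
    fix c assume c: "c \<in> cells M"
    show "(1/pi) * E c \<le> \<bar>u \<bullet> barycentre M c\<bar> + (if c \<in> C0 then 8 * norm u/(pi * (real M^3)) else 0)"
    proof (cases "straddles M u c")
      case True
      hence "c \<in> C0" using c by (simp add: C0_def hit_def)
      thus ?thesis using E_str[OF True] by simp
    next
      case False
      hence "c \<notin> C0" by (simp add: C0_def hit_def)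
      thus ?thesis using calm[OF False] by simp
    qed
  qed
  also have "\<dots> = support_sum (cells M) (barycentre M) u + real (card C0) * (8 * norm u/(pi * (real M^3)))"
  proof -
    have "(\<Sum>c\<in>cells M. if c \<in> C0 then 8 * norm u/(pi * (real M^3)) else 0) = (\<Sum>c\<in>C0. 8 * norm u/(pi * (real M^3)))"
      by (subst sum.inter_filter[symmetric]) (auto simp: C0_def hit_def intro: sum.cong)
    thus ?thesis by (simp add: sum.distrib support_sum_def)
  qed
  also have "real (card C0) * (8 * norm u/(pi * (real M^3))) \<le> (36 * real M) * (8 * norm u/(pi * (real M^3)))"
    using cC0 by (intro mult_right_mono) auto
  also have "(36 * real M) * (8 * norm u/(pi * (real M^3))) = (288/pi) * norm u/(real M)\<^sup>2"
    using M1 by (simp add: eval_nat_numeral)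
  also have "\<dots> \<le> 100 * norm u/(real M)\<^sup>2"
    using pi_gt3 by (intro divide_right_mono mult_right_mono) (auto simp: field_simps)
  finally have "1/2 * norm u \<le> support_sum (cells M) (barycentre M) u + 100 * norm u/(real M)\<^sup>2"
    by simp
  moreover have "(1/2 - 100/(2^P)\<^sup>2) * norm u = 1/2 * norm u - 100 * norm u/(real M)\<^sup>2"
    by (simp add: M_def left_diff_distrib)
  ultimately show ?thesis unfolding M_def by linarith
qed

text \<open>\<open>P\<close> is chosen so large that the discretisation error 100/4^P is at most
  step_const n^(-5/4). Added to the 400 of the reduction this gives 401.\<close>

theorem exists_configuration:
  fixes n :: nat
  assumes n: "n \<ge> 216"
  obtains J :: "cell set" and y where "finite J" "card J \<le> n" "(\<Sum>i\<in>J. norm (y i)) \<le> 1"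
    "\<And>u. (1/2 - 401 * step_const * n powr (-5/4)) * norm u \<le> support_sum J y u"
proof -
  have npos: "step_const * n powr (-5/4) > 0" using n step_const_pos by simp
  obtain P :: nat where P: "100/(step_const * n powr (-5/4)) < real P"
    using reals_Archimedean2 by blast
  have "100/(2^P)\<^sup>2 \<le> step_const * n powr (-5/4)"
  proof -
    have "real P < 2^P" by (rule of_nat_less_two_power)
    also have "(2::real)^P \<le> 2^P * 2^P" by simp
    finally have "100/(step_const * n powr (-5/4)) < (2^P)\<^sup>2" using P by (simp add: power2_eq_square)
    thus ?thesis using npos by (simp add: field_simps)
  qed
  note small = this
  obtain J :: "cell set" and y where J: "finite J" "card J \<le> n" "(\<Sum>i\<in>J. norm (y i)) \<le> 1"
    "\<And>u. \<bar>support_sum J y u - support_sum (cells (2^P)) (barycentre (2^P)) u\<bar> \<le> 400 * step_const * n powr (-5/4) * norm u"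
    by (rule spread_reduce[OF spread_barycentre[of P] n]) (rule that)
  show ?thesis
  proof (rule that[OF J(1-3)])
    fix u :: "real^3"
    have "100/(2^P)\<^sup>2 * norm u \<le> step_const * n powr (-5/4) * norm u"
      using small by (rule mult_right_mono) simp
    thus "(1/2 - 401 * step_const * n powr (-5/4)) * norm u \<le> support_sum J y u"
      using support_sum_barycentre[of P u] J(4)[of u] unfolding left_diff_distrib by linarith
  qed
qed

section \<open>Qubit operators\<close>

lemma UNIV_two: "(UNIV :: 2 set) = {0, 1}"
proof -
  have "card {0, 1 :: 2} = card (UNIV :: 2 set)" by simp
  thus ?thesis using card_subset_eq[of UNIV "{0, 1 :: 2}"] by auto
qed

lemma sum_two: "(\<Sum>i\<in>UNIV. g i) = g 0 + g (1 :: 2)"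
  unfolding UNIV_two by simp

lemma forall_two: "(\<forall>i :: 2. P i) \<longleftrightarrow> P 0 \<and> P 1"
proof -
  have "(\<forall>i. P i) \<longleftrightarrow> (\<forall>i\<in>(UNIV :: 2 set). P i)" by simp
  thus ?thesis unfolding UNIV_two by simp
qed

lemma qop_eq_iff: "A = B \<longleftrightarrow> A $ 0 $ 0 = B $ 0 $ 0 \<and> A $ 0 $ 1 = B $ 0 $ 1 \<and> A $ 1 $ 0 = B $ 1 $ 0 \<and> A $ 1 $ 1 = B $ 1 $ 1"
  for A B :: qop
  unfolding vec_eq_iff forall_two by blast

text \<open>Unnormalised Bloch form: the trace is 2m and positivity means norm w <= m. Sums and
  multiples of operators are then computed on the pairs (m, w).\<close>

definition bloch :: "real \<Rightarrow> real^3 \<Rightarrow> qop" where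
  "bloch m w = m *\<^sub>R mat 1 + n_dot_sigma w"

lemma bloch_nth:
  "bloch m w $ 0 $ 0 = of_real (m + w $ 3)" "bloch m w $ 0 $ 1 = Complex (w $ 1) (- w $ 2)"
  "bloch m w $ 1 $ 0 = Complex (w $ 1) (w $ 2)" "bloch m w $ 1 $ 1 = of_real (m - w $ 3)"
  by (simp_all add: bloch_def n_dot_sigma_def pauli_x_def pauli_y_def pauli_z_def mat_def complex_eq_iff)

lemma scaleR_bloch: "c *\<^sub>R bloch m w = bloch (c * m) (c *\<^sub>R w)"
  unfolding qop_eq_iff by (simp add: bloch_nth complex_eq_iff algebra_simps)

lemma bloch_add: "bloch m w + bloch m' w' = bloch (m + m') (w + w')"
  unfolding qop_eq_iff by (simp add: bloch_nth complex_eq_iff)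

lemma bloch_0: "bloch 0 0 = 0"
  unfolding qop_eq_iff by (simp add: bloch_nth complex_eq_iff)

lemma bloch_1: "bloch 1 0 = mat 1"
  unfolding qop_eq_iff by (simp add: bloch_nth complex_eq_iff mat_def)

lemma bloch_eq_iff: "bloch m w = bloch m' w' \<longleftrightarrow> m = m' \<and> w = w'"
  unfolding qop_eq_iff by (auto simp: bloch_nth complex_eq_iff vec_eq_iff forall_3)

lemma sum_bloch: "(\<Sum>i\<in>I. c i *\<^sub>R bloch (m i) (w i)) = bloch (\<Sum>i\<in>I. c i * m i) (\<Sum>i\<in>I. c i *\<^sub>R w i)"
  by (induction I rule: infinite_finite_induct) (simp_all add: bloch_0 scaleR_bloch bloch_add)

lemma qtrace_bloch: "qtrace (bloch m w) = of_real (2 * m)"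
  by (simp add: qtrace_def sum_two bloch_nth)

lemma Pr_meas_bloch: "Pr_meas r n s = bloch (1/2) (((if s then 1 else - 1) * (r/2)) *\<^sub>R n)"
  unfolding Pr_meas_def by (simp add: bloch_def n_dot_sigma_def scaleR_add_right)

lemma psd_bloch:
  assumes "norm w \<le> m"
  shows "psd (bloch m w)"
  unfolding psd_def
proof
  fix v :: "complex^2"
  define a b c d where "a = Re (v $ 0)" and "b = Im (v $ 0)" and "c = Re (v $ 1)" and "d = Im (v $ 1)"
  \<comment> \<open>The Hopf map: \<open>z\<close> lists the expectations of the Pauli matrices in
    \<open>v\<close>, and its length is the squared norm of \<open>v\<close>. Positivity is then the
    Cauchy-Schwarz inequality for w . z.\<close>
  define z :: "real^3" where "z = vector [2 * (a * c + b * d), 2 * (a * d - b * c), a\<^sup>2 + b\<^sup>2 - c\<^sup>2 - d\<^sup>2]"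
  define q where "q = a\<^sup>2 + b\<^sup>2 + c\<^sup>2 + d\<^sup>2"
  have q0: "q \<ge> 0" by (simp add: q_def)
  have "(norm z)\<^sup>2 = q\<^sup>2"
    unfolding power2_norm_eq_inner inner_vec_def sum_3 z_def q_def
    by (simp add: power2_eq_square algebra_simps)
  hence nz: "norm z = q" using q0 by (simp add: power2_eq_iff_nonneg)
  have "\<bar>w \<bullet> z\<bar> \<le> norm w * norm z" by (rule Cauchy_Schwarz_ineq2)
  also have "\<dots> \<le> m * q" unfolding nz using assms q0 by (rule mult_right_mono)
  finally have pos: "0 \<le> m * q + w \<bullet> z" by linarith
  have v0: "v $ 0 = Complex a b" and v1: "v $ 1 = Complex c d"
    by (simp_all add: a_def b_def c_def d_def)
  have val: "(\<Sum>i\<in>UNIV. cnj (v $ i) * (bloch m w *v v) $ i) = of_real (m * q + w \<bullet> z)"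
    unfolding matrix_vector_mult_def sum_two vec_lambda_beta bloch_nth v0 v1 q_def z_def inner_vec_def sum_3
    by (simp add: complex_eq_iff power2_eq_square algebra_simps)
  show "Im (\<Sum>i\<in>UNIV. cnj (v $ i) * (bloch m w *v v) $ i) = 0 \<and>
      0 \<le> Re (\<Sum>i\<in>UNIV. cnj (v $ i) * (bloch m w *v v) $ i)"
    unfolding val using pos by simp
qed

lemma hermitian_bloch:
  assumes "hermitian_op (A :: qop)"
  obtains m w where "A = bloch m w"
proof -
  have h: "A $ 0 $ 0 = cnj (A $ 0 $ 0)" "A $ 1 $ 1 = cnj (A $ 1 $ 1)" "A $ 0 $ 1 = cnj (A $ 1 $ 0)"
    using assms unfolding hermitian_op_def by blast+
  define w :: "real^3" where "w = vector [Re (A $ 1 $ 0), Im (A $ 1 $ 0), (Re (A $ 0 $ 0) - Re (A $ 1 $ 1))/2]"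
  have "A = bloch ((Re (A $ 0 $ 0) + Re (A $ 1 $ 1))/2) w"
    unfolding qop_eq_iff bloch_nth w_def using h by (simp add: complex_eq_iff field_simps)
  thus ?thesis by (rule that)
qed

lemma bloch_square: "bloch m w ** bloch m w = bloch (m\<^sup>2 + (norm w)\<^sup>2) ((2 * m) *\<^sub>R w)"
proof -
  have "(norm w)\<^sup>2 = w $ 1 * w $ 1 + w $ 2 * w $ 2 + w $ 3 * w $ 3"
    unfolding power2_norm_eq_inner inner_vec_def sum_3 by simp
  thus ?thesis
    unfolding qop_eq_iff matrix_matrix_mult_def vec_lambda_beta sum_two bloch_nth
    by (simp add: complex_eq_iff power2_eq_square algebra_simps)
qed

text \<open>A^2 = A reads m^2 + |w|^2 = m and 2 m w = w. Besides the rank-one projectors there are 0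
  and the identity, which may occur as outcomes of a projective measurement.\<close>

lemma projector_bloch:
  assumes "is_projector (A :: qop)"
  obtains m w where "A = bloch m w" "(m = 0 \<and> w = 0) \<or> (m = 1 \<and> w = 0) \<or> (m = 1/2 \<and> norm w = 1/2)"
proof -
  obtain m w where A: "A = bloch m w"
    using assms hermitian_bloch unfolding is_projector_def by blast
  have "bloch (m\<^sup>2 + (norm w)\<^sup>2) ((2 * m) *\<^sub>R w) = bloch m w"
    using assms unfolding is_projector_def A bloch_square by blast
  hence e: "m\<^sup>2 + (norm w)\<^sup>2 = m" "(2 * m) *\<^sub>R w = w"
    unfolding bloch_eq_iff by blast+
  have "(2 * m - 1) *\<^sub>R w = 0" using e(2) by (simp add: scaleR_left_diff_distrib)
  hence "w = 0 \<or> m = 1/2" by auto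
  moreover have "m = 0 \<or> m = 1" if "w = 0"
    using e(1) that by (simp add: power2_eq_square)
  moreover have "norm w = 1/2" if "m = 1/2"
  proof -
    have "(norm w)\<^sup>2 = (1/2)\<^sup>2" using e(1) that by (simp add: power2_eq_square)
    thus ?thesis by (simp add: power2_eq_iff_nonneg)
  qed
  ultimately show ?thesis using that[OF A] by blast
qed

text \<open>Singlet anticorrelation: the Bloch vector is reversed, the noise multiplies it by
  \<open>r\<close>, and the factor 1/2 comes from the maximally mixed marginal.\<close>

lemma assemblage_werner: "assemblage (werner r) (\<lambda>M a. M a) M a = bloch (m/2) (- (r/2) *\<^sub>R w)"
  if M: "M a = bloch m w"
proof -
  have sum_pair: "(\<Sum>p\<in>UNIV. g p) = g (0, 0) + g (0, 1) + g (1, 0) + g (1, 1)" for g :: "2 \<times> 2 \<Rightarrow> complex"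
  proof -
    have e: "(UNIV :: (2 \<times> 2) set) = {(0, 0), (0, 1), (1, 0), (1, 1)}"
      unfolding UNIV_Times_UNIV[symmetric] UNIV_two by auto
    show ?thesis unfolding e by (simp add: add.assoc)
  qed
  have s2: "complex_of_real (1/sqrt 2) * complex_of_real (1/sqrt 2) = 1/2"
    unfolding of_real_mult[symmetric] by simp
  have W: "werner r $ p $ q = of_real r * (psi_minus $ p * cnj (psi_minus $ q)) + (if p = q then of_real ((1 - r)/4) else 0)" for p q
    unfolding werner_def vector_add_component vector_scaleR_component vec_lambda_beta mat_def
    by (simp add: scaleR_conv_of_real)
  have psi: "psi_minus $ (0, 0) = 0" "psi_minus $ (1, 1) = 0" "psi_minus $ (0, 1) = complex_of_real (1/sqrt 2)"
    "psi_minus $ (1, 0) = - complex_of_real (1/sqrt 2)"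
    by (simp_all add: psi_minus_def)
  have Wv: "werner r $ (0, 0) $ (0, 0) = of_real ((1 - r)/4)" "werner r $ (1, 1) $ (1, 1) = of_real ((1 - r)/4)"
    "werner r $ (0, 1) $ (0, 1) = of_real ((1 + r)/4)" "werner r $ (1, 0) $ (1, 0) = of_real ((1 + r)/4)"
    "werner r $ (0, 1) $ (1, 0) = - of_real (r/2)" "werner r $ (1, 0) $ (0, 1) = - of_real (r/2)"
    "werner r $ (0, 0) $ (0, 1) = 0" "werner r $ (0, 0) $ (1, 0) = 0" "werner r $ (0, 0) $ (1, 1) = 0"
    "werner r $ (0, 1) $ (0, 0) = 0" "werner r $ (0, 1) $ (1, 1) = 0"
    "werner r $ (1, 0) $ (0, 0) = 0" "werner r $ (1, 0) $ (1, 1) = 0"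
    "werner r $ (1, 1) $ (0, 0) = 0" "werner r $ (1, 1) $ (0, 1) = 0" "werner r $ (1, 1) $ (1, 0) = 0"
    unfolding W psi by (simp_all add: s2 field_simps flip: of_real_mult)
  show ?thesis
    unfolding qop_eq_iff assemblage_def ptrace_A_def vec_lambda_beta sum_two matrix_matrix_mult_def sum_pair
      kron_def fst_conv snd_conv M bloch_nth Wv mat_def
    by (simp add: complex_eq_iff field_simps)
qed

text \<open>One set of data for both conclusions: the pairs (m i, w i) are the POVM elements and,
  after normalisation, the hidden states. \<open>p n i\<close> is the probability of answering + in
  direction \<open>n\<close>; by \<open>anti\<close> the answers for opposite directions are
  complementary.\<close>

locale Bloch_model =
  fixes N :: nat and r :: real and m :: "nat \<Rightarrow> real" and w :: "nat \<Rightarrow> real^3" and p :: "real^3 \<Rightarrow> nat \<Rightarrow> real"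
  assumes m: "norm (w i) \<le> m i" and sm: "(\<Sum>i<N. m i) = 1" and sw: "(\<Sum>i<N. w i) = 0"
    and p01: "0 \<le> p n i \<and> p n i \<le> 1" and anti: "p n i + p (- n) i = 1"
    and pm: "norm n = 1 \<Longrightarrow> (\<Sum>i<N. p n i * m i) = 1/2"
    and pw: "norm n = 1 \<Longrightarrow> (\<Sum>i<N. p n i *\<^sub>R w i) = (r/2) *\<^sub>R n"

lemma (in Bloch_model) povm: "is_povm N (\<lambda>i. bloch (m i) (w i))"
proof -
  have "(\<Sum>i<N. 1 *\<^sub>R bloch (m i) (w i)) = bloch 1 0"
    unfolding sum_bloch using sm sw by simp
  thus ?thesis using m by (simp add: is_povm_def psd_bloch bloch_1)
qed

lemma (in Bloch_model) simulates_Pr_meas: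
  "simulates N (\<lambda>i. bloch (m i) (w i)) unit_sphere3 (UNIV :: bool set) (Pr_meas r)"
  unfolding simulates_def
proof (intro exI[of _ "\<lambda>n s i. if s then p n i else 1 - p n i"] conjI ballI allI impI)
  fix n :: "real^3" and s :: bool assume n: "n \<in> unit_sphere3"
  hence nn: "norm n = 1" by (simp add: unit_sphere3_def)
  show "Pr_meas r n s = (\<Sum>i<N. (if s then p n i else 1 - p n i) *\<^sub>R bloch (m i) (w i))"
    unfolding sum_bloch Pr_meas_bloch bloch_eq_iff
    using pm[OF nn] pw[OF nn] sm sw
    by (simp add: left_diff_distrib scaleR_left_diff_distrib sum_subtractf)
qed (use p01 in \<open>auto simp: UNIV_bool\<close>)

definition bloch_pvm :: "nat \<Rightarrow> (nat \<Rightarrow> real) \<Rightarrow> (nat \<Rightarrow> real^3) \<Rightarrow> bool" where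
  "bloch_pvm K \<mu> \<omega> \<longleftrightarrow> (\<forall>a<K. (\<mu> a = 0 \<and> \<omega> a = 0) \<or> (\<mu> a = 1 \<and> \<omega> a = 0) \<or> (\<mu> a = 1/2 \<and> norm (\<omega> a) = 1/2)) \<and>
     (\<Sum>a<K. \<mu> a) = 1 \<and> (\<Sum>a<K. \<omega> a) = 0"

lemma projective_meas_bloch:
  assumes "is_projective_meas K M"
  shows "\<exists>\<mu> \<omega>. (\<forall>a<K. M a = bloch (\<mu> a) (\<omega> a)) \<and> bloch_pvm K \<mu> \<omega>"
proof -
  have "\<forall>a. \<exists>m w. a < K \<longrightarrow> M a = bloch m w \<and>
      ((m = 0 \<and> w = 0) \<or> (m = 1 \<and> w = 0) \<or> (m = 1/2 \<and> norm w = 1/2))"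
    using assms projector_bloch unfolding is_projective_meas_def by metis
  then obtain \<mu> \<omega> where f: "\<forall>a. a < K \<longrightarrow> M a = bloch (\<mu> a) (\<omega> a) \<and>
      ((\<mu> a = 0 \<and> \<omega> a = 0) \<or> (\<mu> a = 1 \<and> \<omega> a = 0) \<or> (\<mu> a = 1/2 \<and> norm (\<omega> a) = 1/2))"
    by metis
  have "(\<Sum>a<K. 1 *\<^sub>R bloch (\<mu> a) (\<omega> a)) = (\<Sum>a<K. M a)"
    using f by (intro sum.cong) auto
  also have "\<dots> = bloch 1 0" using assms by (simp add: is_projective_meas_def bloch_1)
  finally have "(\<Sum>a<K. \<mu> a) = 1" "(\<Sum>a<K. \<omega> a) = 0"
    unfolding sum_bloch bloch_eq_iff by simp_all
  thus ?thesis using f unfolding bloch_pvm_def by blast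
qed

text \<open>Counting traces, card H/2 + card T = 1: apart from zeros there is either a single
  identity or a pair of opposite rank-one projectors, whose responses add up to 1 by
  \<open>anti\<close>.\<close>

lemma two_halves:
  fixes p :: "real^3 \<Rightarrow> real"
  assumes pvm: "bloch_pvm K \<mu> \<omega>"
    and anti: "\<And>n. p n + p (- n) = 1"
  shows "(\<Sum>a<K. if \<mu> a = 1/2 then p ((- 2) *\<^sub>R \<omega> a) else \<mu> a) = 1"
proof -
  have cases: "\<And>a. a < K \<Longrightarrow> (\<mu> a = 0 \<and> \<omega> a = 0) \<or> (\<mu> a = 1 \<and> \<omega> a = 0) \<or> (\<mu> a = 1/2 \<and> norm (\<omega> a) = 1/2)"
    and sm: "(\<Sum>a<K. \<mu> a) = 1" and sw: "(\<Sum>a<K. \<omega> a) = 0"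
    using pvm unfolding bloch_pvm_def by blast+
  define H T where "H = {a. a < K \<and> \<mu> a = 1/2}" and "T = {a. a < K \<and> \<mu> a = 1}"
  have fin: "finite H" "finite T" by (simp_all add: H_def T_def)
  have split: "(\<Sum>a<K. g a) = (\<Sum>a\<in>H. g a) + (\<Sum>a\<in>T. g a)"
    if "\<And>a. a < K \<Longrightarrow> \<mu> a = 0 \<Longrightarrow> g a = 0" for g :: "nat \<Rightarrow> 'z :: comm_monoid_add"
  proof -
    have "(\<Sum>a<K. g a) = (\<Sum>a\<in>H \<union> T. g a)"
      using cases that by (intro sum.mono_neutral_right) (auto simp: H_def T_def)
    also have "\<dots> = (\<Sum>a\<in>H. g a) + (\<Sum>a\<in>T. g a)"
      using fin by (intro sum.union_disjoint) (auto simp: H_def T_def)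
    finally show ?thesis .
  qed
  have "(\<Sum>a\<in>H. \<mu> a) = (\<Sum>a\<in>H. 1/2)" "(\<Sum>a\<in>T. \<mu> a) = (\<Sum>a\<in>T. 1)"
    by (intro sum.cong; simp add: H_def T_def)+
  hence "real (card H)/2 + real (card T) = 1"
    using split[of \<mu>] sm by simp
  hence "card H + 2 * card T = 2" by linarith
  hence "card H = 0 \<and> card T = 1 \<or> card H = 2 \<and> card T = 0" by presburger
  thus ?thesis
  proof
    assume "card H = 0 \<and> card T = 1"
    hence H0: "H = {}" using fin by simp
    have "(\<Sum>a<K. if \<mu> a = 1/2 then p ((- 2) *\<^sub>R \<omega> a) else \<mu> a) = (\<Sum>a<K. \<mu> a)"
      using H0 by (intro sum.cong) (auto simp: H_def)
    thus ?thesis using sm by simp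
  next
    assume HT: "card H = 2 \<and> card T = 0"
    hence T0: "T = {}" using fin by simp
    obtain a b where ab: "H = {a, b}" "a \<noteq> b" using HT by (auto simp: card_2_iff)
    have "(\<Sum>a<K. \<omega> a) = (\<Sum>a\<in>H. \<omega> a) + (\<Sum>a\<in>T. \<omega> a)"
      using cases by (intro split) fastforce
    hence "\<omega> b = - \<omega> a" using sw T0 ab by (simp add: add_eq_0_iff)
    moreover have "(\<Sum>a<K. if \<mu> a = 1/2 then p ((- 2) *\<^sub>R \<omega> a) else \<mu> a) =
        (\<Sum>a\<in>H. if \<mu> a = 1/2 then p ((- 2) *\<^sub>R \<omega> a) else \<mu> a) + (\<Sum>a\<in>T. if \<mu> a = 1/2 then p ((- 2) *\<^sub>R \<omega> a) else \<mu> a)"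
      by (intro split) auto
    moreover have "\<mu> a = 1/2" "\<mu> b = 1/2" using ab by (auto simp: H_def)
    ultimately show ?thesis using T0 ab anti[of "(- 2) *\<^sub>R \<omega> a"] by simp
  qed
qed

text \<open>Noise \<open>r\<close> in the state acts on a projective measurement like noise
  \<open>r\<close> in the measurement with the Bloch vector reversed, so the simulation becomes a
  local model with hidden distribution \<open>m\<close>.\<close>

lemma (in Bloch_model) LHS_model:
  assumes X: "\<forall>M\<in>X. is_projective_meas K M"
  shows "has_LHS_model N X {..<K} (assemblage (werner r) (\<lambda>M a. M a))"
proof -
  have "\<forall>M\<in>X. \<exists>\<mu>\<omega>. (\<forall>a<K. M a = bloch (fst \<mu>\<omega> a) (snd \<mu>\<omega> a)) \<and> bloch_pvm K (fst \<mu>\<omega>) (snd \<mu>\<omega>)"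
    using X projective_meas_bloch by simp
  from bchoice[OF this] obtain f where
    f: "\<forall>M\<in>X. (\<forall>a<K. M a = bloch (fst (f M) a) (snd (f M) a)) \<and> bloch_pvm K (fst (f M)) (snd (f M))" ..
  define \<mu> \<omega> where "\<mu> M = fst (f M)" and "\<omega> M = snd (f M)" for M
  have fM: "\<And>a. a < K \<Longrightarrow> M a = bloch (\<mu> M a) (\<omega> M a)" "bloch_pvm K (\<mu> M) (\<omega> M)" if "M \<in> X" for M
    using f that unfolding \<mu>_def \<omega>_def by blast+
  have vals: "(\<mu> M a = 0 \<and> \<omega> M a = 0) \<or> (\<mu> M a = 1 \<and> \<omega> M a = 0) \<or> (\<mu> M a = 1/2 \<and> norm (\<omega> M a) = 1/2)"
    if "M \<in> X" "a < K" for M a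
    using fM(2)[OF that(1)] that(2) unfolding bloch_pvm_def by blast
  \<comment> \<open>An outcome of weight 0 cannot be normalised; the maximally mixed state serves as
    its default.\<close>
  define \<rho> where "\<rho> i = (if m i = 0 then bloch (1/2) 0 else (1/(2 * m i)) *\<^sub>R bloch (m i) (w i))" for i
  \<comment> \<open>A rank-one projector has Bloch vector of length 1/2. The factor 2 makes it a
    unit direction and the minus sign undoes the anticorrelation; outcomes 0 and identity are
    answered deterministically.\<close>
  define q where "q M a i = (if \<mu> M a = 1/2 then p ((- 2) *\<^sub>R \<omega> M a) i else \<mu> M a)" for M a i
  have \<rho>: "m i *\<^sub>R \<rho> i = (1/2) *\<^sub>R bloch (m i) (w i)" for i
    using m[of i] by (auto simp: \<rho>_def bloch_0)
  show ?thesis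
    unfolding has_LHS_model_def
  proof (intro exI[of _ m] exI[of _ \<rho>] exI[of _ q] conjI ballI allI impI)
    fix i assume i: "i < N"
    have mi: "0 \<le> m i" using m[of i] norm_ge_zero[of "w i"] by linarith
    thus "0 \<le> m i" .
    show "is_state (\<rho> i)"
    proof (cases "m i = 0")
      case True
      thus ?thesis by (simp add: \<rho>_def is_state_def psd_bloch qtrace_bloch)
    next
      case False
      hence mp: "m i > 0" using mi by simp
      have "\<rho> i = bloch (1/2) ((1/(2 * m i)) *\<^sub>R w i)"
        using False by (simp add: \<rho>_def scaleR_bloch)
      moreover have "norm ((1/(2 * m i)) *\<^sub>R w i) \<le> 1/2"
        using m[of i] mp by (simp add: field_simps)
      ultimately show ?thesis by (simp add: is_state_def psd_bloch qtrace_bloch)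
    qed
  next
    fix M i assume M: "M \<in> X" and i: "i < N"
    show "(\<Sum>a\<in>{..<K}. q M a i) = 1"
      unfolding q_def by (rule two_halves[OF fM(2)[OF M], of "\<lambda>n. p n i"]) (rule anti)
  next
    fix M a i assume M: "M \<in> X" and a: "a \<in> {..<K}" and i: "i < N"
    have "a < K" using a by simp
    from vals[OF M this] show "0 \<le> q M a i" using p01 by (auto simp: q_def)
  next
    fix M a assume M: "M \<in> X" and a: "a \<in> {..<K}"
    hence aK: "a < K" by simp
    have "(\<Sum>i<N. (q M a i * m i) *\<^sub>R \<rho> i) = (\<Sum>i<N. (q M a i/2) *\<^sub>R bloch (m i) (w i))"
    proof (rule sum.cong[OF refl])
      fix i assume "i \<in> {..<N}"
      hence "q M a i *\<^sub>R (m i *\<^sub>R \<rho> i) = q M a i *\<^sub>R ((1/2) *\<^sub>R bloch (m i) (w i))" using \<rho> by simp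
      thus "(q M a i * m i) *\<^sub>R \<rho> i = (q M a i/2) *\<^sub>R bloch (m i) (w i)" by simp
    qed
    also have "\<dots> = bloch (\<Sum>i<N. q M a i/2 * m i) (\<Sum>i<N. (q M a i/2) *\<^sub>R w i)" by (rule sum_bloch)
    also have "\<dots> = bloch (\<mu> M a/2) (- (r/2) *\<^sub>R \<omega> M a)"
    proof (cases "\<mu> M a = 1/2")
      case True
      define n where "n = (- 2) *\<^sub>R \<omega> M a"
      have nn: "norm n = 1" using vals[OF M aK] True by (simp add: n_def)
      have "(\<Sum>i<N. q M a i/2 * m i) = (1/2) * (\<Sum>i<N. p n i * m i)"
        unfolding sum_distrib_left using True by (intro sum.cong) (auto simp: q_def n_def)
      moreover have "(\<Sum>i<N. (q M a i/2) *\<^sub>R w i) = (1/2) *\<^sub>R (\<Sum>i<N. p n i *\<^sub>R w i)"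
        unfolding scaleR_sum_right using True by (intro sum.cong) (auto simp: q_def n_def)
      ultimately show ?thesis
        by (simp only: pm[OF nn] pw[OF nn] bloch_eq_iff True) (simp add: n_def)
    next
      case False
      hence w0: "\<omega> M a = 0" using vals[OF M aK] by auto
      have "(\<Sum>i<N. q M a i/2 * m i) = (\<mu> M a/2) * (\<Sum>i<N. m i)"
        unfolding sum_distrib_left using False by (intro sum.cong) (auto simp: q_def)
      moreover have "(\<Sum>i<N. (q M a i/2) *\<^sub>R w i) = (\<mu> M a/2) *\<^sub>R (\<Sum>i<N. w i)"
        unfolding scaleR_sum_right using False by (intro sum.cong) (auto simp: q_def)
      ultimately show ?thesis by (simp only: sm sw bloch_eq_iff) (simp add: w0)
    qed
    also have "\<dots> = assemblage (werner r) (\<lambda>M a. M a) M a"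
      by (rule assemblage_werner[symmetric]) (rule fM(1)[OF M aK])
    finally show "assemblage (werner r) (\<lambda>M a. M a) M a = (\<Sum>i<N. (q M a i * m i) *\<^sub>R \<rho> i)" ..
  qed (rule sm)
qed

section \<open>From configurations to simulations\<close>

definition zonotope :: "'i set \<Rightarrow> ('i \<Rightarrow> real^3) \<Rightarrow> (real^3) set" where
  "zonotope J y = {\<Sum>i\<in>J. s i *\<^sub>R y i |s. \<forall>i\<in>J. \<bar>s i\<bar> \<le> 1}"

lemma zonotope_insert:
  assumes "finite J" "j \<notin> J"
  shows "zonotope (insert j J) y = {a + b |a b. a \<in> (\<lambda>t. t *\<^sub>R y j) ` {-1..1} \<and> b \<in> zonotope J y}"
proof (intro equalityI subsetI)
  fix z assume "z \<in> zonotope (insert j J) y"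
  then obtain s where s: "z = (\<Sum>i\<in>insert j J. s i *\<^sub>R y i)" "\<forall>i\<in>insert j J. \<bar>s i\<bar> \<le> 1"
    by (auto simp: zonotope_def)
  have "z = s j *\<^sub>R y j + (\<Sum>i\<in>J. s i *\<^sub>R y i)" using s(1) assms by simp
  moreover have "s j \<in> {-1..1}" using s(2) by (simp add: abs_le_iff)
  moreover have "(\<Sum>i\<in>J. s i *\<^sub>R y i) \<in> zonotope J y" using s(2) by (auto simp: zonotope_def)
  ultimately show "z \<in> {a + b |a b. a \<in> (\<lambda>t. t *\<^sub>R y j) ` {-1..1} \<and> b \<in> zonotope J y}" by blast
next
  fix z assume "z \<in> {a + b |a b. a \<in> (\<lambda>t. t *\<^sub>R y j) ` {-1..1} \<and> b \<in> zonotope J y}"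
  then obtain t s where ts: "t \<in> {-1..1}" "\<forall>i\<in>J. \<bar>s i\<bar> \<le> 1" "z = t *\<^sub>R y j + (\<Sum>i\<in>J. s i *\<^sub>R y i)"
    by (auto simp: zonotope_def)
  define s' where "s' = s(j := t)"
  have "(\<Sum>i\<in>J. s i *\<^sub>R y i) = (\<Sum>i\<in>J. s' i *\<^sub>R y i)"
    using assms(2) by (intro sum.cong) (auto simp: s'_def)
  hence "z = (\<Sum>i\<in>insert j J. s' i *\<^sub>R y i)" using ts(3) assms by (simp add: s'_def)
  moreover have "\<forall>i\<in>insert j J. \<bar>s' i\<bar> \<le> 1" using ts by (auto simp: s'_def)
  ultimately show "z \<in> zonotope (insert j J) y" unfolding zonotope_def by blast
qed

lemma compact_zonotope: "finite J \<Longrightarrow> compact (zonotope J y)"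
proof (induction J rule: finite_induct)
  case empty
  have "zonotope {} y = {0}" by (auto simp: zonotope_def)
  thus ?case by simp
next
  case (insert j J)
  have "compact ((\<lambda>t. t *\<^sub>R y j) ` {-1..1::real})"
    by (intro compact_continuous_image continuous_intros) auto
  from compact_sums[OF this insert.IH] show ?case unfolding zonotope_insert[OF insert.hyps] .
qed

lemma convex_zonotope: "convex (zonotope J y)"
proof (rule convexI)
  fix a b :: "real^3" and u v :: real
  assume a: "a \<in> zonotope J y" and b: "b \<in> zonotope J y" and uv: "0 \<le> u" "0 \<le> v" "u + v = 1"
  obtain s where s: "a = (\<Sum>i\<in>J. s i *\<^sub>R y i)" "\<forall>i\<in>J. \<bar>s i\<bar> \<le> 1" using a by (auto simp: zonotope_def)
  obtain t where t: "b = (\<Sum>i\<in>J. t i *\<^sub>R y i)" "\<forall>i\<in>J. \<bar>t i\<bar> \<le> 1" using b by (auto simp: zonotope_def)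
  have "u *\<^sub>R a + v *\<^sub>R b = (\<Sum>i\<in>J. (u * s i + v * t i) *\<^sub>R y i)"
    by (simp add: s(1) t(1) scaleR_sum_right sum.distrib scaleR_add_left)
  moreover have "\<bar>u * s i + v * t i\<bar> \<le> 1" if "i \<in> J" for i
  proof -
    have "\<bar>u * s i + v * t i\<bar> \<le> u * \<bar>s i\<bar> + v * \<bar>t i\<bar>"
      using abs_triangle_ineq[of "u * s i" "v * t i"] uv by (simp add: abs_mult)
    also have "\<dots> \<le> u * 1 + v * 1" using s(2) t(2) that uv by (intro add_mono mult_left_mono) auto
    finally show ?thesis using uv by simp
  qed
  ultimately show "u *\<^sub>R a + v *\<^sub>R b \<in> zonotope J y"
    unfolding zonotope_def mem_Collect_eq by (intro exI[of _ "\<lambda>i. u * s i + v * t i"]) auto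
qed

lemma ball_in_zonotope:
  assumes J: "finite J" and r: "0 \<le> r" and supp: "\<And>u. r * norm u \<le> support_sum J y u" and n: "norm n = 1"
  shows "r *\<^sub>R n \<in> zonotope J y"
proof (rule ccontr)
  assume "r *\<^sub>R n \<notin> zonotope J y"
  then obtain a b where ab: "a \<bullet> (r *\<^sub>R n) < b" "\<forall>z\<in>zonotope J y. a \<bullet> z > b"
    using separating_hyperplane_closed_point[OF convex_zonotope compact_imp_closed[OF compact_zonotope[OF J]]] by blast
  \<comment> \<open>The vertex minimising the separating functional \<open>a\<close>, with value
    \<open>- support_sum J y a\<close>.\<close>
  define s where "s i = - sgn (a \<bullet> y i)" for i
  have "(\<Sum>i\<in>J. s i *\<^sub>R y i) \<in> zonotope J y"
    unfolding zonotope_def mem_Collect_eq by (intro exI[of _ s]) (auto simp: s_def sgn_real_def)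
  hence "b < a \<bullet> (\<Sum>i\<in>J. s i *\<^sub>R y i)" using ab(2) by blast
  also have "\<dots> = (\<Sum>i\<in>J. - \<bar>a \<bullet> y i\<bar>)"
    unfolding inner_sum_right by (intro sum.cong) (auto simp: s_def sgn_real_def)
  also have "\<dots> = - support_sum J y a" by (simp add: support_sum_def sum_negf)
  also have "\<dots> \<le> - (r * norm a)" using supp[of a] by simp
  finally have "b < - (r * norm a)" .
  moreover have "\<bar>a \<bullet> (r *\<^sub>R n)\<bar> \<le> norm a * norm (r *\<^sub>R n)" by (rule Cauchy_Schwarz_ineq2)
  hence "\<bar>a \<bullet> (r *\<^sub>R n)\<bar> \<le> r * norm a" using n r by (simp add: mult.commute)
  ultimately show False using ab(1) by linarith
qed

lemma sum_even_odd: "(\<Sum>i<2 * k + 1. f i) = (\<Sum>j<k. f (2 * j) + f (2 * j + 1)) + f (2 * k)"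
  for f :: "nat \<Rightarrow> 'b :: comm_monoid_add"
  by (induction k) (simp_all add: add_ac)

text \<open>The vectors \<open>y j\<close> become the outcomes \<open>(|y j| I \<plusminus> y j \<cdot> \<sigma>)/2\<close>; the last outcome, a multiple
  of the identity, absorbs the missing mass.\<close>
lemma Bloch_model_of_configuration:
  assumes J: "finite J" and mass: "(\<Sum>i\<in>J. norm (y i)) \<le> 1" and r: "0 \<le> r"
    and supp: "\<And>u. r * norm u \<le> support_sum J y u"
  shows "\<exists>m w p. Bloch_model (2 * card J + 1) r m w p"
proof -
  define k where "k = card J"
  obtain e where e: "bij_betw e {..<k} J"
    using ex_bij_betw_nat_finite[OF J] by (auto simp: k_def lessThan_atLeast0)
  define z where "z j = y (e j)" for j
  have reidx: "(\<Sum>j<k. g (e j)) = (\<Sum>i\<in>J. g i)" for g :: "_ \<Rightarrow> 'z :: comm_monoid_add"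
    by (rule sum.reindex_bij_betw[OF e])
  have "\<forall>n. \<exists>s. norm n = 1 \<longrightarrow> (\<forall>i\<in>J. \<bar>s i\<bar> \<le> 1) \<and> r *\<^sub>R n = (\<Sum>i\<in>J. s i *\<^sub>R y i)"
  proof
    fix n :: "real^3"
    show "\<exists>s. norm n = 1 \<longrightarrow> (\<forall>i\<in>J. \<bar>s i\<bar> \<le> 1) \<and> r *\<^sub>R n = (\<Sum>i\<in>J. s i *\<^sub>R y i)"
      using ball_in_zonotope[OF J r supp, of n] unfolding zonotope_def by blast
  qed
  from choice[OF this] obtain s where
    s: "\<forall>n. norm n = 1 \<longrightarrow> (\<forall>i\<in>J. \<bar>s n i\<bar> \<le> 1) \<and> r *\<^sub>R n = (\<Sum>i\<in>J. s n i *\<^sub>R y i)" ..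
  \<comment> \<open>Antisymmetrising the coefficients in \<open>n\<close> keeps the represented
    point \<open>r *\<^sub>R n\<close> and makes the responses for \<open>n\<close> and
    \<open>- n\<close> complementary. The value 0 elsewhere preserves antisymmetry and the bound
    1.\<close>
  define t where "t n j = (if norm n = 1 \<and> j < k then (s n (e j) - s (- n) (e j))/2 else 0)" for n j
  have t_anti: "t (- n) j = - t n j" for n j
    by (auto simp: t_def field_simps)
  have t1: "\<bar>t n j\<bar> \<le> 1" for n j
  proof (cases "norm n = 1 \<and> j < k")
    case True
    hence "e j \<in> J" using e by (auto simp: bij_betw_def)
    hence "\<bar>s n (e j)\<bar> \<le> 1" "\<bar>s (- n) (e j)\<bar> \<le> 1"
      using s[rule_format, of n] s[rule_format, of "- n"] True by simp_all
    thus ?thesis using True by (simp add: t_def)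
  next
    case False
    hence "t n j = 0" unfolding t_def by (rule if_not_P)
    thus ?thesis by simp
  qed
  have tz: "(\<Sum>j<k. t n j *\<^sub>R z j) = r *\<^sub>R n" if n: "norm n = 1" for n
  proof -
    have "(\<Sum>j<k. t n j *\<^sub>R z j) = (\<Sum>j<k. (1/2) *\<^sub>R (s n (e j) *\<^sub>R y (e j) - s (- n) (e j) *\<^sub>R y (e j)))"
      using n by (intro sum.cong) (auto simp: t_def z_def scaleR_left_diff_distrib[symmetric])
    also have "\<dots> = (1/2) *\<^sub>R ((\<Sum>i\<in>J. s n i *\<^sub>R y i) - (\<Sum>i\<in>J. s (- n) i *\<^sub>R y i))"
      unfolding scaleR_sum_right[symmetric] sum_subtractf
      by (simp only: reidx[of "\<lambda>i. s n i *\<^sub>R y i"] reidx[of "\<lambda>i. s (- n) i *\<^sub>R y i"])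
    also have "\<dots> = (1/2) *\<^sub>R (r *\<^sub>R n - r *\<^sub>R (- n))"
      using s[rule_format, of n] s[rule_format, of "- n"] n by simp
    also have "\<dots> = r *\<^sub>R n" by (simp add: scaleR_2[symmetric] flip: scaleR_add_left)
    finally show ?thesis .
  qed
  define \<Sigma> where "\<Sigma> = (\<Sum>j<k. norm (z j))"
  have \<Sigma>: "\<Sigma> \<le> 1" using mass reidx[of "\<lambda>i. norm (y i)"] by (simp add: \<Sigma>_def z_def)
  \<comment> \<open>Outcomes 2j and 2j + 1 carry the vectors \<open>z j/2\<close> and
    \<open>- z j/2\<close>; the outcome 2k receives the missing mass.\<close>
  define m where "m i = (if i < 2 * k then norm (z (i div 2))/2 else 1 - \<Sigma>)" for i
  define w where "w i = (if i < 2 * k then (if even i then 1/2 else - 1/2) *\<^sub>R z (i div 2) else 0)" for i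
  define p where "p n i = (if i < 2 * k then (1 + (if even i then 1 else - 1) * t n (i div 2))/2 else 1/2)" for n i
  note expand = sum_even_odd[of _ k, folded k_def]
  have "Bloch_model (2 * k + 1) r m w p"
  proof
    show "norm (w i) \<le> m i" for i using \<Sigma> by (simp add: w_def m_def)
    show "(\<Sum>i<2 * k + 1. m i) = 1"
      unfolding expand by (simp add: m_def \<Sigma>_def)
    show "(\<Sum>i<2 * k + 1. w i) = 0"
      unfolding expand by (simp add: w_def)
    show "0 \<le> p n i \<and> p n i \<le> 1" for n i
      using t1[of n "i div 2"] by (auto simp: p_def abs_le_iff)
    show "p n i + p (- n) i = 1" for n i
      by (simp add: p_def t_anti add_divide_distrib diff_divide_distrib)
    fix n :: "real^3" assume n: "norm n = 1"
    have "(\<Sum>i<2 * k + 1. p n i * m i) = (\<Sum>j<k. norm (z j)/2) + (1 - \<Sigma>)/2"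
      unfolding expand
      by (intro arg_cong2[where f = "(+)"] sum.cong) (auto simp: p_def m_def algebra_simps add_divide_distrib diff_divide_distrib)
    also have "\<dots> = 1/2" by (simp add: \<Sigma>_def sum_divide_distrib[symmetric] diff_divide_distrib)
    finally show "(\<Sum>i<2 * k + 1. p n i * m i) = 1/2" .
    have "(\<Sum>i<2 * k + 1. p n i *\<^sub>R w i) = (\<Sum>j<k. (1/2) *\<^sub>R (t n j *\<^sub>R z j)) + 0"
      unfolding expand
    proof (intro arg_cong2[where f = "(+)"] sum.cong refl)
      fix j assume "j \<in> {..<k}"
      hence "p n (2 * j) *\<^sub>R w (2 * j) + p n (2 * j + 1) *\<^sub>R w (2 * j + 1) =
          ((1 + t n j)/2 * (1/2) + (1 - t n j)/2 * (- 1/2)) *\<^sub>R z j"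
        by (simp add: p_def w_def scaleR_left_diff_distrib)
      also have "(1 + t n j)/2 * (1/2) + (1 - t n j)/2 * (- 1/2) = 1/2 * t n j"
        by (simp add: field_simps)
      finally show "p n (2 * j) *\<^sub>R w (2 * j) + p n (2 * j + 1) *\<^sub>R w (2 * j + 1) = (1/2) *\<^sub>R (t n j *\<^sub>R z j)"
        by simp
    qed (simp add: w_def)
    also have "\<dots> = (1/2) *\<^sub>R (\<Sum>j<k. t n j *\<^sub>R z j)" by (simp only: scaleR_sum_right add_0_right)
    also have "\<dots> = (r/2) *\<^sub>R n" by (simp add: tz[OF n])
    finally show "(\<Sum>i<2 * k + 1. p n i *\<^sub>R w i) = (r/2) *\<^sub>R n" .
  qed
  thus ?thesis unfolding k_def by blast
qed

text \<open>2n + 1 outcomes with n <= 217 + X give 435 + 2X. The additive 435 is absorbed because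
  (1/2 - r)^(-4/5) >= 1.\<close>

definition size_const :: real where
  "size_const = 435 + 2 * (401 * step_const) powr (4/5)"

lemma exists_Bloch_model:
  assumes r: "0 \<le> r" "r < 1/2"
  shows "\<exists>N m w p. real N \<le> size_const * (1/2 - r) powr (-4/5) \<and> Bloch_model N r m w p"
proof -
  define sc where "sc = 401 * step_const"
  define \<delta> where "\<delta> = 1/2 - r"
  \<comment> \<open>The solution of 401 step_const X^(-5/4) = \<delta>, which is where the exponent
    4/5 arises.\<close>
  define X where "X = (sc/\<delta>) powr (4/5)"
  have sc: "sc > 0" using step_const_pos by (simp add: sc_def)
  have \<delta>: "0 < \<delta>" "\<delta> \<le> 1" using r by (simp_all add: \<delta>_def)
  have X0: "X > 0" using sc \<delta> by (simp add: X_def)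
  define n where "n = 216 + nat \<lceil>X\<rceil>"
  have n: "216 \<le> n" "X \<le> real n" "real n \<le> 217 + X"
    using X0 by (simp_all add: n_def) linarith+
  have "real n powr (-5/4) \<le> X powr (-5/4)"
    using n(2) X0 by (intro powr_mono2') auto
  also have "X powr (-5/4) = \<delta>/sc"
    using sc \<delta> by (simp add: X_def powr_powr powr_minus)
  finally have "sc * real n powr (-5/4) \<le> \<delta>" using sc by (simp add: field_simps)
  hence rn: "r \<le> 1/2 - 401 * step_const * real n powr (-5/4)" by (simp add: sc_def \<delta>_def)
  obtain J :: "cell set" and y where J: "finite J" "card J \<le> n" "(\<Sum>i\<in>J. norm (y i)) \<le> 1"
    "\<And>u. (1/2 - 401 * step_const * n powr (-5/4)) * norm u \<le> support_sum J y u"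
    by (rule exists_configuration[OF n(1)]) (rule that)
  have supp: "r * norm u \<le> support_sum J y u" for u
    by (rule order_trans[OF mult_right_mono[OF rn] J(4)]) simp
  have "real (2 * card J + 1) \<le> 435 + 2 * X" using J(2) n(3) by simp
  also have "\<dots> = 435 * 1 + 2 * sc powr (4/5) * \<delta> powr (-4/5)"
    using sc \<delta> by (simp add: X_def powr_divide powr_minus_divide)
  also have "\<dots> \<le> 435 * \<delta> powr (-4/5) + 2 * sc powr (4/5) * \<delta> powr (-4/5)"
  proof -
    have "1 powr (-4/5) \<le> \<delta> powr (-4/5)" using \<delta> by (intro powr_mono2') auto
    thus ?thesis by simp
  qed
  also have "\<dots> = (435 + 2 * sc powr (4/5)) * \<delta> powr (-4/5)" by (simp add: distrib_right)
  finally have "real (2 * card J + 1) \<le> size_const * (1/2 - r) powr (-4/5)"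
    unfolding sc_def \<delta>_def size_const_def .
  thus ?thesis using Bloch_model_of_configuration[OF J(1,3) r(1) supp] by blast
qed

theorem theorem2:
  shows "\<exists>C::real. C > 0 \<and>
    (\<forall>r::real. 0 \<le> r \<and> r < 1/2 \<longrightarrow>
       real (N_min r) \<le> C * (1/2 - r) powr (-4/5) \<and>
       (\<forall>(K::nat) (X :: (nat \<Rightarrow> qop) set).
          (\<forall>M\<in>X. is_projective_meas K M) \<longrightarrow>
          (\<exists>n. real n \<le> C * (1/2 - r) powr (-4/5) \<and>
               has_LHS_model n X {..<K} (assemblage (werner r) (\<lambda>M a. M a)))))"
proof (intro exI[of _ size_const] conjI allI impI)
  show "0 < size_const" unfolding size_const_def by (rule add_pos_nonneg) simp_all
next
  fix r :: real assume "0 \<le> r \<and> r < 1/2"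
  then obtain N m w p where N: "real N \<le> size_const * (1/2 - r) powr (-4/5)" and "Bloch_model N r m w p"
    using exists_Bloch_model by blast
  then interpret Bloch_model N r m w p by simp
  have "N_min r \<le> N"
    unfolding N_min_def using povm simulates_Pr_meas by (intro Least_le) blast
  thus "real (N_min r) \<le> size_const * (1/2 - r) powr (-4/5)" using N by linarith
  fix K :: nat and X :: "(nat \<Rightarrow> qop) set"
  assume "\<forall>M\<in>X. is_projective_meas K M"
  from LHS_model[OF this] N
  show "\<exists>n. real n \<le> size_const * (1/2 - r) powr (-4/5) \<and>
      has_LHS_model n X {..<K} (assemblage (werner r) (\<lambda>M a. M a))" by blast
qed

end
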